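(* Assume the model accuracy, preconditioner, regularity, local Lipschitz and quadratic growth conditions given in the context, and assume $\mathcal{X}^*$ is nonempty. Let $\{x_k\}$ be generated by the model-based ispPPA algorithm with stepsizes $\{\alpha_k\}$ and parameters $\{\epsilon_k\}$. Put $\eta=L_\infty^2\overline{\eta}$, $\tau=L_\infty^2\overline{\tau}$, $c_1=\mu_\infty^2\overline{c}_1$. Suppose there exist $\gamma\in\mathbb{R}_+$ and $\overline{\rho}>\eta+\tau$ such that $\alpha_{l0}k^{-\beta}\le\alpha_k\le\alpha_{u0}k^{-\beta}$ and $\epsilon_k=\gamma\alpha_k^{3/2}$ for all $k\in\mathbb{Z}_+$, where $\alpha_{l0},\alpha_{u0}\in(0,(\overline{\rho})^{-1})$ and $\beta\in(0,1]$. Let $s\in(0,2)$ be an arbitrary scalar and set $c_{\tau,\eta}=c_1-\frac{\tau+\eta}2$, $\tilde{c}_1=\frac{\overline{\rho}c_{\tau,\eta}}{\overline{\rho}+\eta}$. If $c_1>\frac{\tau+\eta}2$, then on the event that $\sup_{k\in\mathbb{Z}_+}\|x_k\|_2<\infty$, the following hold: 1. If $\beta\in(0,1)$, then $\mathbb{E}[\mathrm{dist}(x_k,\mathcal{X}^* )^2]\le\mathcal{O}(k^{-\beta})$ holds for all $k\in\mathbb{Z}_+$. 2. If $\beta=1$, then for all $k\in\mathbb{Z}_+$, $$\mathbb{E}[\mathrm{dist}(x_k,\mathcal{X}^* )^2]\le\begin{cases}\mathcal{O}\Big(k^{-\frac{2s\tilde{c}_1\alpha_{l0}}{2+s\tilde{c}_1\alpha_{l0}}}\Big)&\text{if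 }c_{\tau,\eta}\alpha_{l0}<\frac2s\left(1+\frac{\eta}{\overline{\rho}}\right),\\ \mathcal{O}(k^{-1}\ln(k))&\text{if }c_{\tau,\eta}\alpha_{l0}=\frac2s\left(1+\frac{\eta}{\overline{\rho}}\right),\\ \mathcal{O}(k^{-1})&\text{if }c_{\tau,\eta}\alpha_{l0}>\frac2s\left(1+\frac{\eta}{\overline{\rho}}\right).\end{cases}$$
   Context: Notation: $\mathbb{Z}_+=\{1,2,\dots\}$, $\mathbb{R}_+=[0,\infty)$, $\mathbb{R}_{++}=(0,\infty)$. $\mathcal{O}(\cdot)$ is the usual (asymptotic) order notation in $k$. For a self-adjoint positive-definite linear map $M$ on $\mathbb{R}^d$: $\|x\|_M^2=\langle x,Mx\rangle$, $\mathrm{dist}_M(x,X)=\inf_{y\in X}\|x-y\|_M$ (subscript omitted when $M=I_d$); for $p:\mathbb{R}^d\to(-\infty,+\infty]$ proper closed and $\alpha>0$, $\mathrm{prox}^M_{\alpha p}(x)=\arg\min_y\{p(y)+\frac1{2\alpha}\|y-x\|_M^2\}$. A proper closed $p$ is $\overline{\tau}$-weakly convex if $p+\frac{\overline{\tau}}2\|\cdot\|_2^2$ is convex; $\partial p$ is the regular (Fréchet) subdifferential. (The scalar $s\in(0,2)$ in the claim is unrelated to the sample variable $s\in\mathcal{S}$ below.) Problem: minimize $\phi(x)=F(x)+r(x)$ over $\mathbb{R}^d$, $F(x)=\mathbb{E}_{s\sim P}[f(x;s)]$, $P$ a distribution on a sample space $\mathcal{S}$, $r:\mathbb{R}^d\to(-\infty,+\infty]$.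 $\phi^*=\inf\phi$, $\mathcal{X}^*=\arg\min\phi$. Model functions: $V$ is an open convex set containing $\mathrm{dom}(r)$, and $(x,y,s)\mapsto f_x(y;s)$ is a measurable function on $V\times V\times\mathcal{S}$; $\varphi_x(y;s)=f_x(y;s)+r(y)$, with value $+\infty$ for $y\notin\mathrm{dom}(r)$. For a minibatch $S_k^{1:m}=\{S_k^i\}_{i=1}^m$: $\overline{f}_{x_k}(x;S_k^{1:m})=\frac1m\sum_{i=1}^m f_{x_k}(x;S_k^i)$, $\overline{\varphi}_{x_k}(x;S_k^{1:m})=\overline{f}_{x_k}(x;S_k^{1:m})+r(x)$. Model-based ispPPA algorithm: given $x_1$, stepsizes $\alpha_k>0$, accuracies $\epsilon_k\ge0$, minibatch size $m$ and self-adjoint positive-definite linear maps (preconditioners) $M_k$, which may depend on the sampled minibatches, at iteration $k=1,2,\dots$ draw $S_k^1,\dots,S_k^m$ i.i.d. from $P$ and let $x_{k+1}$ be an approximate minimizer of $\Phi_k(x)=\overline{\varphi}_{x_k}(x;S_k^{1:m})+\frac1{2\alpha_k}\|x-x_k\|_{M_k}^2$ satisfying one of: (a) $\|x_{k+1}-\tilde{x}_{k+1}\|_{M_k}\le\epsilon_k$, where $\tilde{x}_{k+1}=\mathrm{prox}^{M_k}_{\alpha_k\overline{\varphi}_{x_k}(\cdot;S_k^{1:m})}(x_k)$; (b) $\Phi_k(x_{k+1})-\min\Phi_k\le\frac{1-\tau\alpha_k}{2\alpha_k}\epsilon_k^2$; (c) $\mathrm{dist}_{M_k^{-1}}(0,\partial\Phi_k(x_{k+1}))\le\frac{1-\tau\alpha_k}{\alpha_k}\epsilon_k$;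 here $\tau=L_\infty^2\overline{\tau}$. $\mathcal{F}_k=\sigma(S_1^{1:m},\dots,S_k^{1:m})$ and $\mathbb{E}_k[\cdot]=\mathbb{E}[\cdot\mid\mathcal{F}_{k-1}]$. Model accuracy condition: there is a scalar $\overline{\eta}\in\mathbb{R}$ such that for $P$-almost all $s$, $f_x(x;s)=f(x;s)$ and $|f_x(y;s)-f(y;s)|\le\frac{\overline{\eta}}2\|y-x\|_2^2$ for all $x,y\in V$. Preconditioner condition: there are $\mu_\infty\in(0,1]$, $L_\infty\in[1,\infty)$ such that for every $k\in\mathbb{Z}_+$, $\mu_k\|x\|_{M_k}\le\|x\|_2\le L_k\|x\|_{M_k}$ for all $x\in\mathbb{R}^d$, with $\mu_k\in[\mu_\infty,\infty)$, $L_k\in(0,L_\infty]$; and $\rho_k^{-2}\le\mathbb{E}_k\big[\|x\|_{M_k}^2/\|x\|_{M_{k-1}}^2\big]\le\rho_k^2$ for all $x\ne0$, with $\rho_k\in[1,\infty)$ and $\nu_k=\prod_{i=0}^{k-1}\rho_i\nearrow\nu_\infty=\prod_{i=0}^\infty\rho_i<\infty$; by definition $M_0=I_d$, $\mu_0=L_0=\rho_0=1$. Regularity condition: $F:\mathbb{R}^d\to\mathbb{R}$ is locally Lipschitz, $r$ is proper closed, and for $P$-almost all $s$, $f(\cdot;s):\mathbb{R}^d\to(-\infty,+\infty]$ is proper closed with $\mathrm{dom}(f(\cdot;s))\supset\mathrm{dom}(r)$, and $\varphi_x(\cdot;s)$ is $\overline{\tau}$-weakly convex for all $x\in V$, where $\overline{\tau}\in\mathbb{R}_+$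 is a constant. Local Lipschitz condition: for any bounded subset $U\subset V$ there is a measurable $\overline{L}_{f,U}:\mathcal{S}\to\mathbb{R}_+$ with $\sqrt{\mathbb{E}_{s\sim P}[\overline{L}_{f,U}(s)^2]}\le\overline{L}_F(U)$ for some constant $\overline{L}_F(U)\in\mathbb{R}_+$ depending on $U$ such that for $P$-almost all $s$, $|f_x(x;s)-f_x(y;s)|\le\overline{L}_{f,U}(s)\|x-y\|_2$ for all $x,y\in U$. Quadratic growth condition: there is $\overline{c}_1>0$ with $\phi(x)\ge\phi^*+\overline{c}_1\,\mathrm{dist}(x,\mathcal{X}^* )^2$ for all $x\in\mathbb{R}^d$.
   Formalization: "On the event sup‖x_k‖<∞" is read as: for each R, the expectation of dist² restricted to {sup‖x_k‖≤R} has the stated order, with a constant that may depend on R; with one constant for the whole event the claim fails (e.g. for β<1/2). *)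

theory Defs
  imports "HOL-Probability.Probability" "HOL-Library.Landau_Symbols"
begin

text \<open>R^d is rendered by a type of class \<^class>\<open>euclidean_space\<close>.  Extended-valued functions are
  functions into \<^typ>\<open>ereal\<close>; they are called closed or convex according to their epigraph.\<close>

definition ereal_epi :: "('a::euclidean_space \<Rightarrow> ereal) \<Rightarrow> ('a \<times> real) set" where
  "ereal_epi p = {(x, t). p x \<le> ereal t}"

definition effective_dom :: "('a::euclidean_space \<Rightarrow> ereal) \<Rightarrow> 'a set" where
  "effective_dom p = {x. p x < \<infinity>}"

definition proper_closed :: "('a::euclidean_space \<Rightarrow> ereal) \<Rightarrow> bool" where
  "proper_closed p \<longleftrightarrow>
     (\<forall>x. p x \<noteq> -\<infinity>) \<and> (\<exists>x. p x \<noteq> \<infinity>) \<and> closed (ereal_epi p)"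

definition weakly_convex :: "real \<Rightarrow> ('a::euclidean_space \<Rightarrow> ereal) \<Rightarrow> bool" where
  "weakly_convex \<tau> p \<longleftrightarrow>
     proper_closed p \<and> convex (ereal_epi (\<lambda>x. p x + ereal (\<tau> / 2 * (norm x)\<^sup>2)))"

definition argmin_set :: "('a::euclidean_space \<Rightarrow> ereal) \<Rightarrow> 'a set" where
  "argmin_set p = {x. is_arg_min p (\<lambda>_. True) x}"

text \<open>The regular subdifferential is empty where the function is not finite.\<close>

definition regular_subdiff :: "('a::euclidean_space \<Rightarrow> ereal) \<Rightarrow> 'a \<Rightarrow> 'a set" where
  "regular_subdiff p x =
     {v. \<bar>p x\<bar> \<noteq> \<infinity> \<and>
         0 \<le> Liminf (at x) (\<lambda>y. (p y - p x - ereal (v \<bullet> (y - x))) / ereal (norm (y - x)))}"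

definition sa_pos_def :: "('a::euclidean_space \<Rightarrow> 'a) \<Rightarrow> bool" where
  "sa_pos_def M \<longleftrightarrow>
     linear M \<and> (\<forall>x y. M x \<bullet> y = x \<bullet> M y) \<and> (\<forall>x. x \<noteq> 0 \<longrightarrow> 0 < x \<bullet> M x)"

definition norm_of :: "('a::euclidean_space \<Rightarrow> 'a) \<Rightarrow> 'a \<Rightarrow> real" where
  "norm_of M x = sqrt (x \<bullet> M x)"

text \<open>Extended-valued, so that the distance to the empty set is \<^term>\<open>\<infinity> :: ereal\<close>.\<close>

definition dist_of :: "('a::euclidean_space \<Rightarrow> 'a) \<Rightarrow> 'a \<Rightarrow> 'a set \<Rightarrow> ereal" where
  "dist_of M x X = (INF y\<in>X. ereal (norm_of M (x - y)))"

definition prox_objective ::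
  "('a::euclidean_space \<Rightarrow> 'a) \<Rightarrow> real \<Rightarrow> ('a \<Rightarrow> ereal) \<Rightarrow> 'a \<Rightarrow> 'a \<Rightarrow> ereal" where
  "prox_objective M \<alpha> p x y = p y + ereal (1 / (2 * \<alpha>) * (norm_of M (y - x))\<^sup>2)"

text \<open>The set of minimizers; it is a singleton when \<open>p\<close> is weakly convex and \<open>\<alpha>\<close> is small.\<close>

definition prox_set ::
  "('a::euclidean_space \<Rightarrow> 'a) \<Rightarrow> real \<Rightarrow> ('a \<Rightarrow> ereal) \<Rightarrow> 'a \<Rightarrow> 'a set" where
  "prox_set M \<alpha> p x = argmin_set (prox_objective M \<alpha> p x)"

definition inexact_prox_step ::
  "real \<Rightarrow> ('a::euclidean_space \<Rightarrow> 'a) \<Rightarrow> real \<Rightarrow> real \<Rightarrow> ('a \<Rightarrow> ereal) \<Rightarrow> 'a \<Rightarrow> 'a \<Rightarrow> bool" where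
  "inexact_prox_step \<tau> M \<alpha> \<epsilon> p x x' \<longleftrightarrow>
     (\<exists>z\<in>prox_set M \<alpha> p x. norm_of M (x' - z) \<le> \<epsilon>) \<or>
     prox_objective M \<alpha> p x x' - (INF y. prox_objective M \<alpha> p x y)
        \<le> ereal ((1 - \<tau> * \<alpha>) / (2 * \<alpha>) * \<epsilon>\<^sup>2) \<or>
     dist_of (inv M) 0 (regular_subdiff (prox_objective M \<alpha> p x) x')
        \<le> ereal ((1 - \<tau> * \<alpha>) / \<alpha> * \<epsilon>)"

text \<open>In the following, \<open>f x s\<close> is the sample function at \<open>x\<close> and \<open>fm x y s\<close> is the value at \<open>y\<close> of
  the model function built at \<open>x\<close>.\<close>

definition expected_fun :: "'s measure \<Rightarrow> ('a::euclidean_space \<Rightarrow> 's \<Rightarrow> ereal) \<Rightarrow> 'a \<Rightarrow> real" where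
  "expected_fun P f x = (LINT s|P. real_of_ereal (f x s))"

definition objective ::
  "'s measure \<Rightarrow> ('a::euclidean_space \<Rightarrow> 's \<Rightarrow> ereal) \<Rightarrow> ('a \<Rightarrow> ereal) \<Rightarrow> 'a \<Rightarrow> ereal" where
  "objective P f r x = ereal (expected_fun P f x) + r x"

definition model_setting ::
  "'s measure \<Rightarrow> 'a set \<Rightarrow> ('a::euclidean_space \<Rightarrow> 'a \<Rightarrow> 's \<Rightarrow> real) \<Rightarrow> ('a \<Rightarrow> ereal) \<Rightarrow> bool" where
  "model_setting P V fm r \<longleftrightarrow>
     open V \<and> convex V \<and> effective_dom r \<subseteq> V \<and>
     (\<lambda>(x, y, s). fm x y s) \<in> borel_measurable
        (restrict_space borel V \<Otimes>\<^sub>M (restrict_space borel V \<Otimes>\<^sub>M P))"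

text \<open>Outside the effective domain of \<open>r\<close> this is \<^term>\<open>\<infinity> :: ereal\<close>, so values of \<open>fm\<close> outside
  \<open>V\<close> do not matter.\<close>

definition composite_model ::
  "('a::euclidean_space \<Rightarrow> 'a \<Rightarrow> 's \<Rightarrow> real) \<Rightarrow> ('a \<Rightarrow> ereal) \<Rightarrow> 'a \<Rightarrow> 's \<Rightarrow> 'a \<Rightarrow> ereal" where
  "composite_model fm r x s y = ereal (fm x y s) + r y"

definition minibatch_model ::
  "nat \<Rightarrow> ('a::euclidean_space \<Rightarrow> 'a \<Rightarrow> 's \<Rightarrow> real) \<Rightarrow> ('a \<Rightarrow> ereal) \<Rightarrow> 'a \<Rightarrow> (nat \<Rightarrow> 's) \<Rightarrow> 'a \<Rightarrow> ereal"
where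
  "minibatch_model m fm r x b y = ereal (1 / real m * (\<Sum>i=1..m. fm x y (b i))) + r y"

definition model_accuracy ::
  "'s measure \<Rightarrow> 'a set \<Rightarrow> ('a::euclidean_space \<Rightarrow> 's \<Rightarrow> ereal) \<Rightarrow> ('a \<Rightarrow> 'a \<Rightarrow> 's \<Rightarrow> real) \<Rightarrow> real \<Rightarrow> bool"
where
  "model_accuracy P V f fm \<eta> \<longleftrightarrow>
     (AE s in P. \<forall>x\<in>V. \<forall>y\<in>V. ereal (fm x x s) = f x s \<and>
        \<bar>ereal (fm x y s) - f y s\<bar> \<le> ereal (\<eta> / 2 * (norm (y - x))\<^sup>2))"

text \<open>The first line of the definition says that the expectation of \<open>f x\<close> exists as a real number.\<close>

definition regularity_condition ::
  "'s measure \<Rightarrow> 'a set \<Rightarrow> ('a::euclidean_space \<Rightarrow> 's \<Rightarrow> ereal) \<Rightarrow> ('a \<Rightarrow> 'a \<Rightarrow> 's \<Rightarrow> real) \<Rightarrow>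
   ('a \<Rightarrow> ereal) \<Rightarrow> real \<Rightarrow> bool"
where
  "regularity_condition P V f fm r \<tau> \<longleftrightarrow>
     (\<forall>x. (AE s in P. \<bar>f x s\<bar> \<noteq> \<infinity>) \<and> integrable P (\<lambda>s. real_of_ereal (f x s))) \<and>
     (\<forall>x. \<exists>e>0. \<exists>L. L-lipschitz_on (ball x e) (expected_fun P f)) \<and>
     proper_closed r \<and> 0 \<le> \<tau> \<and>
     (AE s in P. proper_closed (\<lambda>x. f x s) \<and> effective_dom r \<subseteq> effective_dom (\<lambda>x. f x s) \<and>
        (\<forall>x\<in>V. weakly_convex \<tau> (composite_model fm r x s)))"

definition local_lipschitz_condition ::
  "'s measure \<Rightarrow> 'a set \<Rightarrow> ('a::euclidean_space \<Rightarrow> 'a \<Rightarrow> 's \<Rightarrow> real) \<Rightarrow> bool" where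
  "local_lipschitz_condition P V fm \<longleftrightarrow>
     (\<forall>U. bounded U \<and> U \<subseteq> V \<longrightarrow>
       (\<exists>Lf LF. 0 \<le> LF \<and> Lf \<in> borel_measurable P \<and> (\<forall>s\<in>space P. 0 \<le> Lf s) \<and>
          integrable P (\<lambda>s. (Lf s)\<^sup>2) \<and> sqrt (LINT s|P. (Lf s)\<^sup>2) \<le> LF \<and>
          (AE s in P. \<forall>x\<in>U. \<forall>y\<in>U. \<bar>fm x x s - fm x y s\<bar> \<le> Lf s * norm (x - y))))"

definition quadratic_growth :: "('a::euclidean_space \<Rightarrow> ereal) \<Rightarrow> real \<Rightarrow> bool" where
  "quadratic_growth \<phi> c \<longleftrightarrow> 0 < c \<and>
     (\<forall>x. (INF y. \<phi> y) + ereal (c * (infdist x (argmin_set \<phi>))\<^sup>2) \<le> \<phi> x)"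

text \<open>\<open>S k i\<close> is the \<open>i\<close>-th sample drawn at iteration \<open>k\<close>, for \<open>k \<ge> 1\<close> and \<open>1 \<le> i \<le> m\<close>.\<close>

definition iid_minibatches ::
  "'w measure \<Rightarrow> 's measure \<Rightarrow> nat \<Rightarrow> (nat \<Rightarrow> nat \<Rightarrow> 'w \<Rightarrow> 's) \<Rightarrow> bool" where
  "iid_minibatches \<Omega> P m S \<longleftrightarrow>
     prob_space.indep_vars \<Omega> (\<lambda>_. P) (\<lambda>(k, i). S k i) ({1..} \<times> {1..m}) \<and>
     (\<forall>k\<ge>1. \<forall>i\<in>{1..m}. distr \<Omega> P (S k i) = P)"

text \<open>The sigma-algebra generated by the first \<open>k\<close> minibatches (trivial for \<open>k = 0\<close>).\<close>

definition minibatch_sigma ::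
  "'w measure \<Rightarrow> 's measure \<Rightarrow> nat \<Rightarrow> (nat \<Rightarrow> nat \<Rightarrow> 'w \<Rightarrow> 's) \<Rightarrow> nat \<Rightarrow> 'w measure" where
  "minibatch_sigma \<Omega> P m S k =
     sigma (space \<Omega>) (\<Union>j\<in>{1..k}. \<Union>i\<in>{1..m}. {S j i -` B \<inter> space \<Omega> | B. B \<in> sets P})"

definition preconditioner_condition ::
  "'w measure \<Rightarrow> 's measure \<Rightarrow> nat \<Rightarrow> (nat \<Rightarrow> nat \<Rightarrow> 'w \<Rightarrow> 's) \<Rightarrow>
   (nat \<Rightarrow> 'w \<Rightarrow> 'a::euclidean_space \<Rightarrow> 'a) \<Rightarrow> real \<Rightarrow> real \<Rightarrow> bool"
where
  "preconditioner_condition \<Omega> P m S M \<mu>min Lmax \<longleftrightarrow>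
     0 < \<mu>min \<and> \<mu>min \<le> 1 \<and> 1 \<le> Lmax \<and>
     (\<forall>\<omega>\<in>space \<Omega>. M 0 \<omega> = (\<lambda>v. v)) \<and>
     (\<exists>\<mu> L \<rho> :: nat \<Rightarrow> real. \<mu> 0 = 1 \<and> L 0 = 1 \<and> \<rho> 0 = 1 \<and> convergent_prod \<rho> \<and>
        (\<forall>k\<ge>1. \<mu>min \<le> \<mu> k \<and> 0 < L k \<and> L k \<le> Lmax \<and> 1 \<le> \<rho> k \<and>
           (AE \<omega> in \<Omega>. \<forall>v. \<mu> k * norm_of (M k \<omega>) v \<le> norm v \<and> norm v \<le> L k * norm_of (M k \<omega>) v) \<and>
           (\<forall>v. v \<noteq> 0 \<longrightarrow> (AE \<omega> in \<Omega>.
              1 / (\<rho> k)\<^sup>2 \<le> real_cond_exp \<Omega> (minibatch_sigma \<Omega> P m S (k - 1))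
                 (\<lambda>\<omega>. (norm_of (M k \<omega>) v)\<^sup>2 / (norm_of (M (k - 1) \<omega>) v)\<^sup>2) \<omega> \<and>
              real_cond_exp \<Omega> (minibatch_sigma \<Omega> P m S (k - 1))
                 (\<lambda>\<omega>. (norm_of (M k \<omega>) v)\<^sup>2 / (norm_of (M (k - 1) \<omega>) v)\<^sup>2) \<omega> \<le> (\<rho> k)\<^sup>2))))"

text \<open>Iterates are indexed from 1.  The iterate computed at iteration \<open>k\<close> and the preconditioner used
  there are functions of the first \<open>k\<close> minibatches.  The iterates have to stay in \<open>V\<close> because the
  models \<open>fm x\<close> are only given for \<open>x \<in> V\<close> (an inexact step may leave the effective domain of \<open>r\<close>).\<close>

definition ispPPA ::
  "'w measure \<Rightarrow> 's measure \<Rightarrow> 'a set \<Rightarrow> ('a::euclidean_space \<Rightarrow> 'a \<Rightarrow> 's \<Rightarrow> real) \<Rightarrow> ('a \<Rightarrow> ereal) \<Rightarrow>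
   real \<Rightarrow> nat \<Rightarrow> (nat \<Rightarrow> nat \<Rightarrow> 'w \<Rightarrow> 's) \<Rightarrow> (nat \<Rightarrow> 'w \<Rightarrow> 'a \<Rightarrow> 'a) \<Rightarrow>
   (nat \<Rightarrow> real) \<Rightarrow> (nat \<Rightarrow> real) \<Rightarrow> 'a \<Rightarrow> (nat \<Rightarrow> 'w \<Rightarrow> 'a) \<Rightarrow> bool"
where
  "ispPPA \<Omega> P V fm r \<tau> m S M \<alpha> \<epsilon> x1 x \<longleftrightarrow>
     m \<ge> 1 \<and> iid_minibatches \<Omega> P m S \<and>
     (\<forall>k\<ge>1. 0 < \<alpha> k \<and> 0 \<le> \<epsilon> k) \<and>
     (\<forall>k\<ge>1. \<forall>\<omega>\<in>space \<Omega>. sa_pos_def (M k \<omega>)) \<and>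
     (\<forall>k\<ge>1. \<forall>v. (\<lambda>\<omega>. M k \<omega> v) \<in> borel_measurable (minibatch_sigma \<Omega> P m S k)) \<and>
     (\<forall>\<omega>\<in>space \<Omega>. x 1 \<omega> = x1) \<and>
     (\<forall>k\<ge>1. x (k + 1) \<in> borel_measurable (minibatch_sigma \<Omega> P m S k)) \<and>
     (AE \<omega> in \<Omega>. \<forall>k\<ge>1. x k \<omega> \<in> V \<and>
        inexact_prox_step \<tau> (M k \<omega>) (\<alpha> k) (\<epsilon> k)
          (minibatch_model m fm r (x k \<omega>) (\<lambda>i. S k i \<omega>)) (x k \<omega>) (x (k + 1) \<omega>))"

text \<open>The event that the iterates are bounded is the increasing union over \<open>R\<close> of these events.\<close>

definition bounded_event :: "'w measure \<Rightarrow> (nat \<Rightarrow> 'w \<Rightarrow> 'a::euclidean_space) \<Rightarrow> real \<Rightarrow> 'w set" where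
  "bounded_event \<Omega> x R = {\<omega> \<in> space \<Omega>. (SUP k\<in>{1..}. ereal (norm (x k \<omega>))) \<le> ereal R}"

end

theory Submission
  imports Defs
begin

text \<open>Fix a bound \<open>R\<close> on the iterates and write \<open>N\<^sub>k\<close> for the norm of the preconditioner at iteration \<open>k\<close>.
The proof compares the expected squared distance to the solution set before and after one
iteration and shows that it contracts by a factor \<open>1 - c \<alpha>\<^sub>k\<close>, up to a noise term of order
\<open>\<alpha>\<^sub>k\<^sup>2\<close>, where \<open>c\<close> may be any number below \<open>2 c1 - \<tau> - \<eta>\<close>, that is, below twice \<open>c\<tau>\<eta>\<close>.  Such a
recursion produces the rates.

The contraction comes from the subproblem solved in an iteration.  It is strongly convex with
modulus \<open>1 / \<alpha>\<^sub>k - \<tau>\<close> in \<open>N\<^sub>k\<close>, so its minimizer beats every competitor \<open>y\<close> by a multiple of the squared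
distance to \<open>y\<close>.  With a solution \<open>y\<close> as competitor, the model accuracy turns the model value at \<open>y\<close>
into the optimal value, at the price of a factor \<open>1 + \<eta> \<alpha>\<^sub>k\<close>, while the quadratic growth,
applied at the new point \<open>z\<close>, contributes \<open>2 \<alpha>\<^sub>k c1\<close> times the squared distance from \<open>z\<close> to the
solutions.  The sampled model and the objective are compared at the old iterate \<open>x\<close>; moving from \<open>z\<close> back to
\<open>x\<close> costs a Lipschitz constant times \<open>\<alpha>\<^sub>k\<close> times the length of the step, which Young's inequality absorbs
into the proximal term and \<open>\<alpha>\<^sub>k\<^sup>2\<close> times the squared Lipschitz constant (lemma
\<open>model_step_growth_inequality\<close>).

Each of the three accuracy criteria gives a point within \<open>\<epsilon>\<^sub>k\<close> of the next iterate that minimizes the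
subproblem up to \<open>(1 / \<alpha>\<^sub>k - \<tau>) / 2 * \<epsilon>\<^sub>k\<^sup>2\<close> (lemma \<open>inexact_prox_step_near_minimizer\<close>).  Giving up a fraction \<open>\<delta> \<alpha>\<^sub>k\<close> of the strong
convexity pays for this, and since \<open>\<epsilon>\<^sub>k\<^sup>2\<close> is of order \<open>\<alpha>\<^sub>k\<^sup>3\<close> the cost is again of order
\<open>\<alpha>\<^sub>k\<^sup>2\<close>.

The Lipschitz constants belong to bounded sets, and whether the next iterate stays in the ball of
radius \<open>R\<close> is not decided by the past.  Therefore the distance is set to zero from the first
iterate outside the ball on.  When the next iterate leaves the ball, the left-hand side of the
one-step inequality vanishes, and the right-hand side is nonnegative by the same use of Young's
inequality, so nothing has to be known about the point outside.  What remains is compared on an event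
of the past, where the fresh samples are independent and can be averaged.

The norms change with \<open>k\<close>, and the solution set need not be convex.  The competitor \<open>y\<close> is therefore
a measurable, almost closest solution with respect to the previous norm; passing to the next
norm multiplies the expected squared distance by at most \<open>\<rho>\<^sub>k\<^sup>2\<close>, and the product of these factors is
bounded.\<close>

section \<open>Recursions with polynomially decaying steps\<close>

lemma powr_minus_Suc_ge:
  fixes p :: real
  assumes "0 \<le> p" "1 \<le> k"
  shows "real k powr (- p) * (1 - p / real k) \<le> real (k + 1) powr (- p)"
proof -
  have k: "0 < real k" using assms by simp
  have "ln (1 + 1 / real k) \<le> 1 / real k"
    using k by (intro ln_add_one_self_le_self) simp
  then have "p * ln (1 + 1 / real k) \<le> p * (1 / real k)"
    using assms(1) by (rule mult_left_mono)
  then have "1 - p / real k \<le> 1 + (- p * ln (1 + 1 / real k))" by simp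
  also have "\<dots> \<le> exp (- p * ln (1 + 1 / real k))" by (rule exp_ge_add_one_self)
  also have "\<dots> = (1 + 1 / real k) powr (- p)"
    using k by (simp add: powr_def add_pos_pos less_imp_neq[symmetric])
  finally have *: "1 - p / real k \<le> (1 + 1 / real k) powr (- p)" .
  have "real k powr (- p) * (1 - p / real k) \<le> real k powr (- p) * (1 + 1 / real k) powr (- p)"
    using * by (intro mult_left_mono) auto
  also have "\<dots> = (real k * (1 + 1 / real k)) powr (- p)"
    using k by (simp add: powr_mult)
  also have "real k * (1 + 1 / real k) = real (k + 1)" using k by (simp add: field_simps)
  finally show ?thesis .
qed

text \<open>The candidate bound \<open>D k powr (- p)\<close> decreases in one step by a factor of at least \<open>1 - p / k\<close>.  It
dominates the recursion as soon as the contraction \<open>c k powr (- \<beta>)\<close> exceeds \<open>p / k\<close> by a fixed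
multiple of \<open>k powr (- \<beta>)\<close>, because \<open>D\<close> times this surplus covers the noise when \<open>D\<close> is large and
\<open>p \<le> \<beta>\<close>.\<close>
lemma rate_of_contraction:
  fixes b :: "nat \<Rightarrow> real"
  assumes b: "\<And>k. 0 \<le> b k"
    and rec: "\<And>k. k \<ge> 1 \<Longrightarrow>
      b (k + 1) \<le> (1 - c * real k powr (- \<beta>)) * b k + C * real k powr (- 2 * \<beta>)"
    and \<beta>: "0 < \<beta>" and p: "0 \<le> p" "p \<le> \<beta>" and d: "0 < d" and C: "0 \<le> C"
    and gap: "\<forall>\<^sub>F k in sequentially. p * real k powr (\<beta> - 1) \<le> c - d"
  shows "b \<in> O(\<lambda>k. real k powr (- p))"
proof -
  have "(\<lambda>k. c * real k powr (- \<beta>)) \<longlonglongrightarrow> c * 0"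
    using \<beta> by (intro tendsto_intros tendsto_neg_powr filterlim_real_sequentially) auto
  then have "\<forall>\<^sub>F k in sequentially. c * real k powr (- \<beta>) < 1"
    by (rule order_tendstoD) simp
  with gap have "\<forall>\<^sub>F k in sequentially. k \<ge> 1 \<and> p * real k powr (\<beta> - 1) \<le> c - d \<and>
      c * real k powr (- \<beta>) < 1"
    using eventually_ge_at_top[of 1] by eventually_elim auto
  then obtain K where K: "\<And>k. k \<ge> K \<Longrightarrow> k \<ge> 1 \<and> p * real k powr (\<beta> - 1) \<le> c - d \<and>
      c * real k powr (- \<beta>) < 1"
    unfolding eventually_sequentially by blast
  \<comment> \<open>The first entry makes the surplus cover the noise, the second starts the induction at \<open>K\<close>.\<close>
  define D where "D = max (C / d) (b K * real K powr p)"
  have D: "C \<le> D * d" using d by (simp add: D_def field_simps max_def)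
  have D0: "0 \<le> D" using C d by (auto simp: D_def intro: max.coboundedI1)
  have main: "b k \<le> D * real k powr (- p)" if "k \<ge> K" for k
    using that
  proof (induction k rule: dec_induct)
    case base
    have "real K \<noteq> 0" using K[of K] by simp
    then have "b K = b K * real K powr p * real K powr (- p)"
      by (simp add: powr_minus)
    also have "\<dots> \<le> D * real K powr (- p)"
      by (intro mult_right_mono) (auto simp: D_def)
    finally show ?case .
  next
    case (step k)
    have k: "k \<ge> 1" "p * real k powr (\<beta> - 1) \<le> c - d" "c * real k powr (- \<beta>) < 1"
      using K[OF step(1)] by auto
    have k0: "0 < real k" using k(1) by simp
    have e1: "real k powr (- \<beta>) * real k powr (\<beta> - 1) = 1 / real k"
    proof -
      have "real k powr (- \<beta>) * real k powr (\<beta> - 1) = real k powr (- 1)"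
        by (simp flip: powr_add)
      then show ?thesis using k0 by (simp add: powr_minus_divide)
    qed
    have gap': "d * real k powr (- \<beta>) \<le> c * real k powr (- \<beta>) - p / real k"
    proof -
      have "real k powr (- \<beta>) * (p * real k powr (\<beta> - 1)) \<le> real k powr (- \<beta>) * (c - d)"
        using k(2) by (intro mult_left_mono) auto
      moreover have "real k powr (- \<beta>) * (p * real k powr (\<beta> - 1)) = p / real k"
        using e1 by (simp add: mult.left_commute)
      ultimately show ?thesis by (simp add: algebra_simps)
    qed
    have "real k powr (- 2 * \<beta>) = real k powr (- \<beta>) * real k powr (- \<beta>)"
      by (simp flip: powr_add)
    also have "\<dots> \<le> real k powr (- p) * real k powr (- \<beta>)"
      using p k(1) by (intro mult_right_mono powr_mono) auto
    finally have e2: "real k powr (- 2 * \<beta>) \<le> real k powr (- p) * real k powr (- \<beta>)" .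
    have "C * real k powr (- 2 * \<beta>) \<le> (D * d) * (real k powr (- p) * real k powr (- \<beta>))"
      using e2 D C by (intro mult_mono) (auto intro: order_trans)
    also have "\<dots> = D * real k powr (- p) * (d * real k powr (- \<beta>))" by simp
    also have "\<dots> \<le> D * real k powr (- p) * (c * real k powr (- \<beta>) - p / real k)"
      using gap' D0 by (intro mult_left_mono) auto
    finally have e3: "C * real k powr (- 2 * \<beta>) \<le> \<dots>" .
    have "b (Suc k) \<le> (1 - c * real k powr (- \<beta>)) * b k + C * real k powr (- 2 * \<beta>)"
      using rec[OF k(1)] by simp
    also have "(1 - c * real k powr (- \<beta>)) * b k \<le>
        (1 - c * real k powr (- \<beta>)) * (D * real k powr (- p))"
      using k(3) step.IH by (intro mult_left_mono) auto
    also have "\<dots> + C * real k powr (- 2 * \<beta>) \<le> D * (real k powr (- p) * (1 - p / real k))"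
      using e3 by (simp add: algebra_simps)
    also have "\<dots> \<le> D * real (k + 1) powr (- p)"
      using D0 powr_minus_Suc_ge[OF p(1) k(1)] by (intro mult_left_mono) auto
    finally show ?case by simp
  qed
  show ?thesis
  proof (rule bigoI)
    show "\<forall>\<^sub>F k in sequentially. norm (b k) \<le> D * norm (real k powr (- p))"
      using eventually_ge_at_top[of K] by eventually_elim (use main b in auto)
  qed
qed

lemma convergent_prod_partial_bound:
  fixes \<rho> :: "nat \<Rightarrow> real"
  assumes "convergent_prod \<rho>"
  obtains B where "\<And>n. (\<Prod>i\<le>n. \<rho> i) \<le> B"
proof -
  have "convergent (\<lambda>n. \<Prod>i\<le>n. \<rho> i)"
    by (rule convergent_prod_imp_convergent[OF assms])
  then have "Bseq (\<lambda>n. \<Prod>i\<le>n. \<rho> i)"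
    by (rule convergent_imp_Bseq)
  then obtain B where "\<And>n. norm (\<Prod>i\<le>n. \<rho> i) \<le> B"
    unfolding Bseq_def by blast
  then show ?thesis
    by (intro that[of B]) (metis real_norm_def abs_ge_self order_trans)
qed

text \<open>Dividing by the accumulated product of the \<open>\<rho>\<^sub>i\<^sup>2\<close> removes the factors \<open>\<rho>\<^sub>k\<^sup>2\<close> and keeps the order
of decay, as the products lie between 1 and a constant.  The left factor \<open>1 + u \<alpha>\<^sub>k\<close> is
then moved to the right, where boundedness of the sequence lets all second-order terms join the noise.
If \<open>\<beta> < 1\<close>, every contraction constant suffices, since \<open>1 / k\<close> is negligible against \<open>\<alpha>\<^sub>k\<close>.\<close>
lemma rate_of_preconditioned_recursion:
  fixes a \<alpha> \<rho> :: "nat \<Rightarrow> real"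
  assumes a: "\<And>k. 0 \<le> a k" "\<And>k. k \<ge> 1 \<Longrightarrow> a k \<le> A"
    and rho: "\<rho> 0 = 1" "\<And>k. k \<ge> 1 \<Longrightarrow> 1 \<le> \<rho> k" "convergent_prod \<rho>"
    and rec: "\<And>k. k \<ge> 1 \<Longrightarrow>
      (1 + u * \<alpha> k) * a (k + 1) \<le> (1 + v * \<alpha> k) * ((\<rho> k)\<^sup>2 * a k) + C * (\<alpha> k)\<^sup>2"
    and uv: "0 \<le> v" "v < u" and C: "0 \<le> C"
    and alpha: "\<And>k. k \<ge> 1 \<Longrightarrow> \<alpha>l * real k powr (- \<beta>) \<le> \<alpha> k \<and> \<alpha> k \<le> \<alpha>u * real k powr (- \<beta>)"
    and \<alpha>l: "0 < \<alpha>l" and \<beta>: "0 < \<beta>" "\<beta> \<le> 1" and p: "0 \<le> p" "p \<le> \<beta>"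
    and gap: "\<beta> < 1 \<or> p < (u - v) * \<alpha>l"
  shows "a \<in> O(\<lambda>k. real k powr (- p))"
proof -
  define Q where "Q k = (\<Prod>i<k. (\<rho> i)\<^sup>2)" for k
  have rho1: "1 \<le> \<rho> k" for k using rho(1,2) by (cases k) auto
  then have sq1: "1 \<le> (\<rho> k)\<^sup>2" for k by simp
  have Q1: "1 \<le> Q k" for k
    unfolding Q_def by (intro prod_ge_1) (use sq1 in auto)
  have Qs: "Q (k + 1) = Q k * (\<rho> k)\<^sup>2" for k
    by (simp add: Q_def)
  obtain B0 where B0: "\<And>n. (\<Prod>i\<le>n. \<rho> i) \<le> B0"
    using convergent_prod_partial_bound[OF rho(3)] by blast
  have prod0: "1 \<le> (\<Prod>i\<in>I. \<rho> i)" for I :: "nat set"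
    by (intro prod_ge_1) (use rho1 in auto)
  have QB: "Q k \<le> B0\<^sup>2" for k
  proof -
    have "(\<Prod>i<k. \<rho> i) \<le> (\<Prod>i\<le>k. \<rho> i)"
      using rho1[of k] prod0[of "{..<k}"]
      by (simp add: lessThan_Suc_atMost[symmetric] mult_le_cancel_left1)
    also have "\<dots> \<le> B0" by (rule B0)
    finally have "(\<Prod>i<k. \<rho> i)\<^sup>2 \<le> B0\<^sup>2"
      using prod0[of "{..<k}"] by (intro power_mono) auto
    then show ?thesis by (simp add: Q_def prod_power_distrib)
  qed
  define b where "b k = a k / Q k" for k
  have b0: "0 \<le> b k" for k
    using a(1)[of k] Q1[of k] by (simp add: b_def)
  have bA: "b k \<le> A" if "k \<ge> 1" for k
  proof -
    have "a k / Q k \<le> a k / 1"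
      using a(1)[of k] Q1[of k] by (intro divide_left_mono) auto
    then show ?thesis using a(2)[OF that] that by (simp add: b_def)
  qed
  have A0: "0 \<le> A" using a(1)[of 1] a(2)[of 1] by simp
  have al0: "0 < \<alpha> k" if "k \<ge> 1" for k
  proof -
    have "0 < \<alpha>l * real k powr (- \<beta>)" using \<alpha>l that by simp
    then show ?thesis using alpha[OF that] by linarith
  qed
  define C' where "C' = ((u - v) * u * A + C) * \<alpha>u\<^sup>2"
  have rec': "b (k + 1) \<le> (1 - ((u - v) * \<alpha>l) * real k powr (- \<beta>)) * b k + C' * real k powr (- 2 * \<beta>)"
    if k: "k \<ge> 1" for k
  proof -
    define t where "t = \<alpha> k"
    have t: "0 < t" using al0[OF k] by (simp add: t_def)
    have Qp: "0 < Q k" "0 < Q (k + 1)" "0 < (\<rho> k)\<^sup>2"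
      using Q1[of k] Q1[of "k + 1"] sq1[of k] by linarith+
    have u0: "0 < 1 + u * t" using t uv by (simp add: add_pos_pos)
    have "(1 + u * t) * b (k + 1) = (1 + u * t) * a (k + 1) / Q (k + 1)"
      by (simp add: b_def)
    also have "\<dots> \<le> ((1 + v * t) * ((\<rho> k)\<^sup>2 * a k) + C * t\<^sup>2) / Q (k + 1)"
      using rec[OF k] Qp by (intro divide_right_mono) (auto simp: t_def)
    also have "\<dots> = (1 + v * t) * b k + C * t\<^sup>2 / Q (k + 1)"
    proof -
      have "\<rho> k \<noteq> 0" using rho1[of k] by linarith
      then show ?thesis
        using Qp k unfolding b_def Qs by (simp add: field_simps)
    qed
    also have "C * t\<^sup>2 / Q (k + 1) \<le> C * t\<^sup>2 / 1"
      using C Q1[of "k+1"] by (intro divide_left_mono) auto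
    finally have 1: "(1 + u * t) * b (k + 1) \<le> (1 + v * t) * b k + C * t\<^sup>2" by simp
    have "(1 + v * t) * b k + C * t\<^sup>2 \<le>
        (1 + u * t) * ((1 - (u - v) * t) * b k + ((u - v) * u * A + C) * t\<^sup>2)"
    proof -
      have "(1 + u * t) * ((1 - (u - v) * t) * b k + ((u - v) * u * A + C) * t\<^sup>2)
          - ((1 + v * t) * b k + C * t\<^sup>2)
        = (u - v) * u * t\<^sup>2 * (A - b k) + u * t * (((u - v) * u * A + C) * t\<^sup>2)"
        by (simp add: algebra_simps power2_eq_square)
      moreover have "0 \<le> (u - v) * u * t\<^sup>2 * (A - b k)"
        using uv bA[OF k] by (intro mult_nonneg_nonneg) auto
      moreover have "0 \<le> u * t * (((u - v) * u * A + C) * t\<^sup>2)"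
        using uv t A0 C by (intro mult_nonneg_nonneg add_nonneg_nonneg) auto
      ultimately show ?thesis by linarith
    qed
    with 1 have "(1 + u * t) * b (k + 1) \<le> \<dots>" by linarith
    then have 2: "b (k + 1) \<le> (1 - (u - v) * t) * b k + ((u - v) * u * A + C) * t\<^sup>2"
      using u0 by simp
    have "(u - v) * (\<alpha>l * real k powr (- \<beta>)) \<le> (u - v) * t"
      using alpha[OF k] uv by (intro mult_left_mono) (auto simp: t_def)
    then have 3: "(1 - (u - v) * t) * b k \<le> (1 - ((u - v) * \<alpha>l) * real k powr (- \<beta>)) * b k"
      using b0[of k] by (intro mult_right_mono) auto
    have "t\<^sup>2 \<le> (\<alpha>u * real k powr (- \<beta>))\<^sup>2"
      using alpha[OF k] t by (intro power_mono) (auto simp: t_def)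
    also have "\<dots> = \<alpha>u\<^sup>2 * real k powr (- 2 * \<beta>)"
      by (simp add: power_mult_distrib power2_eq_square flip: powr_add)
    finally have "((u - v) * u * A + C) * t\<^sup>2 \<le>
        ((u - v) * u * A + C) * (\<alpha>u\<^sup>2 * real k powr (- 2 * \<beta>))"
      using uv A0 C by (intro mult_left_mono add_nonneg_nonneg mult_nonneg_nonneg) auto
    then have 4: "((u - v) * u * A + C) * t\<^sup>2 \<le> C' * real k powr (- 2 * \<beta>)"
      by (simp add: C'_def mult.assoc)
    show ?thesis using 2 3 4 by linarith
  qed
  have C'0: "0 \<le> C'" unfolding C'_def
    using uv A0 C by (intro mult_nonneg_nonneg add_nonneg_nonneg) auto
  have c0: "0 < (u - v) * \<alpha>l" using uv \<alpha>l by simp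
  have "\<exists>d>0. \<forall>\<^sub>F k in sequentially. p * real k powr (\<beta> - 1) \<le> (u - v) * \<alpha>l - d"
  proof (cases "\<beta> < 1")
    case True
    have "(\<lambda>k. p * real k powr (\<beta> - 1)) \<longlonglongrightarrow> p * 0"
      using True by (intro tendsto_intros tendsto_neg_powr filterlim_real_sequentially) auto
    then have "\<forall>\<^sub>F k in sequentially. p * real k powr (\<beta> - 1) < (u - v) * \<alpha>l / 2"
      by (rule order_tendstoD) (use c0 in simp)
    then have "\<forall>\<^sub>F k in sequentially. p * real k powr (\<beta> - 1) \<le> (u - v) * \<alpha>l - (u - v) * \<alpha>l / 2"
      by (rule eventually_mono) linarith
    then show ?thesis
      using c0 by (intro exI[of _ "(u - v) * \<alpha>l / 2"] conjI) simp_all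
  next
    case False
    then have [simp]: "\<beta> = 1" using \<beta> by simp
    have "p < (u - v) * \<alpha>l" using gap by simp
    moreover have "\<forall>\<^sub>F k in sequentially.
        p * real k powr (\<beta> - 1) \<le> (u - v) * \<alpha>l - ((u - v) * \<alpha>l - p)"
      using eventually_ge_at_top[of 1] by eventually_elim simp
    ultimately show ?thesis
      by (intro exI[of _ "(u - v) * \<alpha>l - p"] conjI) simp_all
  qed
  then obtain d where d: "d > 0"
    "\<forall>\<^sub>F k in sequentially. p * real k powr (\<beta> - 1) \<le> (u - v) * \<alpha>l - d" by blast
  have "b \<in> O(\<lambda>k. real k powr (- p))"
    by (rule rate_of_contraction[OF b0 rec' \<beta>(1) p d(1) C'0 d(2)])
  moreover have "a \<in> O(b)"
  proof (rule bigoI)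
    show "\<forall>\<^sub>F k in sequentially. norm (a k) \<le> B0\<^sup>2 * norm (b k)"
      using eventually_ge_at_top[of 1]
    proof eventually_elim
      case (elim k)
      have "a k = Q k * b k" using Q1[of k] elim by (simp add: b_def)
      also have "\<dots> \<le> B0\<^sup>2 * b k" using QB b0 by (intro mult_right_mono) auto
      finally show ?case using a(1) b0 by simp
    qed
  qed
  ultimately show ?thesis by (rule landau_o.big_trans[rotated])
qed

section \<open>Norms given by a positive definite map\<close>

lemma norm_of_power2:
  assumes "sa_pos_def M"
  shows "(norm_of M v)\<^sup>2 = v \<bullet> M v"
proof (cases "v = 0")
  case True
  then show ?thesis by (simp add: norm_of_def)
next
  case False
  then have "0 < v \<bullet> M v" using assms by (auto simp: sa_pos_def_def)
  then show ?thesis by (simp add: norm_of_def)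
qed

lemma norm_of_nonneg:
  assumes "sa_pos_def M"
  shows "0 \<le> norm_of M v"
  using assms unfolding norm_of_def sa_pos_def_def
  by (cases "v = 0") (auto intro: less_imp_le)

lemma sa_pos_def_id: "sa_pos_def (\<lambda>v. v)"
  by (auto simp: sa_pos_def_def linear_iff)

lemma inner_sa_pos_def_commute:
  assumes "sa_pos_def M"
  shows "v \<bullet> M u = u \<bullet> M v"
  using assms unfolding sa_pos_def_def by (metis inner_commute)

lemma norm_of_scale_add_power2:
  assumes "sa_pos_def M"
  shows "(norm_of M (a *\<^sub>R u + b *\<^sub>R v))\<^sup>2 =
    a\<^sup>2 * (norm_of M u)\<^sup>2 + b\<^sup>2 * (norm_of M v)\<^sup>2 + 2 * a * b * (u \<bullet> M v)"
proof -
  interpret linear M using assms by (simp add: sa_pos_def_def)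
  show ?thesis
    unfolding norm_of_power2[OF assms]
    using inner_sa_pos_def_commute[OF assms, of v u]
    by (simp add: add scale inner_add_left inner_add_right power2_eq_square algebra_simps)
qed

lemma norm_of_minus_commute:
  assumes "sa_pos_def M"
  shows "norm_of M (u - v) = norm_of M (v - u)"
proof -
  interpret linear M using assms by (simp add: sa_pos_def_def)
  show ?thesis by (simp add: norm_of_def diff inner_diff_left inner_diff_right)
qed

lemma norm_of_convex_combination_power2:
  assumes "sa_pos_def M"
  shows "(norm_of M ((1 - t) *\<^sub>R u + t *\<^sub>R v - w))\<^sup>2 =
    (1 - t) * (norm_of M (u - w))\<^sup>2 + t * (norm_of M (v - w))\<^sup>2 - t * (1 - t) * (norm_of M (u - v))\<^sup>2"
proof -
  have e: "(1 - t) *\<^sub>R u + t *\<^sub>R v - w = (1 - t) *\<^sub>R (u - w) + t *\<^sub>R (v - w)"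
    by (simp add: algebra_simps)
  have d: "u - v = 1 *\<^sub>R (u - w) + (-1) *\<^sub>R (v - w)" by simp
  show ?thesis
    unfolding e d norm_of_scale_add_power2[OF assms]
    by (simp add: power2_eq_square algebra_simps)
qed

text \<open>Expand the squared norm of \<open>c u + v\<close>, which is nonnegative.\<close>
lemma norm_of_young:
  assumes "sa_pos_def M" "0 < c"
  shows "- 2 * (u \<bullet> M v) \<le> c * (norm_of M u)\<^sup>2 + (norm_of M v)\<^sup>2 / c"
proof -
  have "0 \<le> (norm_of M (c *\<^sub>R u + 1 *\<^sub>R v))\<^sup>2" by simp
  also have "\<dots> = c * (c * (norm_of M u)\<^sup>2 + (norm_of M v)\<^sup>2 / c + 2 * (u \<bullet> M v))"
    unfolding norm_of_scale_add_power2[OF assms(1)]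
    using assms(2) by (simp add: power2_eq_square field_simps)
  finally have "0 \<le> c * (norm_of M u)\<^sup>2 + (norm_of M v)\<^sup>2 / c + 2 * (u \<bullet> M v)"
    using assms(2) by (simp add: zero_le_mult_iff)
  then show ?thesis by linarith
qed

lemma norm_of_add_power2_le:
  assumes "sa_pos_def M" "0 < c"
  shows "(norm_of M (u + v))\<^sup>2 \<le> (1 + c) * (norm_of M u)\<^sup>2 + (1 + 1 / c) * (norm_of M v)\<^sup>2"
proof -
  interpret linear M using assms by (simp add: sa_pos_def_def)
  have n: "norm_of M (- v) = norm_of M v" by (simp add: norm_of_def neg)
  have "- 2 * (u \<bullet> M (- v)) \<le> c * (norm_of M u)\<^sup>2 + (norm_of M (- v))\<^sup>2 / c"
    by (rule norm_of_young[OF assms])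
  then have "2 * (u \<bullet> M v) \<le> c * (norm_of M u)\<^sup>2 + (norm_of M v)\<^sup>2 / c"
    unfolding n by (simp add: neg)
  then show ?thesis
    using norm_of_scale_add_power2[OF assms(1), of 1 u 1 v] by (simp add: algebra_simps)
qed

lemma sa_pos_def_bij:
  assumes "sa_pos_def M"
  shows "surj M" "inj M"
proof -
  have l: "linear M" using assms by (simp add: sa_pos_def_def)
  show i: "inj M"
    unfolding linear_injective_0[OF l]
    using assms unfolding sa_pos_def_def by (metis inner_zero_right less_irrefl)
  show "surj M" using l i by (rule linear_inj_imp_surj)
qed

section \<open>Strong convexity and inexact proximal steps\<close>

text \<open>Real-valued functions on a convex set replace extended-valued functions: the set plays the role of
the effective domain.  The modulus is measured in the norm of \<open>M\<close>.\<close>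
definition strongly_convex_on ::
  "('a::euclidean_space \<Rightarrow> 'a) \<Rightarrow> real \<Rightarrow> 'a set \<Rightarrow> ('a \<Rightarrow> real) \<Rightarrow> bool" where
  "strongly_convex_on M \<kappa> D g \<longleftrightarrow> convex D \<and>
     (\<forall>u\<in>D. \<forall>v\<in>D. \<forall>t\<in>{0..1}. g ((1 - t) *\<^sub>R u + t *\<^sub>R v) \<le>
        (1 - t) * g u + t * g v - \<kappa> / 2 * (t * (1 - t)) * (norm_of M (u - v))\<^sup>2)"

lemma strongly_convex_onD:
  assumes "strongly_convex_on M \<kappa> D g" "u \<in> D" "v \<in> D" "0 \<le> t" "t \<le> 1"
  shows "g ((1 - t) *\<^sub>R u + t *\<^sub>R v) \<le>
        (1 - t) * g u + t * g v - \<kappa> / 2 * (t * (1 - t)) * (norm_of M (u - v))\<^sup>2"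
    and "(1 - t) *\<^sub>R u + t *\<^sub>R v \<in> D"
  using assms unfolding strongly_convex_on_def by (auto intro: convexD_alt)

text \<open>An approximate minimizer still beats every competitor quadratically.  The parameter \<open>\<theta>\<close> trades a
fraction of the modulus against the magnification \<open>1 / \<theta>\<close> of the error; it comes from comparing \<open>z\<close> with
the point that lies a fraction \<open>\<theta>\<close> of the way towards \<open>y\<close>.\<close>
lemma strongly_convex_on_near_minimizer:
  assumes g: "strongly_convex_on M \<kappa> D g" and z: "z \<in> D" "\<And>u. u \<in> D \<Longrightarrow> g z \<le> g u + \<xi>"
    and y: "y \<in> D" and \<theta>: "0 < \<theta>" "\<theta> < 1"
  shows "g z + \<kappa> / 2 * (1 - \<theta>) * (norm_of M (z - y))\<^sup>2 \<le> g y + \<xi> / \<theta>"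
proof -
  have "g z \<le> g ((1 - \<theta>) *\<^sub>R z + \<theta> *\<^sub>R y) + \<xi>"
    using \<theta> by (intro z(2) strongly_convex_onD[OF g] z y) auto
  also have "\<dots> \<le> (1 - \<theta>) * g z + \<theta> * g y - \<kappa> / 2 * (\<theta> * (1 - \<theta>)) * (norm_of M (z - y))\<^sup>2 + \<xi>"
    using \<theta> strongly_convex_onD(1)[OF g z(1) y, of \<theta>] by simp
  finally have "\<theta> * (g z + \<kappa> / 2 * (1 - \<theta>) * (norm_of M (z - y))\<^sup>2) \<le> \<theta> * (g y + \<xi> / \<theta>)"
    using \<theta> by (simp add: algebra_simps)
  then show ?thesis using \<theta> by simp
qed

lemma weakly_convex_imp_real:
  assumes w: "weakly_convex \<tau> p" and p: "\<And>y. p y = (if y \<in> D then ereal (g y) else \<infinity>)"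
  shows "convex D"
    and "\<And>u v t. \<lbrakk>u \<in> D; v \<in> D; 0 \<le> t; t \<le> 1\<rbrakk> \<Longrightarrow>
      g ((1 - t) *\<^sub>R u + t *\<^sub>R v) \<le> (1 - t) * g u + t * g v + \<tau> / 2 * (t * (1 - t)) * (norm (u - v))\<^sup>2"
proof -
  let ?q = "\<lambda>x. p x + ereal (\<tau> / 2 * (norm x)\<^sup>2)"
  have cv: "convex (ereal_epi ?q)" using w by (simp add: weakly_convex_def)
  have main: "(1 - t) *\<^sub>R u + t *\<^sub>R v \<in> D \<and>
      g ((1 - t) *\<^sub>R u + t *\<^sub>R v) \<le> (1 - t) * g u + t * g v + \<tau> / 2 * (t * (1 - t)) * (norm (u - v))\<^sup>2"
    if h: "u \<in> D" "v \<in> D" "0 \<le> t" "t \<le> 1" for u v t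
  proof -
    let ?w = "(1 - t) *\<^sub>R u + t *\<^sub>R v"
    have "(u, g u + \<tau> / 2 * (norm u)\<^sup>2) \<in> ereal_epi ?q" "(v, g v + \<tau> / 2 * (norm v)\<^sup>2) \<in> ereal_epi ?q"
      using h p by (auto simp: ereal_epi_def)
    from convexD_alt[OF cv this h(3,4)]
    have e: "p ?w + ereal (\<tau> / 2 * (norm ?w)\<^sup>2) \<le>
        ereal ((1 - t) * (g u + \<tau> / 2 * (norm u)\<^sup>2) + t * (g v + \<tau> / 2 * (norm v)\<^sup>2))"
      by (simp add: ereal_epi_def)
    then have D: "?w \<in> D" by (cases "?w \<in> D") (auto simp: p)
    with e have e': "g ?w + \<tau> / 2 * (norm ?w)\<^sup>2 \<le>
        (1 - t) * (g u + \<tau> / 2 * (norm u)\<^sup>2) + t * (g v + \<tau> / 2 * (norm v)\<^sup>2)"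
      by (simp add: p)
    have n: "norm_of (\<lambda>v. v) z = norm z" for z :: 'a
      by (simp add: norm_of_def norm_eq_sqrt_inner)
    have "(norm ?w)\<^sup>2 = (1 - t) * (norm u)\<^sup>2 + t * (norm v)\<^sup>2 - t * (1 - t) * (norm (u - v))\<^sup>2"
      using norm_of_convex_combination_power2[OF sa_pos_def_id, of t u v 0] by (simp add: n)
    then have "\<tau> / 2 * (norm ?w)\<^sup>2 =
      \<tau> / 2 * ((1 - t) * (norm u)\<^sup>2 + t * (norm v)\<^sup>2 - t * (1 - t) * (norm (u - v))\<^sup>2)" by simp
    moreover have "h * ((1 - t) * a + t * b - t * (1 - t) * c) =
        (1 - t) * (h * a) + t * (h * b) - h * (t * (1 - t)) * c" for h a b c :: real
      by (simp add: algebra_simps)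
    note this[of "\<tau> / 2" "(norm u)\<^sup>2" "(norm v)\<^sup>2" "(norm (u - v))\<^sup>2"]
    moreover have "(1 - t) * (g u + \<tau> / 2 * (norm u)\<^sup>2) + t * (g v + \<tau> / 2 * (norm v)\<^sup>2) =
      (1 - t) * g u + t * g v + ((1 - t) * (\<tau> / 2 * (norm u)\<^sup>2) + t * (\<tau> / 2 * (norm v)\<^sup>2))"
      by (simp add: distrib_left)
    ultimately have "g ?w \<le> (1 - t) * g u + t * g v + \<tau> / 2 * (t * (1 - t)) * (norm (u - v))\<^sup>2"
      using e' by linarith
    with D show ?thesis by simp
  qed
  show "convex D" unfolding convex_alt using main by blast
  show "\<And>u v t. \<lbrakk>u \<in> D; v \<in> D; 0 \<le> t; t \<le> 1\<rbrakk> \<Longrightarrow>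
      g ((1 - t) *\<^sub>R u + t *\<^sub>R v) \<le> (1 - t) * g u + t * g v + \<tau> / 2 * (t * (1 - t)) * (norm (u - v))\<^sup>2"
    using main by blast
qed

text \<open>The concavity allowed by weak convexity is measured in the Euclidean norm, which is at most \<open>L\<close>
times the norm of \<open>M\<close>; the proximal term has modulus \<open>1 / \<alpha>\<close> in the latter.\<close>
lemma strongly_convex_on_prox_objective:
  assumes M: "sa_pos_def M" and D: "convex D" and \<tau>b: "0 \<le> \<tau>b"
    and g: "\<And>u v t. \<lbrakk>u \<in> D; v \<in> D; 0 \<le> t; t \<le> 1\<rbrakk> \<Longrightarrow>
      g ((1 - t) *\<^sub>R u + t *\<^sub>R v) \<le> (1 - t) * g u + t * g v + \<tau>b / 2 * (t * (1 - t)) * (norm (u - v))\<^sup>2"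
    and L: "\<And>v. norm v \<le> L * norm_of M v"
  shows "strongly_convex_on M (1 / \<alpha> - L\<^sup>2 * \<tau>b) D (\<lambda>y. g y + 1 / (2 * \<alpha>) * (norm_of M (y - x))\<^sup>2)"
  unfolding strongly_convex_on_def
proof (intro conjI ballI D)
  fix u v t assume h: "u \<in> D" "v \<in> D" "t \<in> {0..1::real}"
  let ?w = "(1 - t) *\<^sub>R u + t *\<^sub>R v"
  let ?n = "\<lambda>v. (norm_of M v)\<^sup>2"
  have "(norm (u - v))\<^sup>2 \<le> (L * norm_of M (u - v))\<^sup>2"
    using L by (intro power_mono) auto
  then have "\<tau>b / 2 * (t * (1 - t)) * (norm (u - v))\<^sup>2 \<le>
      \<tau>b / 2 * (t * (1 - t)) * (L\<^sup>2 * ?n (u - v))"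
    using \<tau>b h by (intro mult_left_mono) (auto simp: power_mult_distrib)
  moreover have "g ?w \<le> (1 - t) * g u + t * g v + \<tau>b / 2 * (t * (1 - t)) * (norm (u - v))\<^sup>2"
    using h by (intro g) auto
  moreover have "1 / (2 * \<alpha>) * ?n (?w - x) = 1 / (2 * \<alpha>) *
      ((1 - t) * ?n (u - x) + t * ?n (v - x) - t * (1 - t) * ?n (u - v))"
    by (simp add: norm_of_convex_combination_power2[OF M])
  ultimately have "g ?w + 1 / (2 * \<alpha>) * ?n (?w - x) \<le>
     (1 - t) * g u + t * g v + \<tau>b / 2 * (t * (1 - t)) * (L\<^sup>2 * ?n (u - v)) +
     1 / (2 * \<alpha>) * ((1 - t) * ?n (u - x) + t * ?n (v - x) - t * (1 - t) * ?n (u - v))"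
    by linarith
  also have "\<dots> = (1 - t) * (g u + 1 / (2 * \<alpha>) * ?n (u - x)) + t * (g v + 1 / (2 * \<alpha>) * ?n (v - x))
      - (1 / \<alpha> - L\<^sup>2 * \<tau>b) / 2 * (t * (1 - t)) * ?n (u - v)"
  proof -
    define b where "b = 1 / (2 * \<alpha>)"
    define c where "c = \<tau>b / 2"
    have "(1 / \<alpha> - L\<^sup>2 * \<tau>b) / 2 = b - c * L\<^sup>2" by (simp add: b_def c_def diff_divide_distrib mult.commute)
    then show ?thesis
      unfolding b_def[symmetric] c_def[symmetric] by (simp only:) (simp add: algebra_simps)
  qed
  finally show "g ?w + 1 / (2 * \<alpha>) * ?n (?w - x) \<le> \<dots>" .
qed

text \<open>A regular subgradient bounds the function only near \<open>x\<close>.  Strong convexity along the segment from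
\<open>x\<close> to \<open>y\<close> carries the bound from points close to \<open>x\<close> to \<open>y\<close>.\<close>
lemma regular_subgradient_strongly_convex:
  assumes g: "strongly_convex_on M \<kappa> D g"
    and p: "\<And>y. p y = (if y \<in> D then ereal (g y) else \<infinity>)"
    and v: "v \<in> regular_subdiff p x"
  shows "x \<in> D"
    and "y \<in> D \<Longrightarrow> g x + v \<bullet> (y - x) + \<kappa> / 2 * (norm_of M (x - y))\<^sup>2 \<le> g y"
proof -
  show x: "x \<in> D" using v by (auto simp: regular_subdiff_def p split: if_splits)
  assume y: "y \<in> D"
  show "g x + v \<bullet> (y - x) + \<kappa> / 2 * (norm_of M (x - y))\<^sup>2 \<le> g y"
  proof (cases "y = x")
    case True
    then show ?thesis by (simp add: norm_of_def)
  next
    case False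
    define d where "d = y - x"
    have d0: "0 < norm d" using False by (simp add: d_def)
    define K where "K = \<kappa> / 2 * (norm_of M (x - y))\<^sup>2"
    have lim: "((\<lambda>t. g y - g x - v \<bullet> d - (1 - t) * K + e * norm d) \<longlongrightarrow>
        g y - g x - v \<bullet> d - (1 - 0) * K + e * norm d) (at_right 0)" for e
      by (intro tendsto_intros)
    have pos: "0 \<le> g y - g x - v \<bullet> d - K + e * norm d" if e: "0 < e" for e
    proof -
      have "- ereal e < 0" using e by simp
      then have ev: "\<forall>\<^sub>F y in at x. - ereal e < (p y - p x - ereal (v \<bullet> (y - x))) / ereal (norm (y - x))"
        using v unfolding regular_subdiff_def le_Liminf_iff by auto
      have "filterlim (\<lambda>t. x + t *\<^sub>R d) (at x) (at_right 0)"
        unfolding filterlim_at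
      proof
        show "\<forall>\<^sub>F t in at_right 0. x + t *\<^sub>R d \<in> UNIV \<and> x + t *\<^sub>R d \<noteq> x"
          using d0 by (auto simp: eventually_at_filter)
        have "((\<lambda>t. x + t *\<^sub>R d) \<longlongrightarrow> x + 0 *\<^sub>R d) (at_right 0)"
          by (intro tendsto_intros)
        then show "((\<lambda>t. x + t *\<^sub>R d) \<longlongrightarrow> x) (at_right 0)" by simp
      qed
      with ev have "\<forall>\<^sub>F t in at_right 0. - ereal e <
          (p (x + t *\<^sub>R d) - p x - ereal (v \<bullet> (t *\<^sub>R d))) / ereal (norm (t *\<^sub>R d))"
        unfolding filterlim_iff by fastforce
      moreover have "\<forall>\<^sub>F t in at_right 0. 0 < t \<and> t < (1::real)"
        using eventually_at_right_real[of 0 1] by simp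
      ultimately have "\<forall>\<^sub>F t in at_right 0. 0 \<le> g y - g x - v \<bullet> d - (1 - t) * K + e * norm d"
      proof eventually_elim
        case (elim t)
        have xt: "x + t *\<^sub>R d = (1 - t) *\<^sub>R x + t *\<^sub>R y" by (simp add: d_def algebra_simps)
        have D: "x + t *\<^sub>R d \<in> D"
          unfolding xt using elim by (intro strongly_convex_onD(2)[OF g x y]) auto
        have "g (x + t *\<^sub>R d) \<le> (1 - t) * g x + t * g y - \<kappa> / 2 * (t * (1 - t)) * (norm_of M (x - y))\<^sup>2"
          unfolding xt using elim by (intro strongly_convex_onD(1)[OF g x y]) auto
        then have 1: "g (x + t *\<^sub>R d) - g x - t * (v \<bullet> d) \<le> t * (g y - g x - v \<bullet> d - (1 - t) * K)"
          by (simp add: K_def algebra_simps)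
        have "- e < (g (x + t *\<^sub>R d) - g x - t * (v \<bullet> d)) / (t * norm d)"
          using elim D x d0 by (simp add: p)
        then have "- e * (t * norm d) < g (x + t *\<^sub>R d) - g x - t * (v \<bullet> d)"
          using elim d0 by (subst (asm) pos_less_divide_eq) auto
        with 1 have "0 \<le> t * (g y - g x - v \<bullet> d - (1 - t) * K + e * norm d)"
          by (simp add: algebra_simps)
        then show ?case using elim by (simp add: zero_le_mult_iff)
      qed
      then have "0 \<le> g y - g x - v \<bullet> d - (1 - 0) * K + e * norm d"
        by (intro tendsto_lowerbound[OF lim]) auto
      then show ?thesis by simp
    qed
    have "0 \<le> g y - g x - v \<bullet> d - K"
    proof (rule field_le_epsilon)
      fix e :: real assume "0 < e"
      then show "0 \<le> g y - g x - v \<bullet> d - K + e"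
        using pos[of "e / norm d"] d0 by simp
    qed
    then show ?thesis by (simp add: K_def d_def)
  qed
qed

text \<open>The three accuracy criteria become one.  Under the first, \<open>z\<close> is the exact minimizer; under the others
\<open>z\<close> is the computed point itself.  In the subgradient criterion, a subgradient \<open>M w\<close> and strong convexity
bound the function from below by a quadratic whose minimum is the value at the computed point
minus the squared norm of \<open>w\<close> over twice the modulus, and the criterion bounds the norm of \<open>w\<close>.\<close>
lemma inexact_prox_step_near_minimizer:
  assumes M: "sa_pos_def M" and \<alpha>: "0 < \<alpha>" "\<tau> * \<alpha> < 1" and \<epsilon>: "0 \<le> \<epsilon>"
    and g: "strongly_convex_on M (1 / \<alpha> - \<tau>) D g" and D: "D \<noteq> {}"
    and p: "\<And>y. prox_objective M \<alpha> p x y = (if y \<in> D then ereal (g y) else \<infinity>)"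
    and step: "inexact_prox_step \<tau> M \<alpha> \<epsilon> p x x'"
  obtains z where "z \<in> D" "norm_of M (x' - z) \<le> \<epsilon>"
    "\<And>u. u \<in> D \<Longrightarrow> g z \<le> g u + (1 / \<alpha> - \<tau>) / 2 * \<epsilon>\<^sup>2"
proof -
  define \<kappa> where "\<kappa> = 1 / \<alpha> - \<tau>"
  have \<kappa>: "0 < \<kappa>" using \<alpha> by (simp add: \<kappa>_def field_simps)
  have n0: "norm_of M 0 = 0" by (simp add: norm_of_def)
  let ?\<Phi> = "prox_objective M \<alpha> p x"
  from step consider (a) z where "z \<in> prox_set M \<alpha> p x" "norm_of M (x' - z) \<le> \<epsilon>"
    | (b) "?\<Phi> x' - (INF y. ?\<Phi> y) \<le> ereal ((1 - \<tau> * \<alpha>) / (2 * \<alpha>) * \<epsilon>\<^sup>2)"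
    | (c) "dist_of (inv M) 0 (regular_subdiff ?\<Phi> x') \<le> ereal ((1 - \<tau> * \<alpha>) / \<alpha> * \<epsilon>)"
    unfolding inexact_prox_step_def by blast
  then show ?thesis
  proof cases
    case a
    have zmin: "\<not> ?\<Phi> u < ?\<Phi> z" for u
      using a(1) by (auto simp: prox_set_def argmin_set_def is_arg_min_def)
    obtain u0 where "u0 \<in> D" using D by blast
    with zmin[of u0] have z: "z \<in> D" by (auto simp: p split: if_splits)
    have "g z \<le> g u + \<kappa> / 2 * \<epsilon>\<^sup>2" if "u \<in> D" for u
    proof -
      have "0 \<le> \<kappa> / 2 * \<epsilon>\<^sup>2" using \<kappa> by simp
      moreover have "g z \<le> g u" using zmin[of u] that z by (simp add: p)
      ultimately show ?thesis by linarith
    qed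
    then show ?thesis using that[OF z a(2)] by (simp add: \<kappa>_def)
  next
    case b
    have xD: "x' \<in> D"
    proof (rule ccontr)
      assume "x' \<notin> D"
      moreover obtain u0 where "u0 \<in> D" using D by blast
      then have "(INF y. ?\<Phi> y) \<le> ereal (g u0)"
        by (intro INF_lower2[of u0]) (auto simp: p)
      ultimately show False using b by (cases "INF y. ?\<Phi> y") (auto simp: p)
    qed
    have "g x' \<le> g u + \<kappa> / 2 * \<epsilon>\<^sup>2" if u: "u \<in> D" for u
    proof -
      have i: "(INF y. ?\<Phi> y) \<le> ereal (g u)"
        using u by (intro INF_lower2[of u]) (auto simp: p)
      have "(1 - \<tau> * \<alpha>) / (2 * \<alpha>) = \<kappa> / 2" using \<alpha> by (simp add: \<kappa>_def field_simps)
      then have "?\<Phi> x' - (INF y. ?\<Phi> y) \<le> ereal (\<kappa> / 2 * \<epsilon>\<^sup>2)" using b by (simp only:)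
      then show ?thesis using i xD by (cases "INF y. ?\<Phi> y") (auto simp: p simp del: times_divide_eq_left)
    qed
    then show ?thesis using that[OF xD] \<epsilon> n0 by (simp add: \<kappa>_def)
  next
    case c
    have \<kappa>': "(1 - \<tau> * \<alpha>) / \<alpha> = \<kappa>" using \<alpha> by (simp add: \<kappa>_def field_simps)
    \<comment> \<open>The distance is an infimum, so the subgradient is only found up to \<open>e\<close>.\<close>
    have bound: "x' \<in> D \<and> (\<forall>u\<in>D. g x' \<le> g u + (\<kappa> * \<epsilon> + e)\<^sup>2 / (2 * \<kappa>))" if e: "0 < e" for e
    proof -
      have "dist_of (inv M) 0 (regular_subdiff ?\<Phi> x') < ereal (\<kappa> * \<epsilon> + e)"
        using c e unfolding \<kappa>' by (rule_tac le_less_trans) auto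
      then obtain v where v: "v \<in> regular_subdiff ?\<Phi> x'" "norm_of (inv M) (0 - v) < \<kappa> * \<epsilon> + e"
        unfolding dist_of_def INF_less_iff by auto
      obtain w where w: "v = M w" using sa_pos_def_bij[OF M] by blast
      have "linear M" using M by (simp add: sa_pos_def_def)
      then have mw: "- v = M (- w)" using w by (simp add: linear_neg)
      have "norm_of (inv M) (0 - v) = norm_of M w"
      proof -
        have "inv M (0 - v) = - w"
          using inv_f_f[OF sa_pos_def_bij(2)[OF M], of "- w"] mw by simp
        then show ?thesis by (simp add: norm_of_def w inner_commute)
      qed
      then have "(norm_of M w)\<^sup>2 \<le> (\<kappa> * \<epsilon> + e)\<^sup>2"
        using v norm_of_nonneg[OF M, of w] by (intro power_mono) auto
      then have w2: "(norm_of M w)\<^sup>2 / \<kappa> \<le> (\<kappa> * \<epsilon> + e)\<^sup>2 / \<kappa>"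
        using \<kappa> by (intro divide_right_mono) auto
      have "g x' \<le> g u + (\<kappa> * \<epsilon> + e)\<^sup>2 / (2 * \<kappa>)" if u: "u \<in> D" for u
      proof -
        have "g x' + v \<bullet> (u - x') + \<kappa> / 2 * (norm_of M (x' - u))\<^sup>2 \<le> g u"
          using regular_subgradient_strongly_convex(2)[OF g p v(1) u] by (simp add: \<kappa>_def)
        moreover have "- 2 * ((u - x') \<bullet> M w) \<le> \<kappa> * (norm_of M (u - x'))\<^sup>2 + (norm_of M w)\<^sup>2 / \<kappa>"
          by (rule norm_of_young[OF M \<kappa>])
        moreover have "(\<kappa> * \<epsilon> + e)\<^sup>2 / (2 * \<kappa>) = (\<kappa> * \<epsilon> + e)\<^sup>2 / \<kappa> / 2" by simp
        ultimately show ?thesis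
          using w2 norm_of_minus_commute[OF M, of u x'] by (simp add: w inner_commute)
      qed
      then show ?thesis
        using regular_subgradient_strongly_convex(1)[OF g p v(1)] by blast
    qed
    have xD: "x' \<in> D" using bound[of 1] by simp
    have "g x' \<le> g u + \<kappa> / 2 * \<epsilon>\<^sup>2" if u: "u \<in> D" for u
    proof -
      have "((\<lambda>e. g u + (\<kappa> * \<epsilon> + e)\<^sup>2 / (2 * \<kappa>)) \<longlongrightarrow> g u + (\<kappa> * \<epsilon> + 0)\<^sup>2 / (2 * \<kappa>)) (at_right 0)"
        using \<kappa> by (intro tendsto_intros) auto
      moreover have "\<forall>\<^sub>F e in at_right 0. g x' \<le> g u + (\<kappa> * \<epsilon> + e)\<^sup>2 / (2 * \<kappa>)"
        using eventually_at_right_less by (rule eventually_mono) (use bound u in auto)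
      ultimately have "g x' \<le> g u + (\<kappa> * \<epsilon> + 0)\<^sup>2 / (2 * \<kappa>)"
        by (rule tendsto_lowerbound) simp
      also have "(\<kappa> * \<epsilon> + 0)\<^sup>2 / (2 * \<kappa>) = \<kappa> / 2 * \<epsilon>\<^sup>2"
        using \<kappa> by (simp add: power2_eq_square)
      finally show ?thesis .
    qed
    then show ?thesis using that[OF xD] \<epsilon> n0 by (simp add: \<kappa>_def)
  qed
qed

section \<open>Sampling and changing norms\<close>

lemma space_minibatch_sigma [simp]: "space (minibatch_sigma \<Omega> P m S k) = space \<Omega>"
  unfolding minibatch_sigma_def by (rule space_measure_of) auto

lemma sets_minibatch_sigma:
  "sets (minibatch_sigma \<Omega> P m S k) =
    sigma_sets (space \<Omega>) (\<Union>j\<in>{1..k}. \<Union>i\<in>{1..m}. {S j i -` B \<inter> space \<Omega> | B. B \<in> sets P})"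
  unfolding minibatch_sigma_def by (rule sets_measure_of) auto

lemma subalgebra_minibatch_sigma_mono:
  assumes "j \<le> k"
  shows "subalgebra (minibatch_sigma \<Omega> P m S k) (minibatch_sigma \<Omega> P m S j)"
  unfolding subalgebra_def sets_minibatch_sigma
  using assms by (auto intro!: sigma_sets_mono') force

lemma iid_minibatches_measurable:
  assumes "prob_space \<Omega>" "iid_minibatches \<Omega> P m S" "k \<ge> 1" "i \<in> {1..m}"
  shows "S k i \<in> measurable \<Omega> P" "distr \<Omega> P (S k i) = P"
proof -
  interpret prob_space \<Omega> by fact
  have "\<forall>j\<in>{1..} \<times> {1..m}. random_variable P ((\<lambda>(k, i). S k i) j)"
    using assms(2) unfolding iid_minibatches_def indep_vars_def2 by simp
  then show "S k i \<in> measurable \<Omega> P" using assms(3,4) by force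
  show "distr \<Omega> P (S k i) = P" using assms unfolding iid_minibatches_def by auto
qed

lemma subalgebra_minibatch_sigma:
  assumes "prob_space \<Omega>" "iid_minibatches \<Omega> P m S"
  shows "subalgebra \<Omega> (minibatch_sigma \<Omega> P m S k)"
  unfolding subalgebra_def sets_minibatch_sigma
proof (intro conjI space_minibatch_sigma sets.sigma_sets_subset subsetI)
  fix A assume "A \<in> (\<Union>j\<in>{1..k}. \<Union>i\<in>{1..m}. {S j i -` B \<inter> space \<Omega> | B. B \<in> sets P})"
  then show "A \<in> sets \<Omega>"
    using iid_minibatches_measurable(1)[OF assms] by (auto intro: measurable_sets)
qed

text \<open>Independence of the past and a fresh sample, stated as a product distribution because the two take
values in different types.  It follows from the joint independence of all samples by grouping
them into those of earlier iterations and the given one.\<close>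
lemma distr_past_and_minibatch:
  fixes Z :: "'w \<Rightarrow> 'n"
  assumes \<Omega>: "prob_space \<Omega>" and iid: "iid_minibatches \<Omega> P m S" and k: "k \<ge> 1" and i: "i \<in> {1..m}"
    and Z: "Z \<in> measurable (minibatch_sigma \<Omega> P m S (k - 1)) N"
  shows "distr \<Omega> N Z \<Otimes>\<^sub>M P = distr \<Omega> (N \<Otimes>\<^sub>M P) (\<lambda>\<omega>. (Z \<omega>, S k i \<omega>))"
proof -
  interpret prob_space \<Omega> by fact
  let ?E = "\<lambda>j. {(\<lambda>(k, i). S k i) j -` B \<inter> space \<Omega> | B. B \<in> sets P}"
  let ?I = "case_bool ({1..k - 1} \<times> {1..m}) {(k, i)}"
  have "indep_sets ?E ({1..} \<times> {1..m})"
    using iid unfolding iid_minibatches_def indep_vars_def2 by simp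
  then have ind: "indep_sets ?E (\<Union>j\<in>UNIV. ?I j)"
    by (rule indep_sets_mono_index[rotated]) (use k i in \<open>auto split: bool.splits\<close>)
  have "indep_sets (\<lambda>j. sigma_sets (space \<Omega>) (\<Union>i\<in>?I j. ?E i)) UNIV"
  proof (rule indep_sets_collect_sigma[OF ind])
    show "Int_stable (?E j)" for j
    proof (rule Int_stableI)
      fix a b assume "a \<in> ?E j" "b \<in> ?E j"
      then obtain A B where "A \<in> sets P" "B \<in> sets P"
        "a = (\<lambda>(k, i). S k i) j -` A \<inter> space \<Omega>" "b = (\<lambda>(k, i). S k i) j -` B \<inter> space \<Omega>" by blast
      then show "a \<inter> b \<in> ?E j" by (intro CollectI exI[of _ "A \<inter> B"]) auto
    qed
    show "disjoint_family ?I"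
      using k by (auto simp: disjoint_family_on_def split: bool.splits)
  qed
  also have "(\<lambda>j. sigma_sets (space \<Omega>) (\<Union>i\<in>?I j. ?E i)) =
      case_bool (sets (minibatch_sigma \<Omega> P m S (k - 1)))
        (sigma_sets (space \<Omega>) {S k i -` B \<inter> space \<Omega> | B. B \<in> sets P})"
  proof (rule ext)
    fix b :: bool
    have "(\<Union>i\<in>{1..k - 1} \<times> {1..m}. ?E i) =
        (\<Union>j\<in>{1..k - 1}. \<Union>i\<in>{1..m}. {S j i -` B \<inter> space \<Omega> | B. B \<in> sets P})"
    proof -
      have "(\<Union>x\<in>A \<times> B. g x) = (\<Union>a\<in>A. \<Union>b\<in>B. g (a, b))"
        for A :: "nat set" and B :: "nat set" and g :: "nat \<times> nat \<Rightarrow> 'w set set" by auto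
      then show ?thesis by simp
    qed
    then show "sigma_sets (space \<Omega>) (\<Union>i\<in>?I b. ?E i) =
        case_bool (sets (minibatch_sigma \<Omega> P m S (k - 1)))
        (sigma_sets (space \<Omega>) {S k i -` B \<inter> space \<Omega> | B. B \<in> sets P}) b"
      unfolding sets_minibatch_sigma by (cases b) simp_all
  qed
  finally have 1: "indep_set (sets (minibatch_sigma \<Omega> P m S (k - 1)))
      (sigma_sets (space \<Omega>) {S k i -` B \<inter> space \<Omega> | B. B \<in> sets P})"
    unfolding indep_set_def .
  have Zm: "Z \<in> measurable \<Omega> N"
    by (rule measurable_from_subalg[OF subalgebra_minibatch_sigma[OF \<Omega> iid] Z])
  note Sm = iid_minibatches_measurable[OF \<Omega> iid k i]
  interpret Z: prob_space "distr \<Omega> N Z" by (rule prob_space_distr[OF Zm])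
  interpret P: prob_space P using prob_space_distr[OF Sm(1)] Sm(2) by simp
  show ?thesis
  proof (rule pair_measure_eqI)
    fix A B assume A: "A \<in> sets (distr \<Omega> N Z)" and B: "B \<in> sets P"
    have "Z -` A \<inter> space \<Omega> \<in> sets (minibatch_sigma \<Omega> P m S (k - 1))"
      using measurable_sets[OF Z, of A] A by simp
    then have "prob ((Z -` A \<inter> space \<Omega>) \<inter> (S k i -` B \<inter> space \<Omega>)) =
        prob (Z -` A \<inter> space \<Omega>) * prob (S k i -` B \<inter> space \<Omega>)"
      by (rule indep_setD[OF 1]) (use B in auto)
    moreover have "(\<lambda>\<omega>. (Z \<omega>, S k i \<omega>)) -` (A \<times> B) \<inter> space \<Omega> =
        (Z -` A \<inter> space \<Omega>) \<inter> (S k i -` B \<inter> space \<Omega>)" by auto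
    moreover have "emeasure P B = emeasure \<Omega> (S k i -` B \<inter> space \<Omega>)"
      using emeasure_distr[OF Sm(1) B] Sm(2) by simp
    moreover have "emeasure (distr \<Omega> N Z) A = emeasure \<Omega> (Z -` A \<inter> space \<Omega>)"
      using A Zm by (simp add: emeasure_distr)
    moreover have "emeasure (distr \<Omega> (N \<Otimes>\<^sub>M P) (\<lambda>\<omega>. (Z \<omega>, S k i \<omega>))) (A \<times> B) =
        emeasure \<Omega> ((\<lambda>\<omega>. (Z \<omega>, S k i \<omega>)) -` (A \<times> B) \<inter> space \<Omega>)"
      using A B Zm Sm(1) by (intro emeasure_distr) auto
    ultimately show "emeasure (distr \<Omega> N Z) A * emeasure P B =
        emeasure (distr \<Omega> (N \<Otimes>\<^sub>M P) (\<lambda>\<omega>. (Z \<omega>, S k i \<omega>))) (A \<times> B)"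
      by (simp only: emeasure_eq_measure ennreal_mult[OF measure_nonneg measure_nonneg])
  qed (auto intro: Z.sigma_finite_measure_axioms P.sigma_finite_measure_axioms)
qed

lemma integral_past_and_sample_le:
  fixes \<Omega> :: "'w measure" and N :: "'n measure" and P :: "'s measure" and h :: "'n \<times> 's \<Rightarrow> real"
  assumes \<Omega>: "prob_space \<Omega>" and P: "prob_space P"
    and Zm: "Z \<in> measurable \<Omega> N" and Ym: "Y \<in> measurable \<Omega> P"
    and prod: "distr \<Omega> N Z \<Otimes>\<^sub>M P = distr \<Omega> (N \<Otimes>\<^sub>M P) (\<lambda>\<omega>. (Z \<omega>, Y \<omega>))"
    and h: "h \<in> borel_measurable (N \<Otimes>\<^sub>M P)" and int: "integrable \<Omega> (\<lambda>\<omega>. h (Z \<omega>, Y \<omega>))"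
    and G: "integrable \<Omega> G" "\<And>\<omega>. \<omega> \<in> space \<Omega> \<Longrightarrow> (\<integral>s. h (Z \<omega>, s) \<partial>P) \<le> G \<omega>"
  shows "(\<integral>\<omega>. h (Z \<omega>, Y \<omega>) \<partial>\<Omega>) \<le> (\<integral>\<omega>. G \<omega> \<partial>\<Omega>)"
proof -
  interpret prob_space \<Omega> by fact
  interpret P: prob_space P by fact
  interpret D: prob_space "distr \<Omega> N Z" by (rule prob_space_distr[OF Zm])
  interpret PP: pair_prob_space "distr \<Omega> N Z" P ..
  have pm: "(\<lambda>\<omega>. (Z \<omega>, Y \<omega>)) \<in> measurable \<Omega> (N \<Otimes>\<^sub>M P)"
    using Zm Ym by simp
  have i: "integrable (distr \<Omega> N Z \<Otimes>\<^sub>M P) h"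
    unfolding prod using int pm h by (subst integrable_distr_eq) auto
  have m: "(\<lambda>z. \<integral>s. h (z, s) \<partial>P) \<in> borel_measurable N"
    using h by (intro P.borel_measurable_lebesgue_integral) simp
  have "(\<integral>\<omega>. h (Z \<omega>, Y \<omega>) \<partial>\<Omega>) = integral\<^sup>L (distr \<Omega> N Z \<Otimes>\<^sub>M P) h"
    unfolding prod using pm h by (simp add: integral_distr)
  also have "\<dots> = (\<integral>z. (\<integral>s. h (z, s) \<partial>P) \<partial>distr \<Omega> N Z)"
    by (rule PP.integral_fst'[OF i, symmetric])
  also have "\<dots> = (\<integral>\<omega>. (\<integral>s. h (Z \<omega>, s) \<partial>P) \<partial>\<Omega>)"
    by (rule integral_distr[OF Zm m])
  also have "\<dots> \<le> (\<integral>\<omega>. G \<omega> \<partial>\<Omega>)"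
  proof (rule integral_mono[OF _ G])
    have "integrable (distr \<Omega> N Z) (\<lambda>z. \<integral>s. h (z, s) \<partial>P)"
      by (rule PP.integrable_fst'[OF i])
    then show "integrable \<Omega> (\<lambda>\<omega>. \<integral>s. h (Z \<omega>, s) \<partial>P)"
      using integrable_distr_eq[OF Zm m] by simp
  qed
  finally show ?thesis .
qed

text \<open>The map and its argument both depend on the sample point.  Expanding the argument in the basis leaves
only the values of the map at basis vectors.\<close>
lemma borel_measurable_norm_of_power2:
  fixes M :: "'w \<Rightarrow> 'a::euclidean_space \<Rightarrow> 'a"
  assumes M: "\<And>\<omega>. \<omega> \<in> space F \<Longrightarrow> sa_pos_def (M \<omega>)"
    and Mm: "\<And>v. (\<lambda>\<omega>. M \<omega> v) \<in> borel_measurable F" and v: "v \<in> borel_measurable F"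
  shows "(\<lambda>\<omega>. (norm_of (M \<omega>) (v \<omega>))\<^sup>2) \<in> borel_measurable F"
proof -
  have "(\<lambda>\<omega>. (norm_of (M \<omega>) (v \<omega>))\<^sup>2) \<in> borel_measurable F \<longleftrightarrow>
      (\<lambda>\<omega>. v \<omega> \<bullet> (\<Sum>b\<in>Basis. (v \<omega> \<bullet> b) *\<^sub>R M \<omega> b)) \<in> borel_measurable F"
  proof (rule measurable_cong)
    fix \<omega> assume \<omega>: "\<omega> \<in> space F"
    interpret linear "M \<omega>" using M[OF \<omega>] by (simp add: sa_pos_def_def)
    have "M \<omega> (v \<omega>) = M \<omega> (\<Sum>b\<in>Basis. (v \<omega> \<bullet> b) *\<^sub>R b)" by (simp add: euclidean_representation)
    also have "\<dots> = (\<Sum>b\<in>Basis. (v \<omega> \<bullet> b) *\<^sub>R M \<omega> b)" by (simp add: sum scale)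
    finally show "(norm_of (M \<omega>) (v \<omega>))\<^sup>2 = v \<omega> \<bullet> (\<Sum>b\<in>Basis. (v \<omega> \<bullet> b) *\<^sub>R M \<omega> b)"
      by (simp add: norm_of_power2[OF M[OF \<omega>]])
  qed
  moreover have "(\<lambda>\<omega>. v \<omega> \<bullet> (\<Sum>b\<in>Basis. (v \<omega> \<bullet> b) *\<^sub>R M \<omega> b)) \<in> borel_measurable F"
    by (intro borel_measurable_inner borel_measurable_sum borel_measurable_scaleR v Mm
        borel_measurable_const)
  ultimately show ?thesis by simp
qed

lemma tendsto_norm_of_power2:
  assumes M: "sa_pos_def M" and v: "(v \<longlongrightarrow> l) F"
  shows "((\<lambda>n. (norm_of M (v n))\<^sup>2) \<longlongrightarrow> (norm_of M l)\<^sup>2) F"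
proof -
  have "bounded_linear M" using M by (simp add: sa_pos_def_def linear_conv_bounded_linear)
  then show ?thesis
    unfolding norm_of_power2[OF M]
    by (intro tendsto_inner v bounded_linear.tendsto[of M])
qed

text \<open>The ratio bound holds almost surely for each fixed direction, but it is applied to a random one.
For a vector that is determined by the past and takes finitely many values, the bound is used
separately on each of the events on which it is constant; multiplying the ratio by the old squared norm, which
belongs to the past, gives the new squared norm.  Bounded vectors are limits of such simple ones.\<close>
lemma cond_exp_norm_ratio_bound:
  fixes M M' :: "'w \<Rightarrow> 'a::euclidean_space \<Rightarrow> 'a"
  assumes \<Omega>: "prob_space \<Omega>" and F: "subalgebra \<Omega> F"
    and M: "\<And>\<omega>. \<omega> \<in> space \<Omega> \<Longrightarrow> sa_pos_def (M \<omega>)" "\<And>v. (\<lambda>\<omega>. M \<omega> v) \<in> borel_measurable F"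
    and M': "\<And>\<omega>. \<omega> \<in> space \<Omega> \<Longrightarrow> sa_pos_def (M' \<omega>)" "\<And>v. (\<lambda>\<omega>. M' \<omega> v) \<in> borel_measurable \<Omega>"
    and bnd: "AE \<omega> in \<Omega>. \<forall>v. (norm_of (M \<omega>) v)\<^sup>2 \<le> B * (norm v)\<^sup>2"
      "AE \<omega> in \<Omega>. \<forall>v. (norm_of (M' \<omega>) v)\<^sup>2 \<le> B * (norm v)\<^sup>2"
    and ratio: "\<And>v. v \<noteq> 0 \<Longrightarrow> AE \<omega> in \<Omega>.
      real_cond_exp \<Omega> F (\<lambda>\<omega>. (norm_of (M' \<omega>) v)\<^sup>2 / (norm_of (M \<omega>) v)\<^sup>2) \<omega> \<le> c"
    and v: "v \<in> borel_measurable F" "\<And>\<omega>. \<omega> \<in> space \<Omega> \<Longrightarrow> norm (v \<omega>) \<le> R"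
  shows "(\<integral>\<omega>. (norm_of (M' \<omega>) (v \<omega>))\<^sup>2 \<partial>\<Omega>) \<le> c * (\<integral>\<omega>. (norm_of (M \<omega>) (v \<omega>))\<^sup>2 \<partial>\<Omega>)"
proof -
  interpret prob_space \<Omega> by fact
  interpret finite_measure_subalgebra \<Omega> F by unfold_locales (rule F)
  have spF: "space F = space \<Omega>" using F by (simp add: subalgebra_def)
  let ?q = "\<lambda>v \<omega>. (norm_of (M \<omega>) (v \<omega>))\<^sup>2" and ?q' = "\<lambda>v \<omega>. (norm_of (M' \<omega>) (v \<omega>))\<^sup>2"
  have qF: "?q v \<in> borel_measurable F" if "v \<in> borel_measurable F" for v
    by (rule borel_measurable_norm_of_power2[OF _ M(2) that]) (simp add: M(1) spF)
  have q: "?q v \<in> borel_measurable \<Omega>" if "v \<in> borel_measurable F" for v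
    by (rule measurable_from_subalg[OF F qF[OF that]])
  have q': "?q' v \<in> borel_measurable \<Omega>" if "v \<in> borel_measurable F" for v
    by (rule borel_measurable_norm_of_power2[OF M'(1) M'(2) measurable_from_subalg[OF F that]])
  have B: "AE \<omega> in \<Omega>. norm (?q v \<omega>) \<le> \<bar>B\<bar> * R\<^sup>2" "AE \<omega> in \<Omega>. norm (?q' v \<omega>) \<le> \<bar>B\<bar> * R\<^sup>2"
    if vR: "\<And>\<omega>. \<omega> \<in> space \<Omega> \<Longrightarrow> norm (v \<omega>) \<le> R" for v :: "'w \<Rightarrow> 'a" and R
  proof -
    have *: "B * (norm (v \<omega>))\<^sup>2 \<le> \<bar>B\<bar> * R\<^sup>2" if \<omega>: "\<omega> \<in> space \<Omega>" for \<omega>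
      by (rule mult_mono[OF abs_ge_self power_mono[OF vR[OF \<omega>] norm_ge_zero]]) auto
    show "AE \<omega> in \<Omega>. norm (?q v \<omega>) \<le> \<bar>B\<bar> * R\<^sup>2"
      using bnd(1) AE_space
    proof eventually_elim
      case (elim \<omega>)
      then have "?q v \<omega> \<le> B * (norm (v \<omega>))\<^sup>2" by blast
      with *[OF elim(2)] show ?case by simp
    qed
    show "AE \<omega> in \<Omega>. norm (?q' v \<omega>) \<le> \<bar>B\<bar> * R\<^sup>2"
      using bnd(2) AE_space
    proof eventually_elim
      case (elim \<omega>)
      then have "?q' v \<omega> \<le> B * (norm (v \<omega>))\<^sup>2" by blast
      with *[OF elim(2)] show ?case by simp
    qed
  qed
  have indB: "integrable \<Omega> (\<lambda>\<omega>. indicator A \<omega> * ?q (\<lambda>_. u) \<omega>)"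
    "integrable \<Omega> (\<lambda>\<omega>. indicator A \<omega> * ?q' (\<lambda>_. u) \<omega>)" if A: "A \<in> sets \<Omega>" for A u
  proof -
    have ind: "norm (indicator A \<omega> * x) \<le> norm x" for \<omega> and x :: real by (simp add: indicator_def)
    have m: "indicator A \<in> borel_measurable \<Omega>" using A by simp
    show "integrable \<Omega> (\<lambda>\<omega>. indicator A \<omega> * ?q (\<lambda>_. u) \<omega>)"
    proof (rule integrable_const_bound[of _ "\<bar>B\<bar> * (norm u)\<^sup>2"])
      have "AE \<omega> in \<Omega>. norm (?q (\<lambda>_. u) \<omega>) \<le> \<bar>B\<bar> * (norm u)\<^sup>2" by (rule B(1)) simp
      then show "AE \<omega> in \<Omega>. norm (indicator A \<omega> * ?q (\<lambda>_. u) \<omega>) \<le> \<bar>B\<bar> * (norm u)\<^sup>2"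
        by eventually_elim (rule order_trans[OF ind])
    qed (intro borel_measurable_times m q borel_measurable_const)
    show "integrable \<Omega> (\<lambda>\<omega>. indicator A \<omega> * ?q' (\<lambda>_. u) \<omega>)"
    proof (rule integrable_const_bound[of _ "\<bar>B\<bar> * (norm u)\<^sup>2"])
      have "AE \<omega> in \<Omega>. norm (?q' (\<lambda>_. u) \<omega>) \<le> \<bar>B\<bar> * (norm u)\<^sup>2" by (rule B(2)) simp
      then show "AE \<omega> in \<Omega>. norm (indicator A \<omega> * ?q' (\<lambda>_. u) \<omega>) \<le> \<bar>B\<bar> * (norm u)\<^sup>2"
        by eventually_elim (rule order_trans[OF ind])
    qed (intro borel_measurable_times m q' borel_measurable_const)
  qed
  have const: "(\<integral>\<omega>. indicator A \<omega> * ?q' (\<lambda>_. u) \<omega> \<partial>\<Omega>) \<le> c * (\<integral>\<omega>. indicator A \<omega> * ?q (\<lambda>_. u) \<omega> \<partial>\<Omega>)"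
    if A: "A \<in> sets F" for A u
  proof (cases "u = 0")
    case True
    then show ?thesis by (simp add: norm_of_def)
  next
    case False
    let ?g = "\<lambda>\<omega>. ?q' (\<lambda>_. u) \<omega> / ?q (\<lambda>_. u) \<omega>"
    let ?f = "\<lambda>\<omega>. indicator A \<omega> * ?q (\<lambda>_. u) \<omega>"
    have A': "A \<in> sets \<Omega>" using A F by (auto simp: subalgebra_def)
    have fm: "?f \<in> borel_measurable F" using qF[of "\<lambda>_. u"] A by simp
    have gm: "?g \<in> borel_measurable \<Omega>" using q[of "\<lambda>_. u"] q'[of "\<lambda>_. u"] by simp
    have fg: "?f \<omega> * ?g \<omega> = indicator A \<omega> * ?q' (\<lambda>_. u) \<omega>" if "\<omega> \<in> space \<Omega>" for \<omega>
    proof -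
      have "0 < ?q (\<lambda>_. u) \<omega>"
        unfolding norm_of_power2[OF M(1)[OF that]] using M(1)[OF that] False by (simp add: sa_pos_def_def)
      then show ?thesis by simp
    qed
    note i' = indB(2)[OF A', of u] and if' = indB(1)[OF A', of u]
    have ifg: "integrable \<Omega> (\<lambda>\<omega>. ?f \<omega> * ?g \<omega>)"
      using i' by (subst Bochner_Integration.integrable_cong[OF refl fg]) auto
    have "(\<integral>\<omega>. indicator A \<omega> * ?q' (\<lambda>_. u) \<omega> \<partial>\<Omega>) = (\<integral>\<omega>. ?f \<omega> * ?g \<omega> \<partial>\<Omega>)"
      using fg by (intro Bochner_Integration.integral_cong) auto
    also have "\<dots> = (\<integral>\<omega>. ?f \<omega> * real_cond_exp \<Omega> F ?g \<omega> \<partial>\<Omega>)"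
      by (rule real_cond_exp_intg(2)[symmetric, OF ifg fm gm])
    also have "\<dots> \<le> (\<integral>\<omega>. c * ?f \<omega> \<partial>\<Omega>)"
    proof (rule integral_mono_AE)
      show "integrable \<Omega> (\<lambda>\<omega>. ?f \<omega> * real_cond_exp \<Omega> F ?g \<omega>)"
        by (rule real_cond_exp_intg(1)[OF ifg fm gm])
      show "integrable \<Omega> (\<lambda>\<omega>. c * ?f \<omega>)" using if' by simp
      show "AE \<omega> in \<Omega>. ?f \<omega> * real_cond_exp \<Omega> F ?g \<omega> \<le> c * ?f \<omega>"
        using ratio[OF False]
      proof eventually_elim
        case (elim \<omega>)
        have "?f \<omega> * real_cond_exp \<Omega> F ?g \<omega> \<le> ?f \<omega> * c"
          using elim by (intro mult_left_mono) auto
        then show ?case by (simp add: mult.commute)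
      qed
    qed
    finally show ?thesis by simp
  qed
  have simple: "(\<integral>\<omega>. ?q' s \<omega> \<partial>\<Omega>) \<le> c * (\<integral>\<omega>. ?q s \<omega> \<partial>\<Omega>)" if s: "simple_function F s" for s
  proof -
    have fin: "finite (s ` space \<Omega>)" using s spF by (auto simp: simple_function_def)
    define A where "A u = s -` {u} \<inter> space \<Omega>" for u
    have A: "A u \<in> sets F" for u using simple_functionD(2)[OF s, of "{u}"] by (simp add: A_def spF)
    have A': "A u \<in> sets \<Omega>" for u using A[of u] F by (auto simp: subalgebra_def)
    have dec: "\<phi> (s \<omega>) = (\<Sum>u\<in>s ` space \<Omega>. indicator (A u) \<omega> * \<phi> u)" if "\<omega> \<in> space \<Omega>" for \<omega> and \<phi> :: "'a \<Rightarrow> real"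
    proof -
      have "(\<Sum>u\<in>s ` space \<Omega>. indicator (A u) \<omega> * \<phi> u) = (\<Sum>u\<in>s ` space \<Omega>. if u = s \<omega> then \<phi> u else 0)"
        using that by (intro sum.cong) (auto simp: A_def indicator_def)
      then show ?thesis using that fin by simp
    qed
    note i' = indB(2)[OF A'] and i = indB(1)[OF A']
    have "(\<integral>\<omega>. ?q' s \<omega> \<partial>\<Omega>) = (\<integral>\<omega>. (\<Sum>u\<in>s ` space \<Omega>. indicator (A u) \<omega> * ?q' (\<lambda>_. u) \<omega>) \<partial>\<Omega>)"
      by (rule Bochner_Integration.integral_cong[OF refl]) (rule dec)
    also have "\<dots> = (\<Sum>u\<in>s ` space \<Omega>. \<integral>\<omega>. indicator (A u) \<omega> * ?q' (\<lambda>_. u) \<omega> \<partial>\<Omega>)"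
      using i' by (rule Bochner_Integration.integral_sum)
    also have "\<dots> \<le> (\<Sum>u\<in>s ` space \<Omega>. c * (\<integral>\<omega>. indicator (A u) \<omega> * ?q (\<lambda>_. u) \<omega> \<partial>\<Omega>))"
      by (rule sum_mono) (rule const[OF A])
    also have "\<dots> = c * (\<integral>\<omega>. (\<Sum>u\<in>s ` space \<Omega>. indicator (A u) \<omega> * ?q (\<lambda>_. u) \<omega>) \<partial>\<Omega>)"
      using i by (subst Bochner_Integration.integral_sum) (auto simp: sum_distrib_left)
    also have "(\<integral>\<omega>. (\<Sum>u\<in>s ` space \<Omega>. indicator (A u) \<omega> * ?q (\<lambda>_. u) \<omega>) \<partial>\<Omega>) = (\<integral>\<omega>. ?q s \<omega> \<partial>\<Omega>)"
      by (rule Bochner_Integration.integral_cong[OF refl]) (rule dec[symmetric])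
    finally show ?thesis .
  qed
  obtain s where s: "\<And>i. simple_function F (s i)" "\<And>\<omega>. \<omega> \<in> space F \<Longrightarrow> (\<lambda>i. s i \<omega>) \<longlonglongrightarrow> v \<omega>"
    "\<And>i \<omega>. \<omega> \<in> space F \<Longrightarrow> dist (s i \<omega>) 0 \<le> 2 * dist (v \<omega>) 0"
    using borel_measurable_implies_sequence_metric[OF v(1), of 0] by blast
  have sb: "norm (s i \<omega>) \<le> 2 * R" if "\<omega> \<in> space \<Omega>" for i \<omega>
    using s(3)[of \<omega> i] v(2)[OF that] that spF by simp
  have sm: "s i \<in> borel_measurable F" for i using s(1) by (rule borel_measurable_simple_function)
  have "(\<lambda>i. \<integral>\<omega>. ?q' (s i) \<omega> \<partial>\<Omega>) \<longlonglongrightarrow> (\<integral>\<omega>. ?q' v \<omega> \<partial>\<Omega>)"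
  proof (rule integral_dominated_convergence[where w = "\<lambda>_. \<bar>B\<bar> * (2 * R)\<^sup>2"])
    show "AE \<omega> in \<Omega>. (\<lambda>i. ?q' (s i) \<omega>) \<longlonglongrightarrow> ?q' v \<omega>"
      by (rule AE_I2) (rule tendsto_norm_of_power2[OF M'(1) s(2)], simp_all only: spF)
    show "AE \<omega> in \<Omega>. norm (?q' (s i) \<omega>) \<le> \<bar>B\<bar> * (2 * R)\<^sup>2" for i by (rule B(2)[OF sb])
  qed (rule q'[OF v(1)] q'[OF sm] integrable_const)+
  moreover have "(\<lambda>i. c * (\<integral>\<omega>. ?q (s i) \<omega> \<partial>\<Omega>)) \<longlonglongrightarrow> c * (\<integral>\<omega>. ?q v \<omega> \<partial>\<Omega>)"
  proof (rule tendsto_mult_left, rule integral_dominated_convergence[where w = "\<lambda>_. \<bar>B\<bar> * (2 * R)\<^sup>2"])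
    show "AE \<omega> in \<Omega>. (\<lambda>i. ?q (s i) \<omega>) \<longlonglongrightarrow> ?q v \<omega>"
      by (rule AE_I2) (rule tendsto_norm_of_power2[OF M(1) s(2)], simp_all only: spF)
    show "AE \<omega> in \<Omega>. norm (?q (s i) \<omega>) \<le> \<bar>B\<bar> * (2 * R)\<^sup>2" for i by (rule B(1)[OF sb])
  qed (rule q[OF v(1)] q[OF sm] integrable_const)+
  ultimately show ?thesis
    by (rule LIMSEQ_le) (use simple s(1) in blast)
qed

text \<open>Closest points need not be unique or depend measurably on the data.  Allowing an error \<open>d\<close>, one takes
the first point of a countable dense subset that is good enough.\<close>
lemma measurable_near_projection:
  fixes M :: "'w \<Rightarrow> 'a::euclidean_space \<Rightarrow> 'a"
  assumes M: "\<And>\<omega>. \<omega> \<in> space F \<Longrightarrow> sa_pos_def (M \<omega>)" "\<And>v. (\<lambda>\<omega>. M \<omega> v) \<in> borel_measurable F"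
    and X: "X \<in> borel_measurable F" and Xs: "Xs \<noteq> {}" and d: "0 < (d::real)"
  obtains Y where "Y \<in> borel_measurable F" "\<And>\<omega>. Y \<omega> \<in> Xs"
    "\<And>\<omega> y. \<lbrakk>\<omega> \<in> space F; y \<in> Xs\<rbrakk> \<Longrightarrow>
      (norm_of (M \<omega>) (X \<omega> - Y \<omega>))\<^sup>2 \<le> (norm_of (M \<omega>) (X \<omega> - y))\<^sup>2 + d"
proof -
  obtain T where T: "countable T" "T \<subseteq> Xs" "Xs \<subseteq> closure T" by (rule separable)
  have "T \<noteq> {}" using T Xs by auto
  define q where "q = from_nat_into T"
  have q: "range q = T" using T(1) \<open>T \<noteq> {}\<close> by (simp add: q_def range_from_nat_into)
  let ?d = "\<lambda>n \<omega>. (norm_of (M \<omega>) (X \<omega> - q n))\<^sup>2"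
  have dm [measurable]: "?d n \<in> borel_measurable F" for n
    by (rule borel_measurable_norm_of_power2) (use M X in auto)
  define idx where "idx \<omega> = (LEAST n. \<forall>j. ?d n \<omega> \<le> ?d j \<omega> + d)" for \<omega>
  have idxm: "idx \<in> measurable F (count_space UNIV)"
    unfolding idx_def by measurable
  have ex: "\<exists>n. \<forall>j. ?d n \<omega> \<le> ?d j \<omega> + d" for \<omega>
  proof -
    have bdd: "bdd_below (range (\<lambda>n. ?d n \<omega>))" by (rule bdd_belowI[of _ 0]) auto
    have "(INF n. ?d n \<omega>) < (INF n. ?d n \<omega>) + d" using d by simp
    then have "\<exists>n\<in>UNIV. ?d n \<omega> < (INF n. ?d n \<omega>) + d"
      by (subst (asm) cINF_less_iff[OF _ bdd]) auto
    then obtain n where "?d n \<omega> < (INF n. ?d n \<omega>) + d" by blast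
    moreover have "(INF n. ?d n \<omega>) \<le> ?d j \<omega>" for j by (rule cINF_lower[OF bdd]) simp
    ultimately have "\<forall>j. ?d n \<omega> \<le> ?d j \<omega> + d" by (meson add_right_mono less_imp_le order_trans)
    then show ?thesis by blast
  qed
  have idx: "?d (idx \<omega>) \<omega> \<le> ?d j \<omega> + d" for j \<omega>
    using LeastI_ex[OF ex[of \<omega>]] unfolding idx_def by blast
  show thesis
  proof (rule that[of "\<lambda>\<omega>. q (idx \<omega>)"])
    show "(\<lambda>\<omega>. q (idx \<omega>)) \<in> borel_measurable F"
      by (rule measurable_compose[OF idxm]) simp
    show "q (idx \<omega>) \<in> Xs" for \<omega> using q T(2) by blast
    show "(norm_of (M \<omega>) (X \<omega> - q (idx \<omega>)))\<^sup>2 \<le> (norm_of (M \<omega>) (X \<omega> - y))\<^sup>2 + d"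
      if \<omega>: "\<omega> \<in> space F" and y: "y \<in> Xs" for \<omega> y
    proof -
      have "y \<in> closure T" using y T(3) by blast
      then obtain u where u: "\<And>n. u n \<in> T" "u \<longlonglongrightarrow> y"
        by (auto simp: closure_sequential)
      have "(\<lambda>n. (norm_of (M \<omega>) (X \<omega> - u n))\<^sup>2 + d) \<longlonglongrightarrow> (norm_of (M \<omega>) (X \<omega> - y))\<^sup>2 + d"
        by (intro tendsto_intros tendsto_norm_of_power2 M(1) \<omega> u)
      moreover have "(norm_of (M \<omega>) (X \<omega> - q (idx \<omega>)))\<^sup>2 \<le> (norm_of (M \<omega>) (X \<omega> - u n))\<^sup>2 + d" for n
      proof -
        obtain j where "u n = q j" using u(1)[of n] q by (metis rangeE)
        then show ?thesis using idx[of \<omega> j] by simp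
      qed
      ultimately show ?thesis by (intro LIMSEQ_le_const) auto
    qed
  qed
qed

section \<open>One iteration for a fixed sample\<close>

lemma not_in_effective_dom: "y \<notin> effective_dom r \<Longrightarrow> r y = \<infinity>"
  by (simp add: effective_dom_def)

lemma proper_closed_finite:
  assumes "proper_closed r" "y \<in> effective_dom r"
  shows "r y = ereal (real_of_ereal (r y))"
  using assms by (cases "r y") (auto simp: proper_closed_def effective_dom_def)

text \<open>Averaging the weak convexity inequalities of the composite models counts the regularizer \<open>r\<close> once, as
it appears in each of them.\<close>
lemma strongly_convex_on_minibatch_objective:
  fixes r :: "'a::euclidean_space \<Rightarrow> ereal" and \<alpha> :: real
  assumes r: "proper_closed r" and m: "m \<ge> 1"
    and w: "\<And>i. i \<in> {1..m} \<Longrightarrow> weakly_convex \<tau>b (composite_model fm r x (b i))"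
    and M: "sa_pos_def M" and \<tau>b: "0 \<le> \<tau>b" and L: "\<And>v. norm v \<le> L * norm_of M v"
  defines "g \<equiv> \<lambda>y. 1 / real m * (\<Sum>i=1..m. fm x y (b i)) + real_of_ereal (r y)
                 + 1 / (2 * \<alpha>) * (norm_of M (y - x))\<^sup>2"
  shows "strongly_convex_on M (1 / \<alpha> - L\<^sup>2 * \<tau>b) (effective_dom r) g"
    and "prox_objective M \<alpha> (minibatch_model m fm r x b) x y =
      (if y \<in> effective_dom r then ereal (g y) else \<infinity>)"
proof -
  let ?D = "effective_dom r"
  let ?c = "\<lambda>i y. fm x y (b i) + real_of_ereal (r y)"
  let ?avg = "\<lambda>y. 1 / real m * (\<Sum>i=1..m. fm x y (b i)) + real_of_ereal (r y)"
  have c: "composite_model fm r x (b i) y = (if y \<in> ?D then ereal (?c i y) else \<infinity>)" for i y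
    using proper_closed_finite[OF r] not_in_effective_dom[of y r]
    by (auto simp: composite_model_def) (metis plus_ereal.simps(1))
  have avg: "?avg y = 1 / real m * (\<Sum>i=1..m. ?c i y)" for y
    using m by (simp add: sum.distrib field_simps)
  have D: "convex ?D" using weakly_convex_imp_real(1)[OF w c, of 1] m by simp
  have "?avg ((1 - t) *\<^sub>R u + t *\<^sub>R v) \<le> (1 - t) * ?avg u + t * ?avg v + \<tau>b / 2 * (t * (1 - t)) * (norm (u - v))\<^sup>2"
    if h: "u \<in> ?D" "v \<in> ?D" "0 \<le> t" "t \<le> 1" for u v t
  proof -
    let ?K = "\<tau>b / 2 * (t * (1 - t)) * (norm (u - v))\<^sup>2"
    have "(\<Sum>i=1..m. ?c i ((1 - t) *\<^sub>R u + t *\<^sub>R v)) \<le> (\<Sum>i=1..m. (1 - t) * ?c i u + t * ?c i v + ?K)"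
      by (intro sum_mono weakly_convex_imp_real(2)[OF w c] h)
    also have "\<dots> = (1 - t) * (\<Sum>i=1..m. ?c i u) + t * (\<Sum>i=1..m. ?c i v) + real m * ?K"
      by (simp only: sum.distrib sum_distrib_left[symmetric] sum_constant card_atLeastAtMost) simp
    finally have "1 / real m * (\<Sum>i=1..m. ?c i ((1 - t) *\<^sub>R u + t *\<^sub>R v)) \<le>
        1 / real m * ((1 - t) * (\<Sum>i=1..m. ?c i u) + t * (\<Sum>i=1..m. ?c i v) + real m * ?K)"
      by (rule mult_left_mono) simp
    also have "\<dots> = (1 - t) * (1 / real m * (\<Sum>i=1..m. ?c i u)) + t * (1 / real m * (\<Sum>i=1..m. ?c i v)) + ?K"
    proof -
      have "1 / real m * real m = 1" using m by simp
      then have "1 / real m * (real m * ?K) = ?K" by (simp only: mult.assoc[symmetric] mult_1_left)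
      then show ?thesis by (simp only: distrib_left mult.left_commute)
    qed
    finally show ?thesis unfolding avg .
  qed
  from strongly_convex_on_prox_objective[OF M D \<tau>b this L]
  show "strongly_convex_on M (1 / \<alpha> - L\<^sup>2 * \<tau>b) ?D g" unfolding g_def .
  show "prox_objective M \<alpha> (minibatch_model m fm r x b) x y = (if y \<in> ?D then ereal (g y) else \<infinity>)"
  proof (cases "y \<in> ?D")
    case True
    show ?thesis
      unfolding prox_objective_def minibatch_model_def
      by (subst proper_closed_finite[OF r True]) (simp add: g_def True)
  next
    case False
    then show ?thesis
      by (simp add: prox_objective_def minibatch_model_def not_in_effective_dom)
  qed
qed

text \<open>The shape in which Young's inequality is used below: \<open>l\<close> is a Lipschitz constant, \<open>d\<close> the Euclidean
length of a step and \<open>n\<close> its preconditioned length.  Two such terms occur, for the model and for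
the objective, so each may use half of the squared length.\<close>
lemma scaled_product_le_squares:
  fixes \<alpha> l L n d :: real
  assumes "0 \<le> \<alpha>" "0 \<le> l" "d \<le> L * n"
  shows "2 * \<alpha> * l * d \<le> 2 * \<alpha>\<^sup>2 * L\<^sup>2 * l\<^sup>2 + n\<^sup>2 / 2"
proof -
  have "2 * \<alpha> * l * d \<le> 2 * \<alpha> * l * (L * n)"
    using assms by (intro mult_left_mono) auto
  moreover have "0 \<le> (2 * \<alpha> * L * l - n)\<^sup>2" by simp
  ultimately show ?thesis by (simp add: power2_eq_square algebra_simps)
qed

lemma scaled_average_le_squares:
  fixes \<alpha> L n d :: real
  assumes "0 \<le> \<alpha>" "\<And>i. i \<in> {1..m} \<Longrightarrow> 0 \<le> l i" "d \<le> L * n" "m \<ge> (1::nat)"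
  shows "2 * \<alpha> * (1 / real m * (\<Sum>i=1..m. l i)) * d
    \<le> 2 * \<alpha>\<^sup>2 * L\<^sup>2 * (1 / real m * (\<Sum>i=1..m. (l i)\<^sup>2)) + n\<^sup>2 / 2"
proof -
  have "(\<Sum>i=1..m. 2 * \<alpha> * l i * d) \<le> (\<Sum>i=1..m. 2 * \<alpha>\<^sup>2 * L\<^sup>2 * (l i)\<^sup>2 + n\<^sup>2 / 2)"
    using assms by (intro sum_mono scaled_product_le_squares) auto
  also have "\<dots> = 2 * \<alpha>\<^sup>2 * L\<^sup>2 * (\<Sum>i=1..m. (l i)\<^sup>2) + real m * (n\<^sup>2 / 2)"
    by (simp add: sum.distrib sum_distrib_left)
  also have "(\<Sum>i=1..m. 2 * \<alpha> * l i * d) = 2 * \<alpha> * (\<Sum>i=1..m. l i) * d"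
    by (simp add: sum_distrib_left sum_distrib_right)
  finally have "2 * \<alpha> * (\<Sum>i=1..m. l i) * d / real m \<le>
      (2 * \<alpha>\<^sup>2 * L\<^sup>2 * (\<Sum>i=1..m. (l i)\<^sup>2) + real m * (n\<^sup>2 / 2)) / real m"
    by (rule divide_right_mono) simp
  then show ?thesis using assms(4) by (simp add: add_divide_distrib)
qed

text \<open>Moving from \<open>x\<close> to \<open>y\<close> changes the averaged model and the objective by at most their Lipschitz
constants times the length of the step, and half of the squared length absorbs either change.  The bound
serves twice: with the new point as \<open>y\<close> in the one-step inequality, and with the competitor as
\<open>y\<close> when the next iterate leaves the ball.\<close>
lemma model_difference_lower_bound:
  fixes F :: "'a::euclidean_space \<Rightarrow> real" and fm :: "'a \<Rightarrow> 'a \<Rightarrow> 's \<Rightarrow> real"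
  assumes m: "m \<ge> 1" and \<alpha>: "0 \<le> \<alpha>" and M: "sa_pos_def M"
    and L: "\<And>v. norm v \<le> L * norm_of M v"
    and l: "\<And>i. i \<in> {1..m} \<Longrightarrow> 0 \<le> l i"
    and lip: "\<And>i u v. \<lbrakk>i \<in> {1..m}; u \<in> U; v \<in> U\<rbrakk> \<Longrightarrow> \<bar>fm u u (b i) - fm u v (b i)\<bar> \<le> l i * norm (u - v)"
    and LF: "0 \<le> LF" and F: "\<And>u v. \<lbrakk>u \<in> U; v \<in> U\<rbrakk> \<Longrightarrow> \<bar>F u - F v\<bar> \<le> LF * norm (u - v)"
    and x: "x \<in> U" and y: "y \<in> U"
  shows "- (2 * \<alpha>\<^sup>2 * L\<^sup>2 * (1 / real m * (\<Sum>i=1..m. (l i)\<^sup>2) + LF\<^sup>2)) \<le>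
    (norm_of M (y - x))\<^sup>2 + 2 * \<alpha> * (1 / real m * (\<Sum>i=1..m. fm x y (b i) - fm x x (b i)) - F y + F x)"
proof -
  let ?n = "norm_of M (y - x)" and ?d = "norm (y - x)"
  have n: "norm (x - y) = ?d" by (rule norm_minus_commute)
  have "(\<Sum>i=1..m. - (l i * ?d)) \<le> (\<Sum>i=1..m. fm x y (b i) - fm x x (b i))"
    using lip[OF _ x y] unfolding n by (intro sum_mono) (force simp: abs_le_iff)
  then have "- ((\<Sum>i=1..m. l i) * ?d) \<le> (\<Sum>i=1..m. fm x y (b i) - fm x x (b i))"
    by (simp add: sum_negf sum_distrib_right)
  then have "1 / real m * (- ((\<Sum>i=1..m. l i) * ?d)) \<le> 1 / real m * (\<Sum>i=1..m. fm x y (b i) - fm x x (b i))"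
    by (rule mult_left_mono) simp
  moreover have "\<bar>F x - F y\<bar> \<le> LF * ?d" using F[OF x y] n by simp
  ultimately have "- (1 / real m * (\<Sum>i=1..m. l i) * ?d) - LF * ?d \<le>
      1 / real m * (\<Sum>i=1..m. fm x y (b i) - fm x x (b i)) - F y + F x"
    by (simp add: abs_le_iff)
  then have "2 * \<alpha> * (- (1 / real m * (\<Sum>i=1..m. l i) * ?d) - LF * ?d) \<le>
      2 * \<alpha> * (1 / real m * (\<Sum>i=1..m. fm x y (b i) - fm x x (b i)) - F y + F x)"
    using \<alpha> by (intro mult_left_mono) auto
  moreover have "2 * \<alpha> * (- (1 / real m * (\<Sum>i=1..m. l i) * ?d) - LF * ?d) =
      - (2 * \<alpha> * (1 / real m * (\<Sum>i=1..m. l i)) * ?d) - 2 * \<alpha> * LF * ?d"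
    by (simp add: algebra_simps)
  moreover have "2 * \<alpha> * (1 / real m * (\<Sum>i=1..m. l i)) * ?d
      \<le> 2 * \<alpha>\<^sup>2 * L\<^sup>2 * (1 / real m * (\<Sum>i=1..m. (l i)\<^sup>2)) + ?n\<^sup>2 / 2"
    by (rule scaled_average_le_squares[OF \<alpha> l L m])
  moreover have "2 * \<alpha> * LF * ?d \<le> 2 * \<alpha>\<^sup>2 * L\<^sup>2 * LF\<^sup>2 + ?n\<^sup>2 / 2"
    by (rule scaled_product_le_squares[OF \<alpha> LF L])
  moreover have "2 * \<alpha>\<^sup>2 * L\<^sup>2 * (1 / real m * (\<Sum>i=1..m. (l i)\<^sup>2) + LF\<^sup>2) =
      2 * \<alpha>\<^sup>2 * L\<^sup>2 * (1 / real m * (\<Sum>i=1..m. (l i)\<^sup>2)) + 2 * \<alpha>\<^sup>2 * L\<^sup>2 * LF\<^sup>2"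
    by (rule distrib_left)
  ultimately show ?thesis by linarith
qed

text \<open>The basic inequality of one iteration.  The near-minimizer \<open>z\<close> is compared with a solution \<open>y\<close>; the
growth condition is used at \<open>z\<close>, and the proximal term at \<open>z\<close> pays for replacing the model at \<open>z\<close>
by its value at \<open>x\<close>.  The right-hand side depends on \<open>x\<close>, \<open>y\<close> and the sample only, so \<open>z\<close>,
whose measurability is unclear, disappears from it.\<close>
lemma model_step_growth_inequality:
  fixes F :: "'a::euclidean_space \<Rightarrow> real" and fm :: "'a \<Rightarrow> 'a \<Rightarrow> 's \<Rightarrow> real"
  assumes r: "proper_closed r" and m: "m \<ge> 1"
    and w: "\<And>i. i \<in> {1..m} \<Longrightarrow> weakly_convex \<tau>b (composite_model fm r x (b i))" and \<tau>b: "0 \<le> \<tau>b"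
    and M: "sa_pos_def M" and L: "\<And>v. norm v \<le> L * norm_of M v" and \<tau>: "\<tau> = L\<^sup>2 * \<tau>b"
    and \<alpha>: "0 < \<alpha>" "\<tau> * \<alpha> < 1" and \<theta>: "0 < \<theta>" "\<theta> < 1" and \<epsilon>: "0 \<le> \<epsilon>"
    and l: "\<And>i. i \<in> {1..m} \<Longrightarrow> 0 \<le> l i"
    and lip: "\<And>i u v. \<lbrakk>i \<in> {1..m}; u \<in> U; v \<in> U\<rbrakk> \<Longrightarrow> \<bar>fm u u (b i) - fm u v (b i)\<bar> \<le> l i * norm (u - v)"
    and LF: "0 \<le> LF" and F: "\<And>u v. \<lbrakk>u \<in> U; v \<in> U\<rbrakk> \<Longrightarrow> \<bar>F u - F v\<bar> \<le> LF * norm (u - v)"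
    and growth: "\<And>z. z \<in> effective_dom r \<Longrightarrow> \<phi> + c * (infdist z Xs)\<^sup>2 \<le> F z + real_of_ereal (r z)"
    and y: "y \<in> effective_dom r" "F y + real_of_ereal (r y) = \<phi>" and x: "x \<in> U"
    and U: "\<And>z. \<lbrakk>z \<in> effective_dom r; norm_of M (x' - z) \<le> \<epsilon>\<rbrakk> \<Longrightarrow> z \<in> U"
    and step: "inexact_prox_step \<tau> M \<alpha> \<epsilon> (minibatch_model m fm r x b) x x'"
  obtains z where "norm_of M (x' - z) \<le> \<epsilon>"
    "(1 - \<tau> * \<alpha>) * (1 - \<theta>) * (norm_of M (z - y))\<^sup>2 + 2 * \<alpha> * c * (infdist z Xs)\<^sup>2 \<le>
     (norm_of M (y - x))\<^sup>2 + 2 * \<alpha> * (1 / real m * (\<Sum>i=1..m. fm x y (b i) - fm x x (b i)) - F y + F x)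
     + 2 * \<alpha>\<^sup>2 * L\<^sup>2 * (1 / real m * (\<Sum>i=1..m. (l i)\<^sup>2) + LF\<^sup>2) + (1 - \<tau> * \<alpha>) * \<epsilon>\<^sup>2 / \<theta>"
proof -
  let ?D = "effective_dom r" and ?r = "\<lambda>y. real_of_ereal (r y)"
  let ?f = "\<lambda>y. 1 / real m * (\<Sum>i=1..m. fm x y (b i))"
  define g where "g = (\<lambda>y. ?f y + ?r y + 1 / (2 * \<alpha>) * (norm_of M (y - x))\<^sup>2)"
  have g: "strongly_convex_on M (1 / \<alpha> - \<tau>) ?D g"
    unfolding g_def \<tau> by (rule strongly_convex_on_minibatch_objective(1)[OF r m w M \<tau>b L])
  have p: "prox_objective M \<alpha> (minibatch_model m fm r x b) x y = (if y \<in> ?D then ereal (g y) else \<infinity>)" for y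
    unfolding g_def by (rule strongly_convex_on_minibatch_objective(2)[OF r m w M \<tau>b L])
  obtain z where z: "z \<in> ?D" "norm_of M (x' - z) \<le> \<epsilon>"
    "\<And>u. u \<in> ?D \<Longrightarrow> g z \<le> g u + (1 / \<alpha> - \<tau>) / 2 * \<epsilon>\<^sup>2"
    using inexact_prox_step_near_minimizer[OF M \<alpha> \<epsilon> g _ p step] y(1) by blast
  have zU: "z \<in> U" using U z by blast
  have "g z + (1 / \<alpha> - \<tau>) / 2 * (1 - \<theta>) * (norm_of M (z - y))\<^sup>2 \<le> g y + (1 / \<alpha> - \<tau>) / 2 * \<epsilon>\<^sup>2 / \<theta>"
    by (rule strongly_convex_on_near_minimizer[OF g z(1,3) y(1) \<theta>])
  then have "2 * \<alpha> * (g z + (1 / \<alpha> - \<tau>) / 2 * (1 - \<theta>) * (norm_of M (z - y))\<^sup>2) \<le>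
      2 * \<alpha> * (g y + (1 / \<alpha> - \<tau>) / 2 * \<epsilon>\<^sup>2 / \<theta>)"
    using \<alpha> by (intro mult_left_mono) auto
  moreover have k: "2 * \<alpha> * ((1 / \<alpha> - \<tau>) / 2) = 1 - \<tau> * \<alpha>" using \<alpha> by (simp add: field_simps)
  have "2 * \<alpha> * (g z + (1 / \<alpha> - \<tau>) / 2 * (1 - \<theta>) * (norm_of M (z - y))\<^sup>2) =
      2 * \<alpha> * (?f z + ?r z) + (norm_of M (z - x))\<^sup>2 + (1 - \<tau> * \<alpha>) * (1 - \<theta>) * (norm_of M (z - y))\<^sup>2"
    unfolding k[symmetric] using \<alpha> by (simp add: g_def distrib_left mult.assoc)
  moreover have "2 * \<alpha> * (g y + (1 / \<alpha> - \<tau>) / 2 * \<epsilon>\<^sup>2 / \<theta>) =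
      2 * \<alpha> * (?f y + ?r y) + (norm_of M (y - x))\<^sup>2 + (1 - \<tau> * \<alpha>) * \<epsilon>\<^sup>2 / \<theta>"
    unfolding k[symmetric] using \<alpha> by (simp add: g_def distrib_left mult.assoc)
  ultimately have 1: "2 * \<alpha> * (?f z + ?r z) + (norm_of M (z - x))\<^sup>2 + (1 - \<tau> * \<alpha>) * (1 - \<theta>) * (norm_of M (z - y))\<^sup>2 \<le>
      2 * \<alpha> * (?f y + ?r y) + (norm_of M (y - x))\<^sup>2 + (1 - \<tau> * \<alpha>) * \<epsilon>\<^sup>2 / \<theta>"
    by linarith
  have 2: "- (2 * \<alpha>\<^sup>2 * L\<^sup>2 * (1 / real m * (\<Sum>i=1..m. (l i)\<^sup>2) + LF\<^sup>2)) \<le>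
    (norm_of M (z - x))\<^sup>2 + 2 * \<alpha> * (1 / real m * (\<Sum>i=1..m. fm x z (b i) - fm x x (b i)) - F z + F x)"
    by (rule model_difference_lower_bound[where fm = fm and b = b and U = U,
          OF m less_imp_le[OF \<alpha>(1)] M L l lip LF F x zU])
  have d: "1 / real m * (\<Sum>i=1..m. fm x u (b i) - fm x x (b i)) = ?f u - ?f x" for u
    by (simp add: sum_subtractf diff_divide_distrib)
  have 3: "2 * \<alpha> * (\<phi> + c * (infdist z Xs)\<^sup>2) \<le> 2 * \<alpha> * (F z + ?r z)"
    using growth[OF z(1)] \<alpha> by (intro mult_left_mono) auto
  have 4: "2 * \<alpha> * (F y + ?r y) = 2 * \<alpha> * \<phi>" using y(2) by simp
  show thesis
  proof (rule that[OF z(2)])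
    show "(1 - \<tau> * \<alpha>) * (1 - \<theta>) * (norm_of M (z - y))\<^sup>2 + 2 * \<alpha> * c * (infdist z Xs)\<^sup>2 \<le>
     (norm_of M (y - x))\<^sup>2 + 2 * \<alpha> * (1 / real m * (\<Sum>i=1..m. fm x y (b i) - fm x x (b i)) - F y + F x)
     + 2 * \<alpha>\<^sup>2 * L\<^sup>2 * (1 / real m * (\<Sum>i=1..m. (l i)\<^sup>2) + LF\<^sup>2) + (1 - \<tau> * \<alpha>) * \<epsilon>\<^sup>2 / \<theta>"
      using 1 2 3 4 unfolding d by (simp add: algebra_simps)
  qed
qed

lemma infdist_near_point:
  fixes z :: "'a::metric_space"
  assumes "A \<noteq> {}" "0 < (e::real)"
  obtains y where "y \<in> A" "(dist z y)\<^sup>2 \<le> (infdist z A)\<^sup>2 + e"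
proof -
  have "infdist z A < sqrt ((infdist z A)\<^sup>2 + e)"
    using assms(2) by (intro real_less_rsqrt) simp
  then have "(INF a\<in>A. dist z a) < sqrt ((infdist z A)\<^sup>2 + e)"
    using assms(1) by (simp add: infdist_notempty)
  then obtain y where y: "y \<in> A" "dist z y < sqrt ((infdist z A)\<^sup>2 + e)"
    using assms(1) by (subst (asm) cINF_less_iff) auto
  then have "(dist z y)\<^sup>2 \<le> (sqrt ((infdist z A)\<^sup>2 + e))\<^sup>2"
    by (intro power_mono) auto
  then show ?thesis using that y assms(2) by simp
qed

text \<open>Two distances are available at \<open>z\<close>: to the competitor \<open>y\<close> and to the nearest solutions.  The closer of \<open>y\<close>
and a nearly closest solution \<open>q\<close> profits from both coefficients at once.  The error \<open>e\<close> is allowed because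
\<open>q\<close> need not be an exact projection; the loss \<open>1 + \<theta>\<close> comes from replacing \<open>z\<close> by the
computed point \<open>x'\<close>.\<close>
lemma closest_point_growth:
  fixes y z x' :: "'a::euclidean_space"
  assumes M: "sa_pos_def M" and \<mu>: "0 \<le> \<mu>" "\<And>v. \<mu> * norm_of M v \<le> norm v"
    and ab: "0 \<le> A" "0 \<le> B" "0 < \<theta>" "0 < e"
    and y: "y \<in> Xs" and R: "A * (norm_of M (z - y))\<^sup>2 + B * (infdist z Xs)\<^sup>2 \<le> R"
    and x': "norm_of M (x' - z) \<le> \<epsilon>"
  obtains y' where "y' \<in> Xs"
    "(A + B * \<mu>\<^sup>2) * (norm_of M (x' - y'))\<^sup>2 \<le> (1 + \<theta>) * (R + B * e) + (A + B * \<mu>\<^sup>2) * ((1 + 1 / \<theta>) * \<epsilon>\<^sup>2)"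
proof -
  have "Xs \<noteq> {}" using y by blast
  then obtain q where q: "q \<in> Xs" "(dist z q)\<^sup>2 \<le> (infdist z Xs)\<^sup>2 + e"
    using infdist_near_point ab(4) by metis
  define y' where "y' = (if norm_of M (z - y) \<le> norm_of M (z - q) then y else q)"
  let ?n = "norm_of M (z - y')"
  have n: "?n \<le> norm_of M (z - y)" "?n \<le> norm_of M (z - q)" by (auto simp: y'_def)
  have n0: "0 \<le> ?n" by (rule norm_of_nonneg[OF M])
  have y'X: "y' \<in> Xs" using y q by (simp add: y'_def)
  have "(\<mu> * ?n)\<^sup>2 \<le> (dist z q)\<^sup>2"
  proof (rule power_mono)
    have "\<mu> * ?n \<le> \<mu> * norm_of M (z - q)" using n \<mu> by (intro mult_left_mono) auto
    then show "\<mu> * ?n \<le> dist z q" using \<mu>(2)[of "z - q"] by (simp add: dist_norm)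
    show "0 \<le> \<mu> * ?n" using n0 \<mu> by simp
  qed
  with q have "\<mu>\<^sup>2 * ?n\<^sup>2 \<le> (infdist z Xs)\<^sup>2 + e" by (simp add: power_mult_distrib)
  then have "B * (\<mu>\<^sup>2 * ?n\<^sup>2) \<le> B * ((infdist z Xs)\<^sup>2 + e)" using ab by (intro mult_left_mono) auto
  moreover have "A * ?n\<^sup>2 \<le> A * (norm_of M (z - y))\<^sup>2"
    using ab n n0 by (intro mult_left_mono power_mono) auto
  ultimately have 1: "(A + B * \<mu>\<^sup>2) * ?n\<^sup>2 \<le> R + B * e"
    using R by (simp add: algebra_simps)
  have Q: "0 \<le> A + B * \<mu>\<^sup>2" using ab by simp
  have "(norm_of M ((z - y') + (x' - z)))\<^sup>2 \<le> (1 + \<theta>) * ?n\<^sup>2 + (1 + 1 / \<theta>) * (norm_of M (x' - z))\<^sup>2"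
    by (rule norm_of_add_power2_le[OF M ab(3)])
  moreover have "(1 + 1 / \<theta>) * (norm_of M (x' - z))\<^sup>2 \<le> (1 + 1 / \<theta>) * \<epsilon>\<^sup>2"
    using x' ab norm_of_nonneg[OF M] by (intro mult_left_mono power_mono) auto
  ultimately have "(norm_of M (x' - y'))\<^sup>2 \<le> (1 + \<theta>) * ?n\<^sup>2 + (1 + 1 / \<theta>) * \<epsilon>\<^sup>2" by simp
  then have "(A + B * \<mu>\<^sup>2) * (norm_of M (x' - y'))\<^sup>2 \<le> (A + B * \<mu>\<^sup>2) * ((1 + \<theta>) * ?n\<^sup>2 + (1 + 1 / \<theta>) * \<epsilon>\<^sup>2)"
    using Q by (rule mult_left_mono)
  also have "\<dots> = (1 + \<theta>) * ((A + B * \<mu>\<^sup>2) * ?n\<^sup>2) + (A + B * \<mu>\<^sup>2) * ((1 + 1 / \<theta>) * \<epsilon>\<^sup>2)"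
    by (simp only: distrib_left mult.left_commute)
  also have "(1 + \<theta>) * ((A + B * \<mu>\<^sup>2) * ?n\<^sup>2) \<le> (1 + \<theta>) * (R + B * e)"
    using 1 ab by (intro mult_left_mono) auto
  finally show ?thesis using that[OF y'X] by simp
qed

section \<open>The setting of the algorithm\<close>

text \<open>The setting of the convergence theorem for a fixed radius \<open>R\<close>.  The stepsizes are bounded by \<open>1 / \<rho>b\<close>;
their decay enters when the recursion is solved.\<close>
locale localized_ispPPA =
  fixes \<Omega> :: "'w measure" and P :: "'s measure"
    and f :: "'a::euclidean_space \<Rightarrow> 's \<Rightarrow> ereal"
    and fm :: "'a \<Rightarrow> 'a \<Rightarrow> 's \<Rightarrow> real"
    and r :: "'a \<Rightarrow> ereal" and V :: "'a set"
    and m :: nat and S :: "nat \<Rightarrow> nat \<Rightarrow> 'w \<Rightarrow> 's"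
    and M :: "nat \<Rightarrow> 'w \<Rightarrow> 'a \<Rightarrow> 'a"
    and \<alpha> \<epsilon> \<rho> :: "nat \<Rightarrow> real"
    and x1 :: 'a and x :: "nat \<Rightarrow> 'w \<Rightarrow> 'a"
    and \<mu> L \<eta>b \<tau>b c1b \<eta> \<tau> c1 \<gamma> \<rho>b R :: real
    and Xs :: "'a set"
  assumes prob_\<Omega>: "prob_space \<Omega>" and prob_P: "prob_space P"
    and setting: "model_setting P V fm r"
    and accuracy: "model_accuracy P V f fm \<eta>b"
    and \<mu>: "0 < \<mu>" "\<mu> \<le> 1" and L: "1 \<le> L"
    and M0: "\<And>\<omega>. \<omega> \<in> space \<Omega> \<Longrightarrow> M 0 \<omega> = (\<lambda>v. v)"
    and norm_equiv_pos: "\<And>k. k \<ge> 1 \<Longrightarrow> AE \<omega> in \<Omega>. \<forall>v. \<mu> * norm_of (M k \<omega>) v \<le> norm v \<and>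
        norm v \<le> L * norm_of (M k \<omega>) v"
    and ratio: "\<And>k v. \<lbrakk>k \<ge> 1; v \<noteq> 0\<rbrakk> \<Longrightarrow> AE \<omega> in \<Omega>.
        real_cond_exp \<Omega> (minibatch_sigma \<Omega> P m S (k - 1))
          (\<lambda>\<omega>. (norm_of (M k \<omega>) v)\<^sup>2 / (norm_of (M (k - 1) \<omega>) v)\<^sup>2) \<omega> \<le> (\<rho> k)\<^sup>2"
    and regularity: "regularity_condition P V f fm r \<tau>b"
    and lipschitz: "local_lipschitz_condition P V fm"
    and growth: "quadratic_growth (objective P f r) c1b"
    and Xs: "Xs = argmin_set (objective P f r)" "Xs \<noteq> {}"
    and \<eta>: "\<eta> = L\<^sup>2 * \<eta>b" and \<tau>: "\<tau> = L\<^sup>2 * \<tau>b" and c1: "c1 = \<mu>\<^sup>2 * c1b"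
    and run: "ispPPA \<Omega> P V fm r \<tau> m S M \<alpha> \<epsilon> x1 x"
    and \<gamma>: "0 \<le> \<gamma>" and \<rho>b: "\<eta> + \<tau> < \<rho>b"
    and step_small: "\<And>k. k \<ge> 1 \<Longrightarrow> \<alpha> k * \<rho>b < 1"
    and \<epsilon>: "\<And>k. k \<ge> 1 \<Longrightarrow> \<epsilon> k = \<gamma> * \<alpha> k powr (3 / 2)"
begin

sublocale prob_space \<Omega> by (rule prob_\<Omega>)
sublocale P: prob_space P by (rule prob_P)

abbreviation "past k \<equiv> minibatch_sigma \<Omega> P m S (k - 1)"
abbreviation "dom_r \<equiv> effective_dom r"
abbreviation "rr y \<equiv> real_of_ereal (r y)"
abbreviation "F \<equiv> expected_fun P f"
abbreviation "N k \<omega> v \<equiv> norm_of (M k \<omega>) v"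

lemma V: "open V" "convex V" "dom_r \<subseteq> V"
  using setting by (auto simp: model_setting_def)

lemma r: "proper_closed r" using regularity by (simp add: regularity_condition_def)

lemma \<tau>b: "0 \<le> \<tau>b" using regularity by (simp add: regularity_condition_def)

lemma dom_r_nonempty: "dom_r \<noteq> {}"
proof -
  obtain y where "r y \<noteq> \<infinity>" using r by (auto simp: proper_closed_def)
  then have "y \<in> dom_r" by (simp add: effective_dom_def less_top[symmetric] top_ereal_def)
  then show ?thesis by blast
qed

lemma accuracy_real:
  "AE s in P. \<forall>u\<in>V. \<forall>v\<in>V. f u s = ereal (fm u u s) \<and> \<bar>fm u v s - fm v v s\<bar> \<le> \<eta>b / 2 * (norm (v - u))\<^sup>2"
  using accuracy unfolding model_accuracy_def
proof eventually_elim
  case (elim s)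
  show ?case
  proof (intro ballI conjI)
    fix u v assume u: "u \<in> V" and v: "v \<in> V"
    show "f u s = ereal (fm u u s)" using elim u by metis
    have "f v s = ereal (fm v v s)" "\<bar>ereal (fm u v s) - f v s\<bar> \<le> ereal (\<eta>b / 2 * (norm (v - u))\<^sup>2)"
      using elim u v by metis+
    then show "\<bar>fm u v s - fm v v s\<bar> \<le> \<eta>b / 2 * (norm (v - u))\<^sup>2" by simp
  qed
qed

text \<open>The open set \<open>V\<close> contains two different points, for which the accuracy bound would otherwise be negative.\<close>
lemma \<eta>b: "0 \<le> \<eta>b"
proof -
  obtain u where u: "u \<in> V" using V(3) dom_r_nonempty by blast
  obtain e where e: "e > 0" "ball u e \<subseteq> V" using V(1) u by (auto simp: open_contains_ball)
  obtain b :: 'a where b: "b \<in> Basis" using nonempty_Basis by blast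
  define v where "v = u + (e / 2) *\<^sub>R b"
  have d: "norm (v - u) = e / 2" using b e by (simp add: v_def)
  then have "v \<in> V" using e by (intro set_mp[OF e(2)]) (simp add: dist_norm norm_minus_commute)
  obtain s where s: "\<bar>fm u v s - fm v v s\<bar> \<le> \<eta>b / 2 * (norm (v - u))\<^sup>2"
    using eventually_happens'[OF P.ae_filter_bot[unfolded trivial_limit_def[symmetric]] accuracy_real]
      u \<open>v \<in> V\<close> by blast
  have "0 \<le> \<eta>b / 2 * (e / 2)\<^sup>2" using order_trans[OF abs_ge_zero s] unfolding d .
  then show ?thesis using e by (simp add: zero_le_mult_iff)
qed

lemma \<eta>0: "0 \<le> \<eta>" and \<tau>0: "0 \<le> \<tau>" and \<rho>b0: "0 < \<rho>b" and c1b: "0 < c1b" and c10: "0 < c1"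
proof -
  show 1: "0 \<le> \<eta>" "0 \<le> \<tau>" using \<eta>b \<tau>b by (simp_all add: \<eta> \<tau>)
  show "0 < \<rho>b" using 1 \<rho>b by linarith
  show "0 < c1b" using growth by (simp add: quadratic_growth_def)
  then show "0 < c1" using \<mu> by (simp add: c1)
qed

lemma m: "m \<ge> 1" and iid: "iid_minibatches \<Omega> P m S"
  using run by (simp_all add: ispPPA_def)

lemma \<alpha>0: "k \<ge> 1 \<Longrightarrow> 0 < \<alpha> k" and \<epsilon>0: "k \<ge> 1 \<Longrightarrow> 0 \<le> \<epsilon> k"
  using run by (simp_all add: ispPPA_def)

lemma \<alpha>_less: "k \<ge> 1 \<Longrightarrow> \<alpha> k < 1 / \<rho>b"
  using step_small[of k] \<rho>b0 by (simp add: field_simps)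

lemma \<epsilon>_power2:
  assumes "k \<ge> 1" shows "(\<epsilon> k)\<^sup>2 = \<gamma>\<^sup>2 * (\<alpha> k)^3"
proof -
  have "(\<alpha> k powr (3 / 2))\<^sup>2 = \<alpha> k powr 3"
    by (simp add: power2_eq_square flip: powr_add)
  also have "\<dots> = \<alpha> k ^ 3" using \<alpha>0[OF assms] by (simp add: powr_numeral)
  finally show ?thesis by (simp add: \<epsilon>[OF assms] power_mult_distrib)
qed

lemma \<epsilon>_le:
  assumes "k \<ge> 1" shows "\<epsilon> k \<le> \<gamma> * (1 / \<rho>b) powr (3 / 2)"
  unfolding \<epsilon>[OF assms] using \<alpha>0[OF assms] \<alpha>_less[OF assms] \<gamma>
  by (intro mult_left_mono powr_mono2) auto

lemma sa_pos_def_M: "\<omega> \<in> space \<Omega> \<Longrightarrow> sa_pos_def (M k \<omega>)"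
  using run M0 by (cases "k = 0") (auto simp: ispPPA_def sa_pos_def_id)

lemma norm_equiv: "AE \<omega> in \<Omega>. \<forall>v. \<mu> * N k \<omega> v \<le> norm v \<and> norm v \<le> L * N k \<omega> v"
proof (cases "k \<ge> 1")
  case True
  then show ?thesis by (rule norm_equiv_pos)
next
  case False
  then have [simp]: "k = 0" by simp
  show ?thesis
  proof (rule AE_I2, rule allI)
    fix \<omega> v assume "\<omega> \<in> space \<Omega>"
    then have "N k \<omega> v = norm v" by (simp add: M0 norm_of_def norm_eq_sqrt_inner)
    then show "\<mu> * N k \<omega> v \<le> norm v \<and> norm v \<le> L * N k \<omega> v"
      using \<mu> L mult_right_mono[of \<mu> 1 "norm v"] mult_right_mono[of 1 L "norm v"] by simp
  qed
qed

lemma measurable_M: "(\<lambda>\<omega>. M k \<omega> v) \<in> borel_measurable (minibatch_sigma \<Omega> P m S k)"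
proof (cases "k \<ge> 1")
  case True
  then show ?thesis using run by (simp add: ispPPA_def)
next
  case False
  then have "k = 0" by simp
  then show ?thesis by (subst measurable_cong[where g = "\<lambda>_. v"]) (auto simp: M0)
qed

lemma measurable_x:
  assumes "k \<ge> 1" shows "x k \<in> borel_measurable (past k)"
proof (cases "k = 1")
  case True
  then show ?thesis
    using run by (subst measurable_cong[where g = "\<lambda>_. x1"]) (auto simp: ispPPA_def)
next
  case False
  then have k: "k - 1 \<ge> 1" "k - 1 + 1 = k" using assms by auto
  have "\<forall>k\<ge>1. x (k + 1) \<in> borel_measurable (minibatch_sigma \<Omega> P m S k)"
    using run by (simp add: ispPPA_def)
  from this[rule_format, OF k(1)] show ?thesis unfolding k(2) .
qed

lemma subalgebra_past: "subalgebra \<Omega> (minibatch_sigma \<Omega> P m S k)"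
  by (rule subalgebra_minibatch_sigma[OF prob_\<Omega> iid])

lemmas measurable_past = measurable_from_subalg[OF subalgebra_past]

lemma Xs_finite_value:
  obtains \<phi> where "\<And>y. y \<in> Xs \<Longrightarrow> y \<in> dom_r \<and> F y + rr y = \<phi>"
    "\<And>z. z \<in> dom_r \<Longrightarrow> \<phi> + c1b * (infdist z Xs)\<^sup>2 \<le> F z + rr z"
proof -
  let ?\<phi> = "objective P f r"
  obtain q where q: "q \<in> Xs" using Xs(2) by blast
  have obj: "?\<phi> z = ereal (F z + rr z)" if "z \<in> dom_r" for z
    unfolding objective_def by (subst proper_closed_finite[OF r that]) simp
  have objinf: "?\<phi> z = \<infinity>" if "z \<notin> dom_r" for z
    using not_in_effective_dom[OF that] by (simp add: objective_def)
  have min: "?\<phi> y \<le> ?\<phi> z" if "y \<in> Xs" for y z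
    using that unfolding Xs(1) argmin_set_def is_arg_min_def by (auto simp: not_less)
  obtain z0 where z0: "z0 \<in> dom_r" using dom_r_nonempty by blast
  have dom: "y \<in> dom_r" if "y \<in> Xs" for y
    using min[OF that, of z0] obj[OF z0] objinf[of y] by (cases "y \<in> dom_r") auto
  have inf: "(INF y. ?\<phi> y) = ?\<phi> q"
    by (rule antisym[OF INF_lower[of q] INF_greatest]) (auto intro: min q)
  show thesis
  proof (rule that[of "F q + rr q"])
    fix y assume y: "y \<in> Xs"
    have "?\<phi> y = ?\<phi> q" using min[OF y] min[OF q] by (intro antisym)
    then show "y \<in> dom_r \<and> F y + rr y = F q + rr q"
      using dom[OF y] dom[OF q] by (simp add: obj)
  next
    fix z assume z: "z \<in> dom_r"
    have "(INF y. ?\<phi> y) + ereal (c1b * (infdist z Xs)\<^sup>2) \<le> ?\<phi> z"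
      using growth unfolding quadratic_growth_def Xs(1) by blast
    then show "F q + rr q + c1b * (infdist z Xs)\<^sup>2 \<le> F z + rr z"
      unfolding inf using dom[OF q] z by (simp add: obj)
  qed
qed

lemma Xs_subset: "Xs \<subseteq> V"
proof -
  obtain \<phi> where "\<And>y. y \<in> Xs \<Longrightarrow> y \<in> dom_r \<and> F y + rr y = \<phi>" using Xs_finite_value by metis
  then show ?thesis using V(3) by blast
qed

lemma borel_measurable_model:
  assumes "g \<in> measurable A borel" "h \<in> measurable A borel" "s \<in> measurable A P"
    and "\<And>z. z \<in> space A \<Longrightarrow> g z \<in> V" "\<And>z. z \<in> space A \<Longrightarrow> h z \<in> V"
  shows "(\<lambda>z. fm (g z) (h z) (s z)) \<in> borel_measurable A"
proof -
  have fmm: "(\<lambda>(x, y, s). fm x y s) \<in> borel_measurable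
        (restrict_space borel V \<Otimes>\<^sub>M (restrict_space borel V \<Otimes>\<^sub>M P))"
    using setting by (simp add: model_setting_def)
  have gh: "(\<lambda>z. (g z, h z, s z)) \<in> measurable A (restrict_space borel V \<Otimes>\<^sub>M (restrict_space borel V \<Otimes>\<^sub>M P))"
    using assms by (intro measurable_Pair measurable_restrict_space2) auto
  from measurable_compose[OF gh fmm] show ?thesis by simp
qed

lemma measurable_model_section:
  assumes "u \<in> V" "v \<in> V" shows "(\<lambda>s. fm u v s) \<in> borel_measurable P"
  by (rule borel_measurable_model) (use assms in auto)

text \<open>The values of \<open>f\<close> are only assumed to be integrable, whereas the model is jointly measurable; on the
diagonal the two agree almost surely.\<close>
lemma expected_fun_model:
  assumes u: "u \<in> V"
  shows "integrable P (\<lambda>s. fm u u s)" "F u = (\<integral>s. fm u u s \<partial>P)"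
proof -
  have i: "integrable P (\<lambda>s. real_of_ereal (f u s))"
    using regularity by (simp add: regularity_condition_def)
  have e: "AE s in P. real_of_ereal (f u s) = fm u u s"
    using accuracy_real by eventually_elim (use u in auto)
  show "integrable P (\<lambda>s. fm u u s)"
    using integrable_cong_AE[OF borel_measurable_integrable[OF i] measurable_model_section[OF u u] e] i
    by blast
  show "F u = (\<integral>s. fm u u s \<partial>P)"
    unfolding expected_fun_def
    by (rule integral_cong_AE[OF borel_measurable_integrable[OF i] measurable_model_section[OF u u] e])
qed

lemma continuous_expected_fun: "continuous_on UNIV F"
proof (rule continuous_at_imp_continuous_on, rule ballI)
  fix u :: 'a
  obtain e K where e: "e > 0" "K-lipschitz_on (ball u e) F"
    using regularity unfolding regularity_condition_def by blast
  have "continuous_on (ball u e) F" by (rule lipschitz_on_continuous_on[OF e(2)])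
  then show "isCont F u" using e(1) by (simp add: continuous_on_eq_continuous_at)
qed

text \<open>On a bounded set, the Lipschitz condition compares \<open>fm u u\<close> with \<open>fm u v\<close>, and the accuracy condition
compares \<open>fm u v\<close> with \<open>fm v v\<close>.  Together they make \<open>F\<close> Lipschitz on the whole set and
bound the mean model difference by the difference of \<open>F\<close> plus the accuracy error.\<close>
lemma model_differences:
  assumes U: "bounded U" "U \<subseteq> V"
  obtains Lf LF where "0 \<le> LF" "Lf \<in> borel_measurable P" "\<And>s. s \<in> space P \<Longrightarrow> 0 \<le> Lf s"
    "integrable P Lf" "integrable P (\<lambda>s. (Lf s)\<^sup>2)"
    "AE s in P. \<forall>u\<in>U. \<forall>v\<in>U. \<bar>fm u u s - fm u v s\<bar> \<le> Lf s * norm (u - v)"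
    "\<And>u v. \<lbrakk>u \<in> U; v \<in> U\<rbrakk> \<Longrightarrow> \<bar>F u - F v\<bar> \<le> LF * norm (u - v)"
    "\<And>u v. \<lbrakk>u \<in> U; v \<in> U\<rbrakk> \<Longrightarrow> (\<integral>s. fm u v s - fm u u s \<partial>P) \<le> F v - F u + \<eta>b / 2 * (norm (v - u))\<^sup>2"
proof -
  obtain Lf where Lf: "Lf \<in> borel_measurable P" "\<forall>s\<in>space P. 0 \<le> Lf s" "integrable P (\<lambda>s. (Lf s)\<^sup>2)"
    "AE s in P. \<forall>u\<in>U. \<forall>v\<in>U. \<bar>fm u u s - fm u v s\<bar> \<le> Lf s * norm (u - v)"
    using lipschitz U unfolding local_lipschitz_condition_def by blast
  have iL: "integrable P Lf"
    by (rule P.square_integrable_imp_integrable[OF Lf(1,3)])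
  obtain B where B: "\<And>u. u \<in> U \<Longrightarrow> norm u \<le> B" using U(1) by (auto simp: bounded_iff)
  have B2: "norm (u - v) \<le> 2 * B" if "u \<in> U" "v \<in> U" for u v
    using B[OF that(1)] B[OF that(2)] norm_triangle_ineq4[of u v] by linarith
  define LF where "LF = (\<integral>s. Lf s \<partial>P) + \<eta>b * \<bar>B\<bar>"
  have iL0: "0 \<le> (\<integral>s. Lf s \<partial>P)" by (rule integral_nonneg_AE) (use Lf(2) in auto)
  have FL: "\<bar>F u - F v\<bar> \<le> LF * norm (u - v)" if u: "u \<in> U" and v: "v \<in> U" for u v
  proof -
    have uv: "u \<in> V" "v \<in> V" using u v U by auto
    let ?d = "norm (u - v)"
    have "F u - F v = (\<integral>s. fm u u s - fm v v s \<partial>P)"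
      using expected_fun_model uv by simp
    also have "\<bar>\<dots>\<bar> \<le> (\<integral>s. \<bar>fm u u s - fm v v s\<bar> \<partial>P)" by (rule integral_abs_bound)
    also have "\<dots> \<le> (\<integral>s. Lf s * ?d + \<eta>b / 2 * ?d\<^sup>2 \<partial>P)"
    proof (rule integral_mono_AE)
      show "integrable P (\<lambda>s. \<bar>fm u u s - fm v v s\<bar>)" using expected_fun_model uv by simp
      show "integrable P (\<lambda>s. Lf s * ?d + \<eta>b / 2 * ?d\<^sup>2)" using iL by simp
      show "AE s in P. \<bar>fm u u s - fm v v s\<bar> \<le> Lf s * ?d + \<eta>b / 2 * ?d\<^sup>2"
        using Lf(4) accuracy_real
      proof eventually_elim
        case (elim s)
        have "\<bar>fm u u s - fm u v s\<bar> \<le> Lf s * ?d" using elim(1) u v by blast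
        moreover have "\<bar>fm u v s - fm v v s\<bar> \<le> \<eta>b / 2 * ?d\<^sup>2"
          using elim(2) uv by (simp add: norm_minus_commute)
        ultimately show ?case by linarith
      qed
    qed
    also have "\<dots> = (\<integral>s. Lf s \<partial>P) * ?d + \<eta>b / 2 * ?d\<^sup>2" using iL by (simp add: P.prob_space)
    also have "\<eta>b / 2 * ?d\<^sup>2 \<le> \<eta>b * \<bar>B\<bar> * ?d"
    proof -
      have "\<eta>b / 2 * ?d * ?d \<le> \<eta>b / 2 * (2 * \<bar>B\<bar>) * ?d"
        using B2[OF u v] \<eta>b by (intro mult_right_mono mult_left_mono) auto
      then show ?thesis by (simp add: power2_eq_square)
    qed
    finally show ?thesis by (simp add: LF_def algebra_simps)
  qed
  have E: "(\<integral>s. fm u v s - fm u u s \<partial>P) \<le> F v - F u + \<eta>b / 2 * (norm (v - u))\<^sup>2"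
    if u: "u \<in> U" and v: "v \<in> U" for u v
  proof -
    have uv: "u \<in> V" "v \<in> V" using u v U by auto
    have "(\<integral>s. fm u v s - fm u u s \<partial>P) \<le> (\<integral>s. fm v v s - fm u u s + \<eta>b / 2 * (norm (v - u))\<^sup>2 \<partial>P)"
    proof (rule integral_mono_AE)
      show "integrable P (\<lambda>s. fm v v s - fm u u s + \<eta>b / 2 * (norm (v - u))\<^sup>2)"
        using expected_fun_model uv by simp
      show "integrable P (\<lambda>s. fm u v s - fm u u s)"
      proof (rule Bochner_Integration.integrable_bound)
        show "integrable P (\<lambda>s. Lf s * norm (u - v))" using iL by simp
        show "(\<lambda>s. fm u v s - fm u u s) \<in> borel_measurable P"
          using uv by (intro borel_measurable_diff measurable_model_section)
        show "AE s in P. norm (fm u v s - fm u u s) \<le> norm (Lf s * norm (u - v))"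
          using Lf(4) by eventually_elim (use u v in \<open>force simp: abs_minus_commute\<close>)
      qed
      show "AE s in P. fm u v s - fm u u s \<le> fm v v s - fm u u s + \<eta>b / 2 * (norm (v - u))\<^sup>2"
        using accuracy_real
      proof eventually_elim
        case (elim s)
        then have "\<bar>fm u v s - fm v v s\<bar> \<le> \<eta>b / 2 * (norm (v - u))\<^sup>2" using uv by blast
        then show ?case by linarith
      qed
    qed
    also have "\<dots> = F v - F u + \<eta>b / 2 * (norm (v - u))\<^sup>2"
      using expected_fun_model uv by (simp add: P.prob_space)
    finally show ?thesis .
  qed
  show thesis
    by (rule that[OF _ Lf(1) _ iL Lf(3,4) FL E]) (use iL0 \<eta>b Lf(2) in \<open>auto simp: LF_def\<close>)
qed

end

section \<open>The iterates up to their exit from a ball\<close>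

text \<open>Bookkeeping: with \<open>\<theta> = \<delta> \<alpha>\<close> and \<open>\<epsilon>\<^sup>2 = \<gamma>\<^sup>2 \<alpha>^3\<close> every error of one iteration is a multiple of \<open>\<alpha>\<^sup>2\<close>.
Here \<open>n\<close> is the squared distance to the selected near-projection and \<open>n'\<close> the one to the solution
found by \<open>closest_point_growth\<close>; \<open>av\<close> is the average of the squared sample Lipschitz constants.\<close>
lemma collect_step_errors:
  fixes \<alpha> :: real
  assumes \<alpha>: "0 < \<alpha>" "\<alpha> \<le> a0" and \<delta>: "0 < \<delta>" "\<delta> * \<alpha> \<le> 1" and t: "0 \<le> t" and c: "0 \<le> c" and b: "0 \<le> b"
    and Q: "0 \<le> Q" "Q \<le> 1 + 2 * \<alpha> * c"
    and av: "0 \<le> av" and e2: "e2 = g\<^sup>2 * \<alpha>^3"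
    and n: "n \<le> n' + \<alpha>\<^sup>2"
    and main: "Q * n' \<le> (1 + \<delta> * \<alpha>) * ((J + 2 * \<alpha>\<^sup>2 * L\<^sup>2 * (av + LF\<^sup>2) + (1 - t) * e2 / (\<delta> * \<alpha>)) + 2 * \<alpha> * b * \<alpha>)
      + Q * ((1 + 1 / (\<delta> * \<alpha>)) * e2)"
  shows "Q * n \<le> (1 + \<delta> * \<alpha>) * J + \<alpha>\<^sup>2 * (4 * L\<^sup>2 * av +
      (2 * (2 * L\<^sup>2 * LF\<^sup>2 + g\<^sup>2 / \<delta> + 2 * b) + (1 + 2 * c * a0) * (g\<^sup>2 * (a0 + 1 / \<delta>) + 1)))"
proof -
  have \<theta>: "e2 / (\<delta> * \<alpha>) = \<alpha>\<^sup>2 * (g\<^sup>2 / \<delta>)" using \<alpha> \<delta> by (simp add: e2 field_simps power2_eq_square power3_eq_cube)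
  have e2': "e2 = \<alpha>\<^sup>2 * (g\<^sup>2 * \<alpha>)" by (simp add: e2 power2_eq_square power3_eq_cube)
  have e20: "0 \<le> e2" using \<alpha> by (simp add: e2)
  have "(1 - t) * e2 / (\<delta> * \<alpha>) \<le> e2 / (\<delta> * \<alpha>)"
    using t e20 \<alpha> \<delta> by (intro divide_right_mono) (auto simp: algebra_simps)
  then have h1: "(1 - t) * e2 / (\<delta> * \<alpha>) \<le> \<alpha>\<^sup>2 * (g\<^sup>2 / \<delta>)" unfolding \<theta> .
  define E where "E = 2 * \<alpha>\<^sup>2 * L\<^sup>2 * (av + LF\<^sup>2) + \<alpha>\<^sup>2 * (g\<^sup>2 / \<delta>) + 2 * \<alpha> * b * \<alpha>"
  have E0: "0 \<le> E" unfolding E_def using av b \<alpha> \<delta>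
    by (intro add_nonneg_nonneg mult_nonneg_nonneg) auto
  have "(1 + \<delta> * \<alpha>) * ((J + 2 * \<alpha>\<^sup>2 * L\<^sup>2 * (av + LF\<^sup>2) + (1 - t) * e2 / (\<delta> * \<alpha>)) + 2 * \<alpha> * b * \<alpha>)
      \<le> (1 + \<delta> * \<alpha>) * (J + E)"
    using h1 \<alpha> \<delta> by (intro mult_left_mono) (auto simp: E_def)
  also have "\<dots> = (1 + \<delta> * \<alpha>) * J + (1 + \<delta> * \<alpha>) * E" by (rule distrib_left)
  also have "(1 + \<delta> * \<alpha>) * E \<le> 2 * E" using \<delta> E0 by (intro mult_right_mono) auto
  finally have A: "(1 + \<delta> * \<alpha>) * ((J + 2 * \<alpha>\<^sup>2 * L\<^sup>2 * (av + LF\<^sup>2) + (1 - t) * e2 / (\<delta> * \<alpha>)) + 2 * \<alpha> * b * \<alpha>)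
      \<le> (1 + \<delta> * \<alpha>) * J + 2 * E" by simp
  have "(1 + 1 / (\<delta> * \<alpha>)) * e2 = e2 + e2 / (\<delta> * \<alpha>)" by (simp add: algebra_simps)
  also have "\<dots> = \<alpha>\<^sup>2 * (g\<^sup>2 * (\<alpha> + 1 / \<delta>))" unfolding \<theta> e2' by (simp add: algebra_simps)
  finally have e3: "(1 + 1 / (\<delta> * \<alpha>)) * e2 = \<alpha>\<^sup>2 * (g\<^sup>2 * (\<alpha> + 1 / \<delta>))" .
  have "Q * ((1 + 1 / (\<delta> * \<alpha>)) * e2) + Q * \<alpha>\<^sup>2 = Q * (\<alpha>\<^sup>2 * (g\<^sup>2 * (\<alpha> + 1 / \<delta>) + 1))"
    unfolding e3 by (simp add: algebra_simps)
  also have "\<dots> \<le> (1 + 2 * c * a0) * (\<alpha>\<^sup>2 * (g\<^sup>2 * (a0 + 1 / \<delta>) + 1))"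
  proof (rule mult_mono)
    have "\<alpha> * c \<le> a0 * c" using \<alpha> c by (intro mult_right_mono) auto
    then show "Q \<le> 1 + 2 * c * a0" using Q(2) by (simp add: algebra_simps)
    show "\<alpha>\<^sup>2 * (g\<^sup>2 * (\<alpha> + 1 / \<delta>) + 1) \<le> \<alpha>\<^sup>2 * (g\<^sup>2 * (a0 + 1 / \<delta>) + 1)"
      using \<alpha> by (intro mult_left_mono add_mono) auto
    show "0 \<le> 1 + 2 * c * a0" using \<alpha> c by simp
    show "0 \<le> \<alpha>\<^sup>2 * (g\<^sup>2 * (\<alpha> + 1 / \<delta>) + 1)" using \<alpha> \<delta> by simp
  qed
  finally have B: "Q * ((1 + 1 / (\<delta> * \<alpha>)) * e2) + Q * \<alpha>\<^sup>2 \<le> \<alpha>\<^sup>2 * ((1 + 2 * c * a0) * (g\<^sup>2 * (a0 + 1 / \<delta>) + 1))"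
    by (simp only: mult.left_commute)
  have "Q * n \<le> Q * (n' + \<alpha>\<^sup>2)" using n Q(1) by (rule mult_left_mono)
  then have "Q * n \<le> Q * n' + Q * \<alpha>\<^sup>2" by (simp add: distrib_left)
  moreover have "2 * E = \<alpha>\<^sup>2 * (4 * L\<^sup>2 * av + 2 * (2 * L\<^sup>2 * LF\<^sup>2 + g\<^sup>2 / \<delta> + 2 * b))"
    by (simp add: E_def algebra_simps power2_eq_square)
  ultimately have "Q * n \<le> (1 + \<delta> * \<alpha>) * J + \<alpha>\<^sup>2 * (4 * L\<^sup>2 * av + 2 * (2 * L\<^sup>2 * LF\<^sup>2 + g\<^sup>2 / \<delta> + 2 * b)) +
      \<alpha>\<^sup>2 * ((1 + 2 * c * a0) * (g\<^sup>2 * (a0 + 1 / \<delta>) + 1))"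
    using main A B by linarith
  then show ?thesis by (simp only: distrib_left add.assoc)
qed

context localized_ispPPA
begin

text \<open>The error allowed in the selection of a nearly closest solution.  For iterate \<open>k\<close> it is of the order of the
noise of the preceding step; the first iterate has no preceding step.\<close>
definition slack :: "nat \<Rightarrow> real" where
  "slack k = (if k = 1 then 1 else min 1 ((\<alpha> (k - 1))\<^sup>2))"

definition good :: "nat \<Rightarrow> 'w \<Rightarrow> bool" where
  "good k \<omega> \<longleftrightarrow> (\<forall>j\<in>{1..k}. norm (x j \<omega>) \<le> R) \<and> x k \<omega> \<in> V"

definition anchor :: 'a where "anchor = (SOME y. y \<in> Xs)"

text \<open>The iterates, replaced by a solution once the ball has been left.  In contrast to the event that all
iterates are bounded, \<open>good k\<close> is determined by the samples drawn before iteration \<open>k\<close>.\<close>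
definition X :: "nat \<Rightarrow> 'w \<Rightarrow> 'a" where
  "X k \<omega> = (if good k \<omega> then x k \<omega> else anchor)"

text \<open>Bounds for the norms of \<open>X k\<close> and of a nearly closest solution to it: such a solution is not much
farther away than \<open>anchor\<close>, up to the equivalence constants of the norms and a slack of at most 1.\<close>
definition x_radius :: real where "x_radius = \<bar>R\<bar> + norm anchor"

definition y_radius :: real where "y_radius = x_radius + L * sqrt (((x_radius + norm anchor) / \<mu>)\<^sup>2 + 1)"

lemma anchor: "anchor \<in> Xs"
  using Xs(2) unfolding anchor_def by (simp add: some_in_eq)

lemma slack_pos: "k \<ge> 1 \<Longrightarrow> 0 < slack k"
  using \<alpha>0[of "k - 1"] by (cases "k = 1") (simp_all add: slack_def less_imp_neq[symmetric])

lemma slack_le_1: "slack k \<le> 1" and slack_Suc: "k \<ge> 1 \<Longrightarrow> slack (k + 1) \<le> (\<alpha> k)\<^sup>2"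
  by (auto simp: slack_def)

lemma good_Suc: "\<lbrakk>good (k + 1) \<omega>; x k \<omega> \<in> V\<rbrakk> \<Longrightarrow> good k \<omega>"
  by (auto simp: good_def)

lemma X_in_V: "X k \<omega> \<in> V"
  using anchor Xs_subset by (auto simp: X_def good_def)

lemma norm_X_le: "k \<ge> 1 \<Longrightarrow> norm (X k \<omega>) \<le> x_radius"
proof (cases "good k \<omega>")
  case True
  moreover assume "k \<ge> 1"
  ultimately have "norm (x k \<omega>) \<le> R" by (simp add: good_def)
  also have "R \<le> x_radius" using abs_ge_self[of R] norm_ge_zero[of anchor] unfolding x_radius_def by linarith
  finally show ?thesis using True by (simp add: X_def)
qed (simp add: X_def x_radius_def)

lemma x_radius_le_y_radius: "x_radius \<le> y_radius" using L by (simp add: y_radius_def)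

lemma measurable_good:
  assumes k: "k \<ge> 1" shows "Measurable.pred (past k) (good k)"
proof -
  have 1: "Measurable.pred (past k) (\<lambda>\<omega>. norm (x j \<omega>) \<le> R)" if "j \<in> {1..k}" for j
  proof -
    have "x j \<in> borel_measurable (past k)"
      using that by (intro measurable_from_subalg[OF subalgebra_minibatch_sigma_mono measurable_x]) auto
    then show ?thesis by simp
  qed
  have "Measurable.pred (past k) (\<lambda>\<omega>. x k \<omega> \<in> V)"
    by (rule pred_sets2[OF borel_open[OF V(1)] measurable_x[OF k]])
  with 1 show ?thesis unfolding good_def
    by (intro pred_intros_logic pred_intros_finite) auto
qed

lemma measurable_X:
  assumes k: "k \<ge> 1" shows "X k \<in> borel_measurable (past k)"
  unfolding X_def by (intro measurable_If measurable_x[OF k] measurable_const) (use measurable_good[OF k] in \<open>simp_all add: pred_def\<close>)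

text \<open>The selected solution is cut off at \<open>y_radius\<close> so that it is bounded everywhere; almost surely the
cut-off changes nothing.\<close>
lemma exists_near_projection:
  assumes k: "k \<ge> 1"
  shows "\<exists>Y. Y \<in> borel_measurable (past k) \<and> (\<forall>\<omega>. Y \<omega> \<in> Xs \<and> norm (Y \<omega>) \<le> y_radius \<and> (\<not> good k \<omega> \<longrightarrow> Y \<omega> = anchor)) \<and>
    (AE \<omega> in \<Omega>. \<forall>y\<in>Xs. (N (k - 1) \<omega> (X k \<omega> - Y \<omega>))\<^sup>2 \<le> (N (k - 1) \<omega> (X k \<omega> - y))\<^sup>2 + slack k)"
proof -
  obtain Z where Z: "Z \<in> borel_measurable (past k)" "\<And>\<omega>. Z \<omega> \<in> Xs"
    "\<And>\<omega> y. \<lbrakk>\<omega> \<in> space (past k); y \<in> Xs\<rbrakk> \<Longrightarrow>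
      (N (k - 1) \<omega> (X k \<omega> - Z \<omega>))\<^sup>2 \<le> (N (k - 1) \<omega> (X k \<omega> - y))\<^sup>2 + slack k"
    by (rule measurable_near_projection[where M = "M (k - 1)" and X = "X k" and F = "past k",
          OF _ measurable_M measurable_X[OF k] Xs(2) slack_pos[OF k]])
       (use sa_pos_def_M in auto)
  define Y where "Y \<omega> = (if good k \<omega> \<and> norm (Z \<omega>) \<le> y_radius then Z \<omega> else anchor)" for \<omega>
  have zm: "Measurable.pred (past k) (\<lambda>\<omega>. norm (Z \<omega>) \<le> y_radius)" using Z(1) by simp
  have pr: "Measurable.pred (past k) (\<lambda>\<omega>. good k \<omega> \<and> norm (Z \<omega>) \<le> y_radius)"
    by (rule pred_intros_logic(3)[OF measurable_good[OF k] zm])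
  have "Y \<in> borel_measurable (past k)"
    unfolding Y_def by (intro measurable_If Z(1) measurable_const pr[unfolded pred_def]) simp
  moreover have "Y \<omega> \<in> Xs \<and> norm (Y \<omega>) \<le> y_radius \<and> (\<not> good k \<omega> \<longrightarrow> Y \<omega> = anchor)" for \<omega>
    using Z(2) anchor x_radius_le_y_radius by (auto simp: Y_def x_radius_def)
  moreover have "AE \<omega> in \<Omega>. \<forall>y\<in>Xs. (N (k - 1) \<omega> (X k \<omega> - Y \<omega>))\<^sup>2 \<le> (N (k - 1) \<omega> (X k \<omega> - y))\<^sup>2 + slack k"
    using norm_equiv[of "k - 1"] AE_space
  proof eventually_elim
    case (elim \<omega>)
    note Zo = Z(3)[unfolded space_minibatch_sigma, OF elim(2)]
    have pd: "sa_pos_def (M (k - 1) \<omega>)" by (rule sa_pos_def_M[OF elim(2)])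
    show ?case
    proof (cases "good k \<omega>")
      case False
      then have "X k \<omega> - Y \<omega> = 0" by (simp add: X_def Y_def)
      then show ?thesis using slack_pos[OF k] by (simp add: norm_of_def less_imp_le)
    next
      case True
      have n: "norm (X k \<omega> - anchor) \<le> x_radius + norm anchor"
        using norm_X_le[OF k, of \<omega>] norm_triangle_ineq4[of "X k \<omega>" anchor] by linarith
      have "\<mu> * N (k - 1) \<omega> (X k \<omega> - anchor) \<le> x_radius + norm anchor"
        using elim(1) n by (blast intro: order_trans)
      then have "N (k - 1) \<omega> (X k \<omega> - anchor) \<le> (x_radius + norm anchor) / \<mu>"
        using \<mu>(1) by (simp add: pos_le_divide_eq mult.commute)
      then have "(N (k - 1) \<omega> (X k \<omega> - anchor))\<^sup>2 \<le> ((x_radius + norm anchor) / \<mu>)\<^sup>2"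
        using norm_of_nonneg[OF pd] by (intro power_mono) auto
      then have "(N (k - 1) \<omega> (X k \<omega> - Z \<omega>))\<^sup>2 \<le> ((x_radius + norm anchor) / \<mu>)\<^sup>2 + 1"
        using Zo[OF anchor] slack_le_1[of k] by linarith
      then have "N (k - 1) \<omega> (X k \<omega> - Z \<omega>) \<le> sqrt (((x_radius + norm anchor) / \<mu>)\<^sup>2 + 1)"
        by (rule real_le_rsqrt)
      then have "L * N (k - 1) \<omega> (X k \<omega> - Z \<omega>) \<le> L * sqrt (((x_radius + norm anchor) / \<mu>)\<^sup>2 + 1)"
        using L by (intro mult_left_mono) auto
      moreover have "norm (X k \<omega> - Z \<omega>) \<le> L * N (k - 1) \<omega> (X k \<omega> - Z \<omega>)" using elim(1) by blast
      moreover have "norm (Z \<omega>) \<le> norm (X k \<omega>) + norm (X k \<omega> - Z \<omega>)"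
        using norm_triangle_ineq4[of "X k \<omega>" "X k \<omega> - Z \<omega>"] by simp
      ultimately have "norm (Z \<omega>) \<le> y_radius" using norm_X_le[OF k, of \<omega>] by (simp add: y_radius_def)
      then have "Y \<omega> = Z \<omega>" using True by (simp add: Y_def)
      then show ?thesis using Zo by simp
    qed
  qed
  ultimately show ?thesis by blast
qed

definition Y :: "nat \<Rightarrow> 'w \<Rightarrow> 'a" where
  "Y k = (SOME Y. Y \<in> borel_measurable (past k) \<and>
    (\<forall>\<omega>. Y \<omega> \<in> Xs \<and> norm (Y \<omega>) \<le> y_radius \<and> (\<not> good k \<omega> \<longrightarrow> Y \<omega> = anchor)) \<and>
    (AE \<omega> in \<Omega>. \<forall>y\<in>Xs. (N (k - 1) \<omega> (X k \<omega> - Y \<omega>))\<^sup>2 \<le> (N (k - 1) \<omega> (X k \<omega> - y))\<^sup>2 + slack k))"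

lemma Y:
  assumes "k \<ge> 1"
  shows "Y k \<in> borel_measurable (past k)" "Y k \<omega> \<in> Xs" "norm (Y k \<omega>) \<le> y_radius"
    "\<not> good k \<omega> \<Longrightarrow> Y k \<omega> = anchor"
    "AE \<omega> in \<Omega>. \<forall>y\<in>Xs. (N (k - 1) \<omega> (X k \<omega> - Y k \<omega>))\<^sup>2 \<le> (N (k - 1) \<omega> (X k \<omega> - y))\<^sup>2 + slack k"
  using someI_ex[OF exists_near_projection[OF assms], folded Y_def] by blast+

text \<open>The radius leaves room for a point within \<open>\<epsilon>\<^sub>k\<close>, in the norm of the preconditioner, of an iterate in
the ball of radius \<open>R\<close>.\<close>
definition U :: "'a set" where
  "U = V \<inter> cball 0 (y_radius + L * (\<gamma> * (1 / \<rho>b) powr (3 / 2)))"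

lemma U: "bounded U" "U \<subseteq> V"
  unfolding U_def by (auto intro: bounded_subset[OF bounded_cball])

lemma y_radius_le_U: "y_radius \<le> y_radius + L * (\<gamma> * (1 / \<rho>b) powr (3 / 2))"
  using L \<gamma> by simp

lemma X_in_U: "k \<ge> 1 \<Longrightarrow> X k \<omega> \<in> U" and Y_in_U: "k \<ge> 1 \<Longrightarrow> Y k \<omega> \<in> U"
  using X_in_V norm_X_le[of k \<omega>] x_radius_le_y_radius y_radius_le_U Y(2,3)[of k \<omega>] Xs_subset
  by (auto simp: U_def intro: order_trans)

text \<open>The norm is that of the preceding iteration, so the integrand belongs to the past of iteration \<open>k\<close>.\<close>
definition merit :: "nat \<Rightarrow> real" where
  "merit k = (\<integral>\<omega>. (N (k - 1) \<omega> (X k \<omega> - Y k \<omega>))\<^sup>2 \<partial>\<Omega>)"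

text \<open>How much more the sampled model favours \<open>X k\<close> over the solution \<open>Y k\<close> than the objective does.  Its
expectation is controlled by the model accuracy.\<close>
definition model_gain :: "nat \<Rightarrow> 'w \<Rightarrow> real" where
  "model_gain k \<omega> = 1 / real m * (\<Sum>i=1..m. fm (X k \<omega>) (Y k \<omega>) (S k i \<omega>) - fm (X k \<omega>) (X k \<omega>) (S k i \<omega>))
     - F (Y k \<omega>) + F (X k \<omega>)"

text \<open>The part of the bound in \<open>collect_step_errors\<close> that does not depend on the sample, with \<open>1 / \<rho>b\<close> as the bound
for the stepsizes.\<close>
definition noise_const :: "real \<Rightarrow> real \<Rightarrow> real" where
  "noise_const \<delta> LF = 2 * (2 * L\<^sup>2 * LF\<^sup>2 + \<gamma>\<^sup>2 / \<delta> + 2 * c1b) + (1 + 2 * c1 * (1 / \<rho>b)) * (\<gamma>\<^sup>2 * (1 / \<rho>b + 1 / \<delta>) + 1)"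

lemma noise_const_nonneg: "0 < \<delta> \<Longrightarrow> 0 \<le> noise_const \<delta> LF"
  unfolding noise_const_def using c10 c1b \<rho>b0
  by (intro add_nonneg_nonneg mult_nonneg_nonneg) auto

lemma AE_sample:
  assumes "AE s in P. Q s" "k \<ge> 1" "i \<in> {1..m}"
  shows "AE \<omega> in \<Omega>. Q (S k i \<omega>)"
  using iid_minibatches_measurable[OF prob_\<Omega> iid assms(2,3)] assms(1) AE_distrD by metis

text \<open>If iterate \<open>k + 1\<close> is still in the ball, the near-minimizer \<open>z\<close> is in \<open>U\<close>, and the two lemmas on one
iteration apply.  Otherwise the left-hand side is 0, and the right-hand side is nonnegative because
\<open>X k\<close> and \<open>Y k\<close> are in \<open>U\<close>.\<close>
lemma pointwise_step:
  assumes k: "k \<ge> 1" and \<delta>: "0 < \<delta>" "\<delta> \<le> \<rho>b" and LF: "0 \<le> LF"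
    and Lf: "\<And>s. s \<in> space P \<Longrightarrow> 0 \<le> Lf s"
    and lip: "AE s in P. \<forall>u\<in>U. \<forall>v\<in>U. \<bar>fm u u s - fm u v s\<bar> \<le> Lf s * norm (u - v)"
    and FL: "\<And>u v. \<lbrakk>u \<in> U; v \<in> U\<rbrakk> \<Longrightarrow> \<bar>F u - F v\<bar> \<le> LF * norm (u - v)"
  shows "AE \<omega> in \<Omega>. ((1 - \<tau> * \<alpha> k) * (1 - \<delta> * \<alpha> k) + 2 * \<alpha> k * c1) * (N k \<omega> (X (k + 1) \<omega> - Y (k + 1) \<omega>))\<^sup>2 \<le>
    (1 + \<delta> * \<alpha> k) * ((N k \<omega> (Y k \<omega> - X k \<omega>))\<^sup>2 + 2 * \<alpha> k * model_gain k \<omega>)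
    + (\<alpha> k)\<^sup>2 * (4 * L\<^sup>2 * (1 / real m * (\<Sum>i=1..m. (Lf (S k i \<omega>))\<^sup>2)) + noise_const \<delta> LF)"
proof -
  obtain \<phi> where \<phi>: "\<And>y. y \<in> Xs \<Longrightarrow> y \<in> dom_r \<and> F y + rr y = \<phi>"
    "\<And>z. z \<in> dom_r \<Longrightarrow> \<phi> + c1b * (infdist z Xs)\<^sup>2 \<le> F z + rr z" using Xs_finite_value by metis
  have "AE \<omega> in \<Omega>. \<forall>k\<ge>1. x k \<omega> \<in> V \<and> inexact_prox_step \<tau> (M k \<omega>) (\<alpha> k) (\<epsilon> k)
          (minibatch_model m fm r (x k \<omega>) (\<lambda>i. S k i \<omega>)) (x k \<omega>) (x (k + 1) \<omega>)"
    using run by (simp add: ispPPA_def)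
  moreover have "AE \<omega> in \<Omega>. \<forall>i\<in>{1..m}. \<forall>u\<in>V. weakly_convex \<tau>b (composite_model fm r u (S k i \<omega>))"
  proof (rule AE_finite_allI)
    fix i assume i: "i \<in> {1..m}"
    have "AE s in P. \<forall>u\<in>V. weakly_convex \<tau>b (composite_model fm r u s)"
      using regularity unfolding regularity_condition_def by auto
    then show "AE \<omega> in \<Omega>. \<forall>u\<in>V. weakly_convex \<tau>b (composite_model fm r u (S k i \<omega>))"
      by (rule AE_sample[OF _ k i])
  qed simp
  moreover have "AE \<omega> in \<Omega>. \<forall>i\<in>{1..m}. \<forall>u\<in>U. \<forall>v\<in>U.
      \<bar>fm u u (S k i \<omega>) - fm u v (S k i \<omega>)\<bar> \<le> Lf (S k i \<omega>) * norm (u - v)"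
    by (rule AE_finite_allI) (auto intro: AE_sample[OF lip k])
  moreover note norm_equiv[of k]
  moreover have "AE \<omega> in \<Omega>. \<forall>y\<in>Xs. (N k \<omega> (X (k + 1) \<omega> - Y (k + 1) \<omega>))\<^sup>2 \<le>
      (N k \<omega> (X (k + 1) \<omega> - y))\<^sup>2 + slack (k + 1)"
    using Y(5)[of "k + 1"] by simp
  ultimately show ?thesis using AE_space
  proof eventually_elim
    case (elim \<omega>)
    note step = elim(1)[rule_format, OF k] and wc = elim(2)[rule_format] and lip = elim(3)[rule_format]
    have pd: "sa_pos_def (M k \<omega>)" by (rule sa_pos_def_M[OF elim(6)])
    have \<mu>N: "\<mu> * N k \<omega> v \<le> norm v" and LN: "norm v \<le> L * N k \<omega> v" for v using elim(4) by auto
    have l0: "0 \<le> Lf (S k i \<omega>)" if "i \<in> {1..m}" for i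
      using Lf measurable_space[OF iid_minibatches_measurable(1)[OF prob_\<Omega> iid k that] elim(6)] by blast
    have a0: "0 < \<alpha> k" and a1: "\<alpha> k < 1 / \<rho>b" using \<alpha>0[OF k] \<alpha>_less[OF k] by auto
    have small: "c * \<alpha> k < 1" if "c \<le> \<rho>b" for c
    proof -
      have "c * \<alpha> k \<le> \<rho>b * \<alpha> k" using that a0 by (intro mult_right_mono) auto
      then show ?thesis using step_small[OF k] by (simp add: mult.commute)
    qed
    have \<tau>1: "\<tau> * \<alpha> k < 1" using \<eta>0 \<rho>b by (intro small) auto
    have \<delta>a1: "\<delta> * \<alpha> k < 1" using \<delta> by (intro small)
    have \<delta>a0: "0 < \<delta> * \<alpha> k" using \<delta> a0 by simp
    have \<tau>a0: "0 \<le> \<tau> * \<alpha> k" using \<tau>0 a0 by simp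
    let ?av = "1 / real m * (\<Sum>i=1..m. (Lf (S k i \<omega>))\<^sup>2)"
    let ?A = "(1 - \<tau> * \<alpha> k) * (1 - \<delta> * \<alpha> k)"
    let ?J = "(N k \<omega> (Y k \<omega> - X k \<omega>))\<^sup>2 + 2 * \<alpha> k * model_gain k \<omega>"
    have av0: "0 \<le> ?av" by (intro mult_nonneg_nonneg sum_nonneg) auto
    have A0: "0 \<le> ?A" using \<tau>1 \<delta>a1 by simp
    have A1: "?A \<le> 1" using \<tau>1 \<delta>a1 \<tau>a0 \<delta>a0 by (intro mult_le_one) auto
    show ?case
    proof (cases "good (k + 1) \<omega>")
      \<comment> \<open>The factor \<open>1 + \<delta> \<alpha>\<^sub>k\<close> is at most 2, so the noise term dominates the negative part.\<close>
      case False
      have k1: "k + 1 \<ge> 1" by simp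
      have z: "X (k + 1) \<omega> - Y (k + 1) \<omega> = 0" using False Y(4)[OF k1 False] by (simp add: X_def)
      have lb: "- (2 * (\<alpha> k)\<^sup>2 * L\<^sup>2 * (?av + LF\<^sup>2)) \<le> ?J"
        unfolding model_gain_def
        by (rule model_difference_lower_bound[where fm = fm and U = U and b = "\<lambda>i. S k i \<omega>",
              OF m less_imp_le[OF a0] pd LN l0 lip LF FL X_in_U[OF k] Y_in_U[OF k]])
      have E0: "0 \<le> 2 * (\<alpha> k)\<^sup>2 * L\<^sup>2 * (?av + LF\<^sup>2)" using av0 by simp
      have "(1 + \<delta> * \<alpha> k) * (2 * (\<alpha> k)\<^sup>2 * L\<^sup>2 * (?av + LF\<^sup>2)) \<le> 2 * (2 * (\<alpha> k)\<^sup>2 * L\<^sup>2 * (?av + LF\<^sup>2))"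
        using \<delta>a1 E0 by (intro mult_right_mono) auto
      moreover have "(1 + \<delta> * \<alpha> k) * (- (2 * (\<alpha> k)\<^sup>2 * L\<^sup>2 * (?av + LF\<^sup>2))) \<le> (1 + \<delta> * \<alpha> k) * ?J"
        using lb \<delta>a0 by (intro mult_left_mono) auto
      moreover have "2 * (2 * (\<alpha> k)\<^sup>2 * L\<^sup>2 * (?av + LF\<^sup>2)) = (\<alpha> k)\<^sup>2 * (4 * L\<^sup>2 * ?av + 4 * L\<^sup>2 * LF\<^sup>2)"
        by (simp add: algebra_simps)
      moreover have "4 * L\<^sup>2 * LF\<^sup>2 \<le> noise_const \<delta> LF"
      proof -
        have "0 \<le> (1 + 2 * c1 * (1 / \<rho>b)) * (\<gamma>\<^sup>2 * (1 / \<rho>b + 1 / \<delta>) + 1)"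
          using c10 \<rho>b0 \<delta> by (intro mult_nonneg_nonneg add_nonneg_nonneg) auto
        moreover have "0 \<le> \<gamma>\<^sup>2 / \<delta>" using \<delta> by simp
        moreover have "2 * (2 * L\<^sup>2 * LF\<^sup>2 + \<gamma>\<^sup>2 / \<delta> + 2 * c1b) = 4 * L\<^sup>2 * LF\<^sup>2 + 2 * (\<gamma>\<^sup>2 / \<delta>) + 4 * c1b" by simp
        ultimately show ?thesis unfolding noise_const_def using c1b by linarith
      qed
      then have "(\<alpha> k)\<^sup>2 * (4 * L\<^sup>2 * ?av + 4 * L\<^sup>2 * LF\<^sup>2) \<le> (\<alpha> k)\<^sup>2 * (4 * L\<^sup>2 * ?av + noise_const \<delta> LF)"
        by (intro mult_left_mono) auto
      ultimately have "0 \<le> (1 + \<delta> * \<alpha> k) * ?J + (\<alpha> k)\<^sup>2 * (4 * L\<^sup>2 * ?av + noise_const \<delta> LF)"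
        by linarith
      then show ?thesis unfolding z by (simp add: norm_of_def)
    next
      case True
      have xV: "x k \<omega> \<in> V" using step by blast
      have gk: "good k \<omega>" using good_Suc[OF True xV] .
      have Xk: "X k \<omega> = x k \<omega>" "X (k + 1) \<omega> = x (k + 1) \<omega>" using gk True by (simp_all add: X_def)
      have yX: "Y k \<omega> \<in> Xs" by (rule Y(2)[OF k])
      have near: "z \<in> U" if z: "z \<in> dom_r" "N k \<omega> (x (k + 1) \<omega> - z) \<le> \<epsilon> k" for z
      proof -
        have "norm (x (k + 1) \<omega> - z) \<le> L * N k \<omega> (x (k + 1) \<omega> - z)" by (rule LN)
        also have "\<dots> \<le> L * (\<gamma> * (1 / \<rho>b) powr (3 / 2))"
          using z(2) \<epsilon>_le[OF k] L by (intro mult_left_mono) auto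
        finally have "norm z \<le> norm (x (k + 1) \<omega>) + L * (\<gamma> * (1 / \<rho>b) powr (3 / 2))"
          using norm_triangle_ineq4[of "x (k + 1) \<omega>" "x (k + 1) \<omega> - z"] by simp
        moreover have "norm (x (k + 1) \<omega>) \<le> y_radius"
          using norm_X_le[of "k + 1" \<omega>] x_radius_le_y_radius Xk by simp
        ultimately show ?thesis using z(1) V(3) by (auto simp: U_def)
      qed
      obtain z where z: "N k \<omega> (x (k + 1) \<omega> - z) \<le> \<epsilon> k"
        "?A * (N k \<omega> (z - Y k \<omega>))\<^sup>2 + 2 * \<alpha> k * c1b * (infdist z Xs)\<^sup>2 \<le>
          ?J + 2 * (\<alpha> k)\<^sup>2 * L\<^sup>2 * (?av + LF\<^sup>2) + (1 - \<tau> * \<alpha> k) * (\<epsilon> k)\<^sup>2 / (\<delta> * \<alpha> k)"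
        unfolding model_gain_def Xk(1)
        by (rule model_step_growth_inequality[where fm = fm and U = U and b = "\<lambda>i. S k i \<omega>" and r = r and \<phi> = \<phi>
              and l = "\<lambda>i. Lf (S k i \<omega>)" and F = F and Xs = Xs and c = c1b and LF = LF and y = "Y k \<omega>" and m = m
              and x = "x k \<omega>",
              OF r m wc[OF _ xV] \<tau>b pd LN \<tau> a0 \<tau>1 \<delta>a0 \<delta>a1 \<epsilon>0[OF k] l0 lip LF FL \<phi>(2) _ _ _ near])
           (use \<phi>(1)[OF yX] X_in_U[OF k, of \<omega>] Xk step in auto)
      have B0: "0 \<le> 2 * \<alpha> k * c1b" using a0 c1b by simp
      have B\<mu>: "2 * \<alpha> k * c1b * \<mu>\<^sup>2 = 2 * \<alpha> k * c1" by (simp add: c1)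
      obtain y' where y': "y' \<in> Xs"
        "(?A + 2 * \<alpha> k * c1) * (N k \<omega> (x (k + 1) \<omega> - y'))\<^sup>2 \<le>
          (1 + \<delta> * \<alpha> k) * ((?J + 2 * (\<alpha> k)\<^sup>2 * L\<^sup>2 * (?av + LF\<^sup>2) + (1 - \<tau> * \<alpha> k) * (\<epsilon> k)\<^sup>2 / (\<delta> * \<alpha> k)) + 2 * \<alpha> k * c1b * \<alpha> k)
          + (?A + 2 * \<alpha> k * c1) * ((1 + 1 / (\<delta> * \<alpha> k)) * (\<epsilon> k)\<^sup>2)"
        using closest_point_growth[OF pd less_imp_le[OF \<mu>(1)] \<mu>N A0 B0 \<delta>a0 a0 yX z(2,1)]
        unfolding B\<mu> by blast
      have "(N k \<omega> (X (k + 1) \<omega> - Y (k + 1) \<omega>))\<^sup>2 \<le> (N k \<omega> (x (k + 1) \<omega> - y'))\<^sup>2 + (\<alpha> k)\<^sup>2"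
        using elim(5)[rule_format, OF y'(1)] slack_Suc[OF k] unfolding Xk(2) by linarith
      from collect_step_errors[OF a0 less_imp_le[OF a1] \<delta>(1) less_imp_le[OF \<delta>a1] \<tau>a0 less_imp_le[OF c10]
          less_imp_le[OF c1b] _ _ av0 \<epsilon>_power2[OF k] this y'(2)]
      show ?thesis unfolding noise_const_def using A0 A1 a0 c10 by simp
    qed
  qed
qed

lemma integrable_norm_of_power2:
  assumes v: "v \<in> borel_measurable \<Omega>" "\<And>\<omega>. \<omega> \<in> space \<Omega> \<Longrightarrow> norm (v \<omega>) \<le> B"
  shows "integrable \<Omega> (\<lambda>\<omega>. (N k \<omega> (v \<omega>))\<^sup>2)" "(\<integral>\<omega>. (N k \<omega> (v \<omega>))\<^sup>2 \<partial>\<Omega>) \<le> (B / \<mu>)\<^sup>2"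
proof -
  have bnd: "AE \<omega> in \<Omega>. (N k \<omega> (v \<omega>))\<^sup>2 \<le> (B / \<mu>)\<^sup>2"
    using norm_equiv[of k] AE_space
  proof eventually_elim
    case (elim \<omega>)
    have "\<mu> * N k \<omega> (v \<omega>) \<le> B" using elim(1) v(2)[OF elim(2)] by (blast intro: order_trans)
    then have "N k \<omega> (v \<omega>) \<le> B / \<mu>" using \<mu>(1) by (simp add: pos_le_divide_eq mult.commute)
    then show ?case using norm_of_nonneg[OF sa_pos_def_M[OF elim(2)]] by (intro power_mono) auto
  qed
  have m: "(\<lambda>\<omega>. (N k \<omega> (v \<omega>))\<^sup>2) \<in> borel_measurable \<Omega>"
    by (rule borel_measurable_norm_of_power2[OF sa_pos_def_M measurable_past[OF measurable_M] v(1)])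
  show i: "integrable \<Omega> (\<lambda>\<omega>. (N k \<omega> (v \<omega>))\<^sup>2)"
    by (rule integrable_const_bound[OF _ m, of "(B / \<mu>)\<^sup>2"]) (use bnd in simp)
  have "(\<integral>\<omega>. (N k \<omega> (v \<omega>))\<^sup>2 \<partial>\<Omega>) \<le> (\<integral>\<omega>. (B / \<mu>)\<^sup>2 \<partial>\<Omega>)"
    by (rule integral_mono_AE[OF i _ bnd]) simp
  then show "(\<integral>\<omega>. (N k \<omega> (v \<omega>))\<^sup>2 \<partial>\<Omega>) \<le> (B / \<mu>)\<^sup>2" by (simp add: prob_space)
qed

lemma norm_X_minus_Y: "k \<ge> 1 \<Longrightarrow> norm (X k \<omega> - Y k \<omega>) \<le> 2 * y_radius"
  using norm_X_le[of k \<omega>] x_radius_le_y_radius Y(3)[of k \<omega>] norm_triangle_ineq4[of "X k \<omega>" "Y k \<omega>"] by linarith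

lemma measurable_XY:
  assumes "k \<ge> 1"
  shows "X k \<in> borel_measurable \<Omega>" "Y k \<in> borel_measurable \<Omega>" "(\<lambda>\<omega>. X k \<omega> - Y k \<omega>) \<in> borel_measurable (past k)"
  using measurable_X[OF assms] Y(1)[OF assms] measurable_past by auto

lemma merit_nonneg: "0 \<le> merit k" unfolding merit_def by simp

lemma merit_le:
  assumes "k \<ge> 1" shows "merit k \<le> (2 * y_radius / \<mu>)\<^sup>2"
  unfolding merit_def
  by (rule integrable_norm_of_power2(2)[OF measurable_past[OF measurable_XY(3)[OF assms]] norm_X_minus_Y[OF assms]])

lemma expected_norm_change:
  assumes k: "k \<ge> 1"
  shows "(\<integral>\<omega>. (N k \<omega> (X k \<omega> - Y k \<omega>))\<^sup>2 \<partial>\<Omega>) \<le> (\<rho> k)\<^sup>2 * merit k"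
  unfolding merit_def
proof (rule cond_exp_norm_ratio_bound[OF prob_\<Omega> subalgebra_past[of "k - 1"] sa_pos_def_M measurable_M sa_pos_def_M
      measurable_past[OF measurable_M] _ _ ratio[OF k] measurable_XY(3)[OF k] norm_X_minus_Y[OF k]])
  have "AE \<omega> in \<Omega>. \<forall>v. (N j \<omega> v)\<^sup>2 \<le> (1 / \<mu>)\<^sup>2 * (norm v)\<^sup>2" for j
    using norm_equiv[of j] AE_space
  proof eventually_elim
    case (elim \<omega>)
    show ?case
    proof
      fix v
      have "N j \<omega> v \<le> 1 / \<mu> * norm v" using elim(1) \<mu>(1) by (simp add: pos_le_divide_eq mult.commute)
      then have "(N j \<omega> v)\<^sup>2 \<le> (1 / \<mu> * norm v)\<^sup>2"
        using norm_of_nonneg[OF sa_pos_def_M[OF elim(2)]] by (intro power_mono) auto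
      then show "(N j \<omega> v)\<^sup>2 \<le> (1 / \<mu>)\<^sup>2 * (norm v)\<^sup>2" by (simp only: power_mult_distrib)
    qed
  qed
  then show "AE \<omega> in \<Omega>. \<forall>v. (N (k - 1) \<omega> v)\<^sup>2 \<le> (1 / \<mu>)\<^sup>2 * (norm v)\<^sup>2"
    "AE \<omega> in \<Omega>. \<forall>v. (N k \<omega> v)\<^sup>2 \<le> (1 / \<mu>)\<^sup>2 * (norm v)\<^sup>2" by blast+
qed

end

section \<open>The one-step inequality in expectation\<close>

context localized_ispPPA
begin

lemma integrable_past_values:
  assumes k: "k \<ge> 1" and FL: "\<And>u v. \<lbrakk>u \<in> U; v \<in> U\<rbrakk> \<Longrightarrow> \<bar>F u - F v\<bar> \<le> LF * norm (u - v)"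
  shows "integrable \<Omega> (\<lambda>\<omega>. F (X k \<omega>))" "integrable \<Omega> (\<lambda>\<omega>. F (Y k \<omega>))"
    "integrable \<Omega> (\<lambda>\<omega>. (norm (Y k \<omega> - X k \<omega>))\<^sup>2)"
proof -
  have Fm: "F \<in> borel_measurable borel" by (rule borel_measurable_continuous_onI[OF continuous_expected_fun])
  obtain B where B: "\<And>u. u \<in> U \<Longrightarrow> norm u \<le> B" using U(1) by (auto simp: bounded_iff)
  have anU: "anchor \<in> U" using Y_in_U[OF k] X_in_U[OF k] anchor Xs_subset x_radius_le_y_radius y_radius_le_U
    by (auto simp: U_def x_radius_def)
  have FB: "\<bar>F u\<bar> \<le> \<bar>F anchor\<bar> + \<bar>LF\<bar> * (2 * B)" if "u \<in> U" for u
  proof -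
    have "norm (u - anchor) \<le> 2 * B"
      using B[OF that] B[OF anU] norm_triangle_ineq4[of u anchor] by linarith
    then have "LF * norm (u - anchor) \<le> \<bar>LF\<bar> * (2 * B)" by (intro mult_mono) auto
    with FL[OF that anU] show ?thesis by linarith
  qed
  show "integrable \<Omega> (\<lambda>\<omega>. F (X k \<omega>))"
    by (rule integrable_const_bound[of _ "\<bar>F anchor\<bar> + \<bar>LF\<bar> * (2 * B)"])
       (use FB X_in_U[OF k] measurable_compose[OF measurable_XY(1)[OF k] Fm] in auto)
  show "integrable \<Omega> (\<lambda>\<omega>. F (Y k \<omega>))"
    by (rule integrable_const_bound[of _ "\<bar>F anchor\<bar> + \<bar>LF\<bar> * (2 * B)"])
       (use FB Y_in_U[OF k] measurable_compose[OF measurable_XY(2)[OF k] Fm] in auto)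
  show "integrable \<Omega> (\<lambda>\<omega>. (norm (Y k \<omega> - X k \<omega>))\<^sup>2)"
  proof (rule integrable_const_bound[of _ "(2 * y_radius)\<^sup>2"])
    show "AE \<omega> in \<Omega>. norm ((norm (Y k \<omega> - X k \<omega>))\<^sup>2) \<le> (2 * y_radius)\<^sup>2"
    proof (rule AE_I2)
      fix \<omega>
      have "(norm (Y k \<omega> - X k \<omega>))\<^sup>2 \<le> (2 * y_radius)\<^sup>2"
        using norm_X_minus_Y[OF k, of \<omega>] by (intro power_mono) (simp_all add: norm_minus_commute)
      then show "norm ((norm (Y k \<omega> - X k \<omega>))\<^sup>2) \<le> (2 * y_radius)\<^sup>2" by simp
    qed
    show "(\<lambda>\<omega>. (norm (Y k \<omega> - X k \<omega>))\<^sup>2) \<in> borel_measurable \<Omega>"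
      using measurable_XY(1,2)[OF k] by simp
  qed
qed

text \<open>\<open>X k\<close> and \<open>Y k\<close> are functions of the past, so the fresh sample may be integrated first with both of them
held fixed.\<close>
lemma expected_model_difference:
  assumes k: "k \<ge> 1" and i: "i \<in> {1..m}"
    and Lf: "Lf \<in> borel_measurable P" "integrable P Lf" "\<And>s. s \<in> space P \<Longrightarrow> 0 \<le> Lf s"
    and lip: "AE s in P. \<forall>u\<in>U. \<forall>v\<in>U. \<bar>fm u u s - fm u v s\<bar> \<le> Lf s * norm (u - v)"
    and FL: "\<And>u v. \<lbrakk>u \<in> U; v \<in> U\<rbrakk> \<Longrightarrow> \<bar>F u - F v\<bar> \<le> LF * norm (u - v)"
    and mean: "\<And>u v. \<lbrakk>u \<in> U; v \<in> U\<rbrakk> \<Longrightarrow> (\<integral>s. fm u v s - fm u u s \<partial>P) \<le> F v - F u + \<eta>b / 2 * (norm (v - u))\<^sup>2"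
  shows "integrable \<Omega> (\<lambda>\<omega>. fm (X k \<omega>) (Y k \<omega>) (S k i \<omega>) - fm (X k \<omega>) (X k \<omega>) (S k i \<omega>))"
    "(\<integral>\<omega>. fm (X k \<omega>) (Y k \<omega>) (S k i \<omega>) - fm (X k \<omega>) (X k \<omega>) (S k i \<omega>) \<partial>\<Omega>) \<le>
     (\<integral>\<omega>. F (Y k \<omega>) - F (X k \<omega>) + \<eta>b / 2 * (norm (Y k \<omega> - X k \<omega>))\<^sup>2 \<partial>\<Omega>)"
proof -
  note S = iid_minibatches_measurable[OF prob_\<Omega> iid k i]
  have YV: "Y k \<omega> \<in> V" for \<omega> using Y(2)[OF k] Xs_subset by blast
  let ?d = "\<lambda>\<omega>. fm (X k \<omega>) (Y k \<omega>) (S k i \<omega>) - fm (X k \<omega>) (X k \<omega>) (S k i \<omega>)"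
  let ?N = "restrict_space borel V \<Otimes>\<^sub>M restrict_space borel V"
  let ?Z = "\<lambda>\<omega>. (X k \<omega>, Y k \<omega>)"
  let ?h = "\<lambda>z. fm (fst (fst z)) (snd (fst z)) (snd z) - fm (fst (fst z)) (fst (fst z)) (snd z)"
  have dm: "?d \<in> borel_measurable \<Omega>"
    by (intro borel_measurable_diff borel_measurable_model measurable_XY[OF k] S(1) X_in_V YV)
  have Lm: "integrable \<Omega> (\<lambda>\<omega>. Lf (S k i \<omega>))"
    using integrable_distr_eq[OF S(1) Lf(1)] Lf(2) S(2) by simp
  show int: "integrable \<Omega> ?d"
  proof (rule Bochner_Integration.integrable_bound[OF _ dm])
    show "integrable \<Omega> (\<lambda>\<omega>. Lf (S k i \<omega>) * (2 * y_radius))" using Lm by simp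
    show "AE \<omega> in \<Omega>. norm (?d \<omega>) \<le> norm (Lf (S k i \<omega>) * (2 * y_radius))"
      using AE_sample[OF lip k i] AE_space
    proof eventually_elim
      case (elim \<omega>)
      have l: "0 \<le> Lf (S k i \<omega>)" using Lf(3) measurable_space[OF S(1) elim(2)] by blast
      have "\<bar>?d \<omega>\<bar> \<le> Lf (S k i \<omega>) * norm (X k \<omega> - Y k \<omega>)"
        using elim(1) X_in_U[OF k, of \<omega>] Y_in_U[OF k, of \<omega>] by (metis abs_minus_commute)
      also have "\<dots> \<le> Lf (S k i \<omega>) * (2 * y_radius)" using l norm_X_minus_Y[OF k] by (intro mult_left_mono)
      finally show ?case by simp
    qed
  qed
  have Zm: "?Z \<in> measurable (past k) ?N"
    using X_in_V YV by (intro measurable_Pair measurable_restrict_space2 measurable_X[OF k] Y(1)[OF k]) auto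
  have fst: "(\<lambda>z. fst (fst z)) \<in> measurable (?N \<Otimes>\<^sub>M P) borel" "(\<lambda>z. snd (fst z)) \<in> measurable (?N \<Otimes>\<^sub>M P) borel"
  proof -
    have id: "(\<lambda>u. u) \<in> measurable (restrict_space borel V) borel"
      by (rule measurable_restrict_space1) simp
    have "fst \<circ> fst \<in> measurable (?N \<Otimes>\<^sub>M P) (restrict_space borel V)"
      "snd \<circ> fst \<in> measurable (?N \<Otimes>\<^sub>M P) (restrict_space borel V)"
      by (rule measurable_comp[OF measurable_fst measurable_fst] measurable_comp[OF measurable_fst measurable_snd])+
    from measurable_compose[OF this(1) id] measurable_compose[OF this(2) id]
    show "(\<lambda>z. fst (fst z)) \<in> measurable (?N \<Otimes>\<^sub>M P) borel" "(\<lambda>z. snd (fst z)) \<in> measurable (?N \<Otimes>\<^sub>M P) borel"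
      by (simp_all add: comp_def)
  qed
  have hm: "?h \<in> borel_measurable (?N \<Otimes>\<^sub>M P)"
    by (intro borel_measurable_diff borel_measurable_model fst measurable_snd)
       (auto simp: space_pair_measure space_restrict_space)
  have "(\<integral>\<omega>. ?h (?Z \<omega>, S k i \<omega>) \<partial>\<Omega>) \<le>
     (\<integral>\<omega>. F (Y k \<omega>) - F (X k \<omega>) + \<eta>b / 2 * (norm (Y k \<omega> - X k \<omega>))\<^sup>2 \<partial>\<Omega>)"
  proof (rule integral_past_and_sample_le[OF prob_\<Omega> prob_P measurable_past[OF Zm] S(1)
        distr_past_and_minibatch[OF prob_\<Omega> iid k i Zm] hm])
    show "integrable \<Omega> (\<lambda>\<omega>. ?h (?Z \<omega>, S k i \<omega>))" using int by simp
    show "integrable \<Omega> (\<lambda>\<omega>. F (Y k \<omega>) - F (X k \<omega>) + \<eta>b / 2 * (norm (Y k \<omega> - X k \<omega>))\<^sup>2)"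
      using integrable_past_values[OF k FL] by simp
    show "(\<integral>s. ?h (?Z \<omega>, s) \<partial>P) \<le> F (Y k \<omega>) - F (X k \<omega>) + \<eta>b / 2 * (norm (Y k \<omega> - X k \<omega>))\<^sup>2" for \<omega>
      using mean[OF X_in_U[OF k] Y_in_U[OF k]] by simp
  qed
  then show "(\<integral>\<omega>. ?d \<omega> \<partial>\<Omega>) \<le> (\<integral>\<omega>. F (Y k \<omega>) - F (X k \<omega>) + \<eta>b / 2 * (norm (Y k \<omega> - X k \<omega>))\<^sup>2 \<partial>\<Omega>)"
    by simp
qed

text \<open>The Euclidean distance in the accuracy bound is converted into the norm of the preconditioner, which turns
\<open>\<eta>b\<close> into \<open>\<eta>\<close>.\<close>
lemma expected_gain:
  assumes k: "k \<ge> 1"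
    and Lf: "Lf \<in> borel_measurable P" "integrable P Lf" "\<And>s. s \<in> space P \<Longrightarrow> 0 \<le> Lf s"
    and lip: "AE s in P. \<forall>u\<in>U. \<forall>v\<in>U. \<bar>fm u u s - fm u v s\<bar> \<le> Lf s * norm (u - v)"
    and FL: "\<And>u v. \<lbrakk>u \<in> U; v \<in> U\<rbrakk> \<Longrightarrow> \<bar>F u - F v\<bar> \<le> LF * norm (u - v)"
    and mean: "\<And>u v. \<lbrakk>u \<in> U; v \<in> U\<rbrakk> \<Longrightarrow> (\<integral>s. fm u v s - fm u u s \<partial>P) \<le> F v - F u + \<eta>b / 2 * (norm (v - u))\<^sup>2"
  shows "integrable \<Omega> (model_gain k)"
    "2 * (\<integral>\<omega>. model_gain k \<omega> \<partial>\<Omega>) \<le> \<eta> * (\<integral>\<omega>. (N k \<omega> (Y k \<omega> - X k \<omega>))\<^sup>2 \<partial>\<Omega>)"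
proof -
  let ?d = "\<lambda>i \<omega>. fm (X k \<omega>) (Y k \<omega>) (S k i \<omega>) - fm (X k \<omega>) (X k \<omega>) (S k i \<omega>)"
  note d = expected_model_difference[OF k _ Lf lip FL mean]
  note iF = integrable_past_values[OF k FL]
  let ?G = "\<integral>\<omega>. F (Y k \<omega>) - F (X k \<omega>) + \<eta>b / 2 * (norm (Y k \<omega> - X k \<omega>))\<^sup>2 \<partial>\<Omega>"
  have isum: "integrable \<Omega> (\<lambda>\<omega>. \<Sum>i=1..m. ?d i \<omega>)" by (rule Bochner_Integration.integrable_sum[OF d(1)])
  then have id: "integrable \<Omega> (\<lambda>\<omega>. 1 / real m * (\<Sum>i=1..m. ?d i \<omega>))" by (rule integrable_mult_right)
  show "integrable \<Omega> (model_gain k)"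
    unfolding model_gain_def[abs_def] using id iF by simp
  let ?D = "\<integral>\<omega>. 1 / real m * (\<Sum>i=1..m. ?d i \<omega>) \<partial>\<Omega>"
  have g1: "(\<integral>\<omega>. model_gain k \<omega> \<partial>\<Omega>) = ?D - (\<integral>\<omega>. F (Y k \<omega>) \<partial>\<Omega>) + (\<integral>\<omega>. F (X k \<omega>) \<partial>\<Omega>)"
    unfolding model_gain_def using id iF by simp
  have "?D = 1 / real m * (\<Sum>i=1..m. \<integral>\<omega>. ?d i \<omega> \<partial>\<Omega>)"
    by (simp only: Bochner_Integration.integral_mult_right[OF isum] Bochner_Integration.integral_sum[OF d(1)])
  moreover have "1 / real m * (\<Sum>i=1..m. \<integral>\<omega>. ?d i \<omega> \<partial>\<Omega>) \<le> 1 / real m * (\<Sum>i=1..m. ?G)"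
    by (intro mult_left_mono sum_mono d(2)) auto
  moreover have "1 / real m * (\<Sum>i=1..m. ?G) = ?G" using m by simp
  ultimately have g2: "?D \<le> ?G" by linarith
  have g3: "?G = (\<integral>\<omega>. F (Y k \<omega>) \<partial>\<Omega>) - (\<integral>\<omega>. F (X k \<omega>) \<partial>\<Omega>) + \<eta>b / 2 * (\<integral>\<omega>. (norm (Y k \<omega> - X k \<omega>))\<^sup>2 \<partial>\<Omega>)"
    using iF by simp
  have g4: "(\<integral>\<omega>. \<eta>b * (norm (Y k \<omega> - X k \<omega>))\<^sup>2 \<partial>\<Omega>) = \<eta>b * (\<integral>\<omega>. (norm (Y k \<omega> - X k \<omega>))\<^sup>2 \<partial>\<Omega>)"
    by simp
  have 1: "2 * (\<integral>\<omega>. model_gain k \<omega> \<partial>\<Omega>) \<le> (\<integral>\<omega>. \<eta>b * (norm (Y k \<omega> - X k \<omega>))\<^sup>2 \<partial>\<Omega>)"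
    using g1 g2 g3 unfolding g4 by linarith
  have mYX: "(\<lambda>\<omega>. Y k \<omega> - X k \<omega>) \<in> borel_measurable \<Omega>" using measurable_XY[OF k] by simp
  have iN: "integrable \<Omega> (\<lambda>\<omega>. (N k \<omega> (Y k \<omega> - X k \<omega>))\<^sup>2)"
    by (rule integrable_norm_of_power2(1)[OF mYX, of "2 * y_radius"])
       (use norm_X_minus_Y[OF k] in \<open>simp add: norm_minus_commute\<close>)
  have "(\<integral>\<omega>. \<eta>b * (norm (Y k \<omega> - X k \<omega>))\<^sup>2 \<partial>\<Omega>) \<le> (\<integral>\<omega>. \<eta> * (N k \<omega> (Y k \<omega> - X k \<omega>))\<^sup>2 \<partial>\<Omega>)"
  proof (rule integral_mono_AE)
    show "AE \<omega> in \<Omega>. \<eta>b * (norm (Y k \<omega> - X k \<omega>))\<^sup>2 \<le> \<eta> * (N k \<omega> (Y k \<omega> - X k \<omega>))\<^sup>2"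
      using norm_equiv[of k]
    proof eventually_elim
      case (elim \<omega>)
      have "(norm (Y k \<omega> - X k \<omega>))\<^sup>2 \<le> (L * N k \<omega> (Y k \<omega> - X k \<omega>))\<^sup>2"
        using elim by (intro power_mono) auto
      then have "\<eta>b * (norm (Y k \<omega> - X k \<omega>))\<^sup>2 \<le> \<eta>b * (L\<^sup>2 * (N k \<omega> (Y k \<omega> - X k \<omega>))\<^sup>2)"
        using \<eta>b by (intro mult_left_mono) (auto simp: power_mult_distrib)
      then show ?case by (simp add: \<eta> mult.commute mult.left_commute)
    qed
  qed (use iN iF in simp_all)
  with 1 iN show "2 * (\<integral>\<omega>. model_gain k \<omega> \<partial>\<Omega>) \<le> \<eta> * (\<integral>\<omega>. (N k \<omega> (Y k \<omega> - X k \<omega>))\<^sup>2 \<partial>\<Omega>)" by simp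
qed

text \<open>Taking expectations in \<open>pointwise_step\<close>: the model gain contributes the factor \<open>1 + \<eta> \<alpha>\<^sub>k\<close>, the change of norm
the factor \<open>\<rho>\<^sub>k\<^sup>2\<close>, and the squared Lipschitz constants have a fixed mean.  Second-order terms are
rounded away: those on the left are nonnegative, and \<open>\<eta> \<delta> \<alpha>\<^sub>k\<^sup>2 \<le> \<delta> \<alpha>\<^sub>k\<close> on the right.\<close>
lemma merit_recursion:
  assumes \<delta>: "0 < \<delta>" "\<delta> \<le> \<rho>b"
  obtains C where "0 \<le> C" "\<And>k. k \<ge> 1 \<Longrightarrow>
    (1 + (2 * c1 - \<tau> - \<delta>) * \<alpha> k) * merit (k + 1) \<le> (1 + (\<eta> + 2 * \<delta>) * \<alpha> k) * ((\<rho> k)\<^sup>2 * merit k) + C * (\<alpha> k)\<^sup>2"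
proof -
  obtain Lf LF where Lf: "0 \<le> LF" "Lf \<in> borel_measurable P" "\<And>s. s \<in> space P \<Longrightarrow> 0 \<le> Lf s"
    "integrable P Lf" "integrable P (\<lambda>s. (Lf s)\<^sup>2)"
    "AE s in P. \<forall>u\<in>U. \<forall>v\<in>U. \<bar>fm u u s - fm u v s\<bar> \<le> Lf s * norm (u - v)"
    "\<And>u v. \<lbrakk>u \<in> U; v \<in> U\<rbrakk> \<Longrightarrow> \<bar>F u - F v\<bar> \<le> LF * norm (u - v)"
    "\<And>u v. \<lbrakk>u \<in> U; v \<in> U\<rbrakk> \<Longrightarrow> (\<integral>s. fm u v s - fm u u s \<partial>P) \<le> F v - F u + \<eta>b / 2 * (norm (v - u))\<^sup>2"
    by (rule model_differences[OF U]) blast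
  define C where "C = 4 * L\<^sup>2 * (\<integral>s. (Lf s)\<^sup>2 \<partial>P) + noise_const \<delta> LF"
  have C0: "0 \<le> C" unfolding C_def using noise_const_nonneg[OF \<delta>(1)] by simp
  show thesis
  proof (rule that[OF C0])
    fix k :: nat assume k: "k \<ge> 1"
    have a0: "0 < \<alpha> k" by (rule \<alpha>0[OF k])
    let ?Q = "(1 - \<tau> * \<alpha> k) * (1 - \<delta> * \<alpha> k) + 2 * \<alpha> k * c1"
    let ?n = "\<lambda>\<omega>. (N k \<omega> (X k \<omega> - Y k \<omega>))\<^sup>2"
    let ?n' = "\<lambda>\<omega>. (N k \<omega> (Y k \<omega> - X k \<omega>))\<^sup>2"
    let ?av = "\<lambda>\<omega>. 1 / real m * (\<Sum>i=1..m. (Lf (S k i \<omega>))\<^sup>2)"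
    let ?J = "\<lambda>\<omega>. ?n' \<omega> + 2 * \<alpha> k * model_gain k \<omega>"
    let ?B = "\<lambda>\<omega>. (1 + \<delta> * \<alpha> k) * ?J \<omega> + (\<alpha> k)\<^sup>2 * (4 * L\<^sup>2 * ?av \<omega> + noise_const \<delta> LF)"
    have nn: "(\<integral>\<omega>. ?n' \<omega> \<partial>\<Omega>) = (\<integral>\<omega>. ?n \<omega> \<partial>\<Omega>)"
      by (rule Bochner_Integration.integral_cong[OF refl])
         (simp add: norm_of_minus_commute[OF sa_pos_def_M, of _ k "Y k _"])
    have iS: "integrable \<Omega> (\<lambda>\<omega>. (Lf (S k i \<omega>))\<^sup>2)" "(\<integral>\<omega>. (Lf (S k i \<omega>))\<^sup>2 \<partial>\<Omega>) = (\<integral>s. (Lf s)\<^sup>2 \<partial>P)"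
      if i: "i \<in> {1..m}" for i
    proof -
      note S = iid_minibatches_measurable[OF prob_\<Omega> iid k i]
      have L2: "(\<lambda>s. (Lf s)\<^sup>2) \<in> borel_measurable P" using Lf(2) by simp
      show "integrable \<Omega> (\<lambda>\<omega>. (Lf (S k i \<omega>))\<^sup>2)"
        using integrable_distr_eq[OF S(1) L2] Lf(5) S(2) by simp
      show "(\<integral>\<omega>. (Lf (S k i \<omega>))\<^sup>2 \<partial>\<Omega>) = (\<integral>s. (Lf s)\<^sup>2 \<partial>P)"
        using integral_distr[OF S(1) L2] S(2) by simp
    qed
    have iS': "integrable \<Omega> (\<lambda>\<omega>. \<Sum>i=1..m. (Lf (S k i \<omega>))\<^sup>2)"
      by (rule Bochner_Integration.integrable_sum[OF iS(1)])
    then have iav: "integrable \<Omega> ?av" by (rule integrable_mult_right)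
    have av: "(\<integral>\<omega>. ?av \<omega> \<partial>\<Omega>) = (\<integral>s. (Lf s)\<^sup>2 \<partial>P)"
    proof -
      have "(\<integral>\<omega>. ?av \<omega> \<partial>\<Omega>) = 1 / real m * (\<Sum>i=1..m. \<integral>\<omega>. (Lf (S k i \<omega>))\<^sup>2 \<partial>\<Omega>)"
        by (simp only: Bochner_Integration.integral_mult_right[OF iS'] Bochner_Integration.integral_sum[OF iS(1)])
      then show ?thesis using iS(2) m by simp
    qed
    note gain = expected_gain[OF k Lf(2,4,3,6,7,8)]
    have mYX: "(\<lambda>\<omega>. Y k \<omega> - X k \<omega>) \<in> borel_measurable \<Omega>" using measurable_XY[OF k] by simp
    have in': "integrable \<Omega> ?n'"
      by (rule integrable_norm_of_power2(1)[OF mYX, of "2 * y_radius"])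
         (use norm_X_minus_Y[OF k] in \<open>simp add: norm_minus_commute\<close>)
    have iJ: "integrable \<Omega> ?J" using in' gain(1) by simp
    have k1: "k + 1 \<ge> 1" by simp
    have iN1: "integrable \<Omega> (\<lambda>\<omega>. (N k \<omega> (X (k + 1) \<omega> - Y (k + 1) \<omega>))\<^sup>2)"
      by (rule integrable_norm_of_power2(1)[OF measurable_past[OF measurable_XY(3)[OF k1]] norm_X_minus_Y[OF k1]])
    have "?Q * merit (k + 1) = (\<integral>\<omega>. ?Q * (N k \<omega> (X (k + 1) \<omega> - Y (k + 1) \<omega>))\<^sup>2 \<partial>\<Omega>)"
      using iN1 by (simp add: merit_def)
    also have "\<dots> \<le> (\<integral>\<omega>. ?B \<omega> \<partial>\<Omega>)"
    proof (rule integral_mono_AE)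
      show "AE \<omega> in \<Omega>. ?Q * (N k \<omega> (X (k + 1) \<omega> - Y (k + 1) \<omega>))\<^sup>2 \<le> ?B \<omega>"
        by (rule pointwise_step[OF k \<delta> Lf(1) Lf(3) Lf(6) Lf(7)])
      show "integrable \<Omega> (\<lambda>\<omega>. ?Q * (N k \<omega> (X (k + 1) \<omega> - Y (k + 1) \<omega>))\<^sup>2)"
        using iN1 by (rule integrable_mult_right)
      show "integrable \<Omega> ?B"
        by (intro Bochner_Integration.integrable_add integrable_mult_right iJ iav integrable_const)
    qed
    also have "\<dots> = (1 + \<delta> * \<alpha> k) * (\<integral>\<omega>. ?J \<omega> \<partial>\<Omega>) + (\<alpha> k)\<^sup>2 * (4 * L\<^sup>2 * (\<integral>\<omega>. ?av \<omega> \<partial>\<Omega>) + noise_const \<delta> LF)"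
    proof -
      have i2: "integrable \<Omega> (\<lambda>\<omega>. 4 * L\<^sup>2 * ?av \<omega>)" by (rule integrable_mult_right[OF iav])
      have i3: "integrable \<Omega> (\<lambda>\<omega>. 4 * L\<^sup>2 * ?av \<omega> + noise_const \<delta> LF)"
        by (rule Bochner_Integration.integrable_add[OF i2 integrable_const])
      have "(\<integral>\<omega>. 4 * L\<^sup>2 * ?av \<omega> + noise_const \<delta> LF \<partial>\<Omega>) = 4 * L\<^sup>2 * (\<integral>\<omega>. ?av \<omega> \<partial>\<Omega>) + noise_const \<delta> LF"
        unfolding Bochner_Integration.integral_add[OF i2 integrable_const]
          Bochner_Integration.integral_mult_right[OF iav] by (simp add: prob_space)
      then show ?thesis
        unfolding Bochner_Integration.integral_add[OF integrable_mult_right[OF iJ] integrable_mult_right[OF i3]]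
          Bochner_Integration.integral_mult_right[OF iJ] Bochner_Integration.integral_mult_right[OF i3]
        by (simp only:)
    qed
    also have "\<dots> = (1 + \<delta> * \<alpha> k) * (\<integral>\<omega>. ?J \<omega> \<partial>\<Omega>) + C * (\<alpha> k)\<^sup>2"
      unfolding av C_def by (simp add: mult.commute)
    finally have 1: "?Q * merit (k + 1) \<le> (1 + \<delta> * \<alpha> k) * (\<integral>\<omega>. ?J \<omega> \<partial>\<Omega>) + C * (\<alpha> k)\<^sup>2" .
    have "(\<integral>\<omega>. ?J \<omega> \<partial>\<Omega>) = (\<integral>\<omega>. ?n' \<omega> \<partial>\<Omega>) + \<alpha> k * (2 * (\<integral>\<omega>. model_gain k \<omega> \<partial>\<Omega>))"
      using in' gain(1) by simp
    also have "\<dots> \<le> (\<integral>\<omega>. ?n' \<omega> \<partial>\<Omega>) + \<alpha> k * (\<eta> * (\<integral>\<omega>. ?n' \<omega> \<partial>\<Omega>))"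
      using gain(2) a0 by (intro add_left_mono mult_left_mono) auto
    also have "\<dots> = (1 + \<eta> * \<alpha> k) * (\<integral>\<omega>. ?n \<omega> \<partial>\<Omega>)" unfolding nn by (simp add: algebra_simps)
    also have "\<dots> \<le> (1 + \<eta> * \<alpha> k) * ((\<rho> k)\<^sup>2 * merit k)"
      using expected_norm_change[OF k] \<eta>0 a0 by (intro mult_left_mono) auto
    finally have "(1 + \<delta> * \<alpha> k) * (\<integral>\<omega>. ?J \<omega> \<partial>\<Omega>) \<le> (1 + \<delta> * \<alpha> k) * ((1 + \<eta> * \<alpha> k) * ((\<rho> k)\<^sup>2 * merit k))"
      using \<delta> a0 by (intro mult_left_mono) auto
    also have "\<dots> = ((1 + \<delta> * \<alpha> k) * (1 + \<eta> * \<alpha> k)) * ((\<rho> k)\<^sup>2 * merit k)" by simp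
    also have "\<dots> \<le> (1 + (\<eta> + 2 * \<delta>) * \<alpha> k) * ((\<rho> k)\<^sup>2 * merit k)"
    proof (rule mult_right_mono)
      have "\<eta> * \<alpha> k \<le> \<rho>b * \<alpha> k" using \<rho>b \<tau>0 a0 by (intro mult_right_mono) auto
      then have "\<eta> * \<alpha> k \<le> 1" using step_small[OF k] by (simp add: mult.commute)
      then have "\<delta> * \<alpha> k * (\<eta> * \<alpha> k) \<le> \<delta> * \<alpha> k * 1" using \<delta> a0 by (intro mult_left_mono) auto
      then show "(1 + \<delta> * \<alpha> k) * (1 + \<eta> * \<alpha> k) \<le> 1 + (\<eta> + 2 * \<delta>) * \<alpha> k" by (simp add: algebra_simps)
      show "0 \<le> (\<rho> k)\<^sup>2 * merit k" using merit_nonneg by simp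
    qed
    finally have 2: "(1 + \<delta> * \<alpha> k) * (\<integral>\<omega>. ?J \<omega> \<partial>\<Omega>) \<le> (1 + (\<eta> + 2 * \<delta>) * \<alpha> k) * ((\<rho> k)\<^sup>2 * merit k)" .
    have "(1 + (2 * c1 - \<tau> - \<delta>) * \<alpha> k) * merit (k + 1) \<le> ?Q * merit (k + 1)"
    proof (rule mult_right_mono[OF _ merit_nonneg])
      have "0 \<le> \<tau> * \<alpha> k * (\<delta> * \<alpha> k)" using \<tau>0 \<delta> a0 by simp
      then show "1 + (2 * c1 - \<tau> - \<delta>) * \<alpha> k \<le> ?Q" by (simp add: algebra_simps)
    qed
    with 1 2 show "(1 + (2 * c1 - \<tau> - \<delta>) * \<alpha> k) * merit (k + 1) \<le>
        (1 + (\<eta> + 2 * \<delta>) * \<alpha> k) * ((\<rho> k)\<^sup>2 * merit k) + C * (\<alpha> k)\<^sup>2" by linarith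
  qed
qed

text \<open>The difference of the two linear coefficients is \<open>2 c1 - \<tau> - \<eta> - 3 \<delta>\<close>, so a small \<open>\<delta>\<close> keeps it above any
threshold that lies strictly below \<open>2 c1 - \<tau> - \<eta>\<close>.\<close>
lemma merit_rate:
  assumes rho: "\<rho> 0 = 1" "\<And>k. k \<ge> 1 \<Longrightarrow> 1 \<le> \<rho> k" "convergent_prod \<rho>"
    and alpha: "\<And>k. k \<ge> 1 \<Longrightarrow> \<alpha>l * real k powr (- \<beta>) \<le> \<alpha> k \<and> \<alpha> k \<le> \<alpha>u * real k powr (- \<beta>)"
    and \<alpha>l: "0 < \<alpha>l" and \<beta>: "0 < \<beta>" "\<beta> \<le> 1" and p: "0 \<le> p" "p \<le> \<beta>"
    and pos: "0 < 2 * c1 - \<tau> - \<eta>" and gap: "\<beta> < 1 \<or> p < (2 * c1 - \<tau> - \<eta>) * \<alpha>l"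
  shows "merit \<in> O(\<lambda>k. real k powr (- p))"
proof -
  define g where "g = 2 * c1 - \<tau> - \<eta> - (if \<beta> < 1 then 0 else p / \<alpha>l)"
  have g: "0 < g" using pos gap \<alpha>l by (auto simp: g_def pos_divide_less_eq)
  have g': "g \<le> 2 * c1 - \<tau> - \<eta>" using p \<alpha>l by (simp add: g_def)
  define \<delta> where "\<delta> = min \<rho>b (g / 6)"
  have \<delta>: "0 < \<delta>" "\<delta> \<le> \<rho>b" "3 * \<delta> < g" using g \<rho>b0 by (auto simp: \<delta>_def)
  obtain C where C: "0 \<le> C" "\<And>k. k \<ge> 1 \<Longrightarrow>
    (1 + (2 * c1 - \<tau> - \<delta>) * \<alpha> k) * merit (k + 1) \<le> (1 + (\<eta> + 2 * \<delta>) * \<alpha> k) * ((\<rho> k)\<^sup>2 * merit k) + C * (\<alpha> k)\<^sup>2"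
    using merit_recursion[OF \<delta>(1,2)] by blast
  show ?thesis
  proof (rule rate_of_preconditioned_recursion[OF merit_nonneg merit_le rho C(2) _ _ C(1) alpha \<alpha>l \<beta> p])
    show "0 \<le> \<eta> + 2 * \<delta>" using \<eta>0 \<delta> by simp
    show "\<eta> + 2 * \<delta> < 2 * c1 - \<tau> - \<delta>" using \<delta> g' by simp
    show "\<beta> < 1 \<or> p < (2 * c1 - \<tau> - \<delta> - (\<eta> + 2 * \<delta>)) * \<alpha>l"
    proof (cases "\<beta> < 1")
      case False
      then have "p / \<alpha>l < 2 * c1 - \<tau> - \<delta> - (\<eta> + 2 * \<delta>)" using \<delta>(3) by (simp add: g_def)
      then show ?thesis using \<alpha>l by (simp add: pos_divide_less_eq)
    qed simp
  qed
qed

text \<open>On the event that all iterates are bounded by \<open>R\<close>, none of them has been replaced, and \<open>Y k\<close> is one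
of the solutions.\<close>
lemma bounded_event_estimate:
  assumes k: "k \<ge> 1"
  shows "set_integrable \<Omega> (bounded_event \<Omega> x R) (\<lambda>\<omega>. (infdist (x k \<omega>) Xs)\<^sup>2)"
    "0 \<le> (LINT \<omega>:bounded_event \<Omega> x R|\<Omega>. (infdist (x k \<omega>) Xs)\<^sup>2)"
    "(LINT \<omega>:bounded_event \<Omega> x R|\<Omega>. (infdist (x k \<omega>) Xs)\<^sup>2) \<le> L\<^sup>2 * merit k"
proof -
  let ?E = "bounded_event \<Omega> x R"
  have E: "?E = {\<omega> \<in> space \<Omega>. \<forall>j\<in>{1..}. norm (x j \<omega>) \<le> R}"
    by (auto simp: bounded_event_def SUP_le_iff)
  have xm: "x j \<in> borel_measurable \<Omega>" if "j \<ge> 1" for j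
    by (rule measurable_past[OF measurable_x[OF that]])
  have "Measurable.pred \<Omega> (\<lambda>\<omega>. \<forall>j\<in>{1..}. norm (x j \<omega>) \<le> R)"
  proof (rule pred_intros_countable_bounded(3))
    fix j :: nat assume "j \<in> {1..}"
    then show "Measurable.pred \<Omega> (\<lambda>\<omega>. norm (x j \<omega>) \<le> R)" using xm[of j] by simp
  qed
  then have Em: "?E \<in> sets \<Omega>" unfolding E by (simp add: pred_def)
  let ?g = "\<lambda>\<omega>. indicator ?E \<omega> *\<^sub>R (infdist (x k \<omega>) Xs)\<^sup>2"
  have gm: "?g \<in> borel_measurable \<Omega>"
  proof -
    have "(\<lambda>u. infdist u Xs) \<in> borel_measurable borel"
      by (intro borel_measurable_continuous_onI continuous_on_infdist continuous_on_id)
    from measurable_compose[OF xm[OF k] this] show ?thesis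
      using Em by (intro borel_measurable_scaleR borel_measurable_indicator borel_measurable_power)
  qed
  have "norm (?g \<omega>) \<le> (\<bar>R\<bar> + norm anchor)\<^sup>2" for \<omega>
  proof (cases "\<omega> \<in> ?E")
    case True
    then have "norm (x k \<omega>) \<le> R" using k by (simp add: E)
    moreover have "infdist (x k \<omega>) Xs \<le> dist (x k \<omega>) anchor" by (rule infdist_le[OF anchor])
    moreover have "dist (x k \<omega>) anchor \<le> norm (x k \<omega>) + norm anchor"
      unfolding dist_norm by (rule norm_triangle_ineq4)
    ultimately have "infdist (x k \<omega>) Xs \<le> \<bar>R\<bar> + norm anchor" by linarith
    then show ?thesis using True by (simp add: power_mono infdist_nonneg)
  qed simp
  then have gi: "integrable \<Omega> ?g"
    by (intro integrable_const_bound[OF _ gm] AE_I2)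
  then show "set_integrable \<Omega> ?E (\<lambda>\<omega>. (infdist (x k \<omega>) Xs)\<^sup>2)" by (simp add: set_integrable_def)
  show "0 \<le> (LINT \<omega>:?E|\<Omega>. (infdist (x k \<omega>) Xs)\<^sup>2)"
    unfolding set_lebesgue_integral_def by (rule integral_nonneg_AE) simp
  have iN: "integrable \<Omega> (\<lambda>\<omega>. (N (k - 1) \<omega> (X k \<omega> - Y k \<omega>))\<^sup>2)"
    by (rule integrable_norm_of_power2(1)[OF measurable_past[OF measurable_XY(3)[OF k]] norm_X_minus_Y[OF k]])
  have xV: "AE \<omega> in \<Omega>. x k \<omega> \<in> V"
    using run k unfolding ispPPA_def by (auto elim: eventually_mono)
  have "(LINT \<omega>:?E|\<Omega>. (infdist (x k \<omega>) Xs)\<^sup>2) \<le> (\<integral>\<omega>. L\<^sup>2 * (N (k - 1) \<omega> (X k \<omega> - Y k \<omega>))\<^sup>2 \<partial>\<Omega>)"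
    unfolding set_lebesgue_integral_def
  proof (rule integral_mono_AE[OF gi])
    show "AE \<omega> in \<Omega>. ?g \<omega> \<le> L\<^sup>2 * (N (k - 1) \<omega> (X k \<omega> - Y k \<omega>))\<^sup>2"
      using xV norm_equiv[of "k - 1"]
    proof eventually_elim
      case (elim \<omega>)
      show ?case
      proof (cases "\<omega> \<in> ?E")
        case True
        then have "good k \<omega>" using elim(1) by (auto simp: E good_def)
        then have X: "X k \<omega> = x k \<omega>" by (simp add: X_def)
        have "infdist (x k \<omega>) Xs \<le> norm (X k \<omega> - Y k \<omega>)"
          using infdist_le[OF Y(2)[OF k, of \<omega>], of "x k \<omega>"] by (simp add: dist_norm X)
        also have "\<dots> \<le> L * N (k - 1) \<omega> (X k \<omega> - Y k \<omega>)" using elim(2) by blast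
        finally have "(infdist (x k \<omega>) Xs)\<^sup>2 \<le> (L * N (k - 1) \<omega> (X k \<omega> - Y k \<omega>))\<^sup>2"
          by (rule power_mono) (rule infdist_nonneg)
        then show ?thesis using True by (simp add: power_mult_distrib)
      qed simp
    qed
  qed (use iN in simp)
  also have "\<dots> = L\<^sup>2 * merit k" using iN by (simp add: merit_def)
  finally show "(LINT \<omega>:?E|\<Omega>. (infdist (x k \<omega>) Xs)\<^sup>2) \<le> L\<^sup>2 * merit k" .
qed

lemma bounded_event_rate:
  assumes "merit \<in> O(h)"
  shows "(\<lambda>k. LINT \<omega>:bounded_event \<Omega> x R|\<Omega>. (infdist (x k \<omega>) Xs)\<^sup>2) \<in> O(h)"
proof -
  have "(\<lambda>k. LINT \<omega>:bounded_event \<Omega> x R|\<Omega>. (infdist (x k \<omega>) Xs)\<^sup>2) \<in> O(merit)"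
  proof (rule bigoI)
    show "\<forall>\<^sub>F k in sequentially. norm (LINT \<omega>:bounded_event \<Omega> x R|\<Omega>. (infdist (x k \<omega>) Xs)\<^sup>2) \<le> L\<^sup>2 * norm (merit k)"
      using eventually_ge_at_top[of 1]
      by eventually_elim (use bounded_event_estimate merit_nonneg in simp)
  qed
  then show ?thesis using assms by (rule landau_o.big_trans)
qed

end

text \<open>For \<open>\<beta> = 1\<close> every exponent \<open>p \<le> 1\<close> below \<open>2 c\<tau>\<eta> \<alpha>l0\<close> is available.  With \<open>a = s c1t \<alpha>l0\<close> the exponent
of the first regime is \<open>2 a / (2 + a)\<close>; it is at most \<open>a\<close>, which lies below \<open>2 c\<tau>\<eta> \<alpha>l0\<close> because \<open>s < 2\<close> and
\<open>c1t \<le> c\<tau>\<eta>\<close>, and it is at most 1 because that regime means \<open>a < 2\<close>.  In the other two regimes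
\<open>c\<tau>\<eta> \<alpha>l0 > 1\<close>, so \<open>p = 1\<close> is available; on the boundary this is even better than the logarithmic bound.\<close>
theorem corollary2p14:
  fixes \<Omega> :: "'w measure" and P :: "'s measure"
    and f :: "'a::euclidean_space \<Rightarrow> 's \<Rightarrow> ereal"
    and fm :: "'a \<Rightarrow> 'a \<Rightarrow> 's \<Rightarrow> real"
    and r :: "'a \<Rightarrow> ereal" and V :: "'a set"
    and m :: nat and S :: "nat \<Rightarrow> nat \<Rightarrow> 'w \<Rightarrow> 's"
    and M :: "nat \<Rightarrow> 'w \<Rightarrow> 'a \<Rightarrow> 'a"
    and \<alpha> \<epsilon> :: "nat \<Rightarrow> real"
    and x1 :: 'a and x :: "nat \<Rightarrow> 'w \<Rightarrow> 'a"
    and \<mu>min Lmax \<eta>b \<tau>b c1b \<eta> \<tau> c1 \<gamma> \<rho>b \<alpha>l0 \<alpha>u0 \<beta> s c\<tau>\<eta> c1t :: real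
    and Xs :: "'a set"
  assumes "prob_space \<Omega>" and "prob_space P"
    and "model_setting P V fm r"
    and "model_accuracy P V f fm \<eta>b"
    and "preconditioner_condition \<Omega> P m S M \<mu>min Lmax"
    and "regularity_condition P V f fm r \<tau>b"
    and "local_lipschitz_condition P V fm"
    and "quadratic_growth (objective P f r) c1b"
    and "Xs = argmin_set (objective P f r)" and "Xs \<noteq> {}"
    and "\<eta> = Lmax\<^sup>2 * \<eta>b" and "\<tau> = Lmax\<^sup>2 * \<tau>b" and "c1 = \<mu>min\<^sup>2 * c1b"
    and "ispPPA \<Omega> P V fm r \<tau> m S M \<alpha> \<epsilon> x1 x"
    and "0 \<le> \<gamma>" and "\<eta> + \<tau> < \<rho>b"
    and "\<alpha>l0 \<in> {0 <..< inverse \<rho>b}" and "\<alpha>u0 \<in> {0 <..< inverse \<rho>b}" and "\<beta> \<in> {0 <.. 1}"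
    and "\<And>k. k \<ge> 1 \<Longrightarrow> \<alpha>l0 * real k powr (- \<beta>) \<le> \<alpha> k \<and> \<alpha> k \<le> \<alpha>u0 * real k powr (- \<beta>)"
    and "\<And>k. k \<ge> 1 \<Longrightarrow> \<epsilon> k = \<gamma> * \<alpha> k powr (3 / 2)"
    and "s \<in> {0 <..< 2}"
    and "c\<tau>\<eta> = c1 - (\<tau> + \<eta>) / 2" and "c1t = \<rho>b * c\<tau>\<eta> / (\<rho>b + \<eta>)"
    and "c1 > (\<tau> + \<eta>) / 2"
  shows "\<forall>R::real.
    (\<forall>k\<ge>1. set_integrable \<Omega> (bounded_event \<Omega> x R) (\<lambda>\<omega>. (infdist (x k \<omega>) Xs)\<^sup>2)) \<and>
    (\<beta> < 1 \<longrightarrow>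
       (\<lambda>k. LINT \<omega>:bounded_event \<Omega> x R|\<Omega>. (infdist (x k \<omega>) Xs)\<^sup>2)
         \<in> O(\<lambda>k. real k powr (- \<beta>))) \<and>
    (\<beta> = 1 \<longrightarrow>
       (c\<tau>\<eta> * \<alpha>l0 < 2 / s * (1 + \<eta> / \<rho>b) \<longrightarrow>
          (\<lambda>k. LINT \<omega>:bounded_event \<Omega> x R|\<Omega>. (infdist (x k \<omega>) Xs)\<^sup>2)
            \<in> O(\<lambda>k. real k powr (- (2 * s * c1t * \<alpha>l0 / (2 + s * c1t * \<alpha>l0))))) \<and>
       (c\<tau>\<eta> * \<alpha>l0 = 2 / s * (1 + \<eta> / \<rho>b) \<longrightarrow>
          (\<lambda>k. LINT \<omega>:bounded_event \<Omega> x R|\<Omega>. (infdist (x k \<omega>) Xs)\<^sup>2)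
            \<in> O(\<lambda>k. real k powr (- 1) * ln (real k))) \<and>
       (c\<tau>\<eta> * \<alpha>l0 > 2 / s * (1 + \<eta> / \<rho>b) \<longrightarrow>
          (\<lambda>k. LINT \<omega>:bounded_event \<Omega> x R|\<Omega>. (infdist (x k \<omega>) Xs)\<^sup>2)
            \<in> O(\<lambda>k. real k powr (- 1))))"
proof (intro allI conjI impI)
  fix R :: real
  obtain \<mu>' L' \<rho> :: "nat \<Rightarrow> real" where pc: "\<rho> 0 = 1" "convergent_prod \<rho>"
    "\<forall>k\<ge>1. \<mu>min \<le> \<mu>' k \<and> 0 < L' k \<and> L' k \<le> Lmax \<and> 1 \<le> \<rho> k \<and>
       (AE \<omega> in \<Omega>. \<forall>v. \<mu>' k * norm_of (M k \<omega>) v \<le> norm v \<and> norm v \<le> L' k * norm_of (M k \<omega>) v) \<and>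
       (\<forall>v. v \<noteq> 0 \<longrightarrow> (AE \<omega> in \<Omega>.
          1 / (\<rho> k)\<^sup>2 \<le> real_cond_exp \<Omega> (minibatch_sigma \<Omega> P m S (k - 1))
             (\<lambda>\<omega>. (norm_of (M k \<omega>) v)\<^sup>2 / (norm_of (M (k - 1) \<omega>) v)\<^sup>2) \<omega> \<and>
          real_cond_exp \<Omega> (minibatch_sigma \<Omega> P m S (k - 1))
             (\<lambda>\<omega>. (norm_of (M k \<omega>) v)\<^sup>2 / (norm_of (M (k - 1) \<omega>) v)\<^sup>2) \<omega> \<le> (\<rho> k)\<^sup>2))"
    using assms(5) unfolding preconditioner_condition_def by blast
  have pd: "sa_pos_def (M k \<omega>)" if "k \<ge> 1" "\<omega> \<in> space \<Omega>" for k \<omega>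
    using assms(14) that by (simp add: ispPPA_def)
  have norms: "AE \<omega> in \<Omega>. \<forall>v. \<mu>min * norm_of (M k \<omega>) v \<le> norm v \<and> norm v \<le> Lmax * norm_of (M k \<omega>) v"
    if k: "k \<ge> 1" for k
  proof -
    note pck = pc(3)[rule_format, OF k]
    have "AE \<omega> in \<Omega>. \<forall>v. \<mu>' k * norm_of (M k \<omega>) v \<le> norm v \<and> norm v \<le> L' k * norm_of (M k \<omega>) v"
      using pck by blast
    then show ?thesis using AE_space
    proof eventually_elim
      case (elim \<omega>)
      have n: "0 \<le> norm_of (M k \<omega>) v" for v by (rule norm_of_nonneg[OF pd[OF k elim(2)]])
      have "\<mu>min * norm_of (M k \<omega>) v \<le> \<mu>' k * norm_of (M k \<omega>) v"
        "L' k * norm_of (M k \<omega>) v \<le> Lmax * norm_of (M k \<omega>) v" for v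
        using pck n by (auto intro: mult_right_mono)
      with elim(1) show ?case by (blast intro: order_trans)
    qed
  qed
  have Lmax: "0 < \<mu>min" "\<mu>min \<le> 1" "1 \<le> Lmax" "\<forall>\<omega>\<in>space \<Omega>. M 0 \<omega> = (\<lambda>v. v)"
    using assms(5) by (auto simp: preconditioner_condition_def)
  have \<beta>: "0 < \<beta>" "\<beta> \<le> 1" and \<alpha>l0: "0 < \<alpha>l0" "\<alpha>l0 < inverse \<rho>b" and \<alpha>u0: "0 < \<alpha>u0" "\<alpha>u0 < inverse \<rho>b"
    and s: "0 < s" "s < 2"
    using assms(17-19,22) by auto
  have \<rho>bp: "0 < \<rho>b" using \<alpha>l0 by (metis inverse_positive_iff_positive less_trans)
  have small: "\<alpha> k * \<rho>b < 1" if k: "k \<ge> 1" for k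
  proof -
    have "real k powr (- \<beta>) \<le> 1" using k \<beta> by (simp add: powr_minus inverse_le_1_iff ge_one_powr_ge_zero)
    then have "\<alpha>u0 * real k powr (- \<beta>) \<le> \<alpha>u0 * 1" using \<alpha>u0 by (intro mult_left_mono) auto
    then have "\<alpha> k < inverse \<rho>b" using assms(20)[OF k] \<alpha>u0 by linarith
    then have "\<alpha> k * \<rho>b < inverse \<rho>b * \<rho>b" using \<rho>bp by (intro mult_strict_right_mono)
    then show ?thesis using \<rho>bp by simp
  qed
  have M0: "M 0 \<omega> = (\<lambda>v. v)" if "\<omega> \<in> space \<Omega>" for \<omega> using Lmax(4) that by blast
  have ratio: "AE \<omega> in \<Omega>. real_cond_exp \<Omega> (minibatch_sigma \<Omega> P m S (k - 1))
      (\<lambda>\<omega>. (norm_of (M k \<omega>) v)\<^sup>2 / (norm_of (M (k - 1) \<omega>) v)\<^sup>2) \<omega> \<le> (\<rho> k)\<^sup>2"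
    if "k \<ge> 1" "v \<noteq> 0" for k v
    using pc(3)[rule_format, OF that(1)] that(2) by (auto elim: eventually_mono)
  interpret localized_ispPPA \<Omega> P f fm r V m S M \<alpha> \<epsilon> \<rho> x1 x \<mu>min Lmax \<eta>b \<tau>b c1b \<eta> \<tau> c1 \<gamma> \<rho>b R Xs
    by (rule localized_ispPPA.intro) (fact assms Lmax M0 norms ratio small)+
  have rho1: "1 \<le> \<rho> k" if "k \<ge> 1" for k using pc(3) that by blast
  have gap0: "2 * c1 - \<tau> - \<eta> = 2 * c\<tau>\<eta>" unfolding assms(23) by (simp add: field_simps)
  have c0: "0 < c\<tau>\<eta>" using assms(23,25) by simp
  note rate = bounded_event_rate[OF merit_rate[OF pc(1) rho1 pc(2) assms(20) \<alpha>l0(1) \<beta>], unfolded gap0]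
  show "set_integrable \<Omega> (bounded_event \<Omega> x R) (\<lambda>\<omega>. (infdist (x k \<omega>) Xs)\<^sup>2)" if "1 \<le> k" for k
    by (rule bounded_event_estimate(1)[OF that])
  let ?E = "\<lambda>k. LINT \<omega>:bounded_event \<Omega> x R|\<Omega>. (infdist (x k \<omega>) Xs)\<^sup>2"
  show "?E \<in> O(\<lambda>k. real k powr (- \<beta>))" if "\<beta> < 1"
    using c0 \<beta> that by (intro rate) auto
  have ratio_eq: "1 + \<eta> / \<rho>b = (\<rho>b + \<eta>) / \<rho>b" using \<rho>bp by (simp add: add_divide_distrib)
  have rp: "0 < \<rho>b + \<eta>" using \<rho>bp \<eta>0 by simp
  have fast: "?E \<in> O(\<lambda>k. real k powr (- 1))" if \<beta>1: "\<beta> = 1" and h: "c\<tau>\<eta> * \<alpha>l0 \<ge> 2 / s * (1 + \<eta> / \<rho>b)"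
  proof (rule rate)
    have "1 < 2 / s * 1" using s by simp
    also have "\<dots> \<le> 2 / s * (1 + \<eta> / \<rho>b)" using s \<eta>0 \<rho>bp by (intro mult_left_mono) auto
    finally have "1 < c\<tau>\<eta> * \<alpha>l0" using h by linarith
    then show "\<beta> < 1 \<or> 1 < 2 * c\<tau>\<eta> * \<alpha>l0" by simp
  qed (use \<beta>1 c0 in auto)
  show "?E \<in> O(\<lambda>k. real k powr (- 1))" if "\<beta> = 1" "c\<tau>\<eta> * \<alpha>l0 > 2 / s * (1 + \<eta> / \<rho>b)"
    using fast that by simp
  show "?E \<in> O(\<lambda>k. real k powr (- 1) * ln (real k))" if "\<beta> = 1" "c\<tau>\<eta> * \<alpha>l0 = 2 / s * (1 + \<eta> / \<rho>b)"
  proof -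
    have "(\<lambda>k. real k powr (- 1)) \<in> O(\<lambda>k. real k powr (- 1) * ln (real k))"
    proof (rule bigoI[of _ 1])
      show "\<forall>\<^sub>F k in sequentially. norm (real k powr (- 1)) \<le> 1 * norm (real k powr (- 1) * ln (real k))"
        using eventually_ge_at_top[of 3]
      proof eventually_elim
        case (elim k)
        have "exp 1 \<le> real k" using elim e_less_272 by simp
        then have "1 \<le> ln (real k)" using elim by (simp add: ln_ge_iff)
        then have "real k powr (- 1) * 1 \<le> real k powr (- 1) * ln (real k)" by (intro mult_left_mono) auto
        then show ?case using \<open>1 \<le> ln (real k)\<close> by simp
      qed
    qed
    with fast that show ?thesis by (auto intro: landau_o.big_trans)
  qed
  show "?E \<in> O(\<lambda>k. real k powr (- (2 * s * c1t * \<alpha>l0 / (2 + s * c1t * \<alpha>l0))))"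
    if \<beta>1: "\<beta> = 1" and h: "c\<tau>\<eta> * \<alpha>l0 < 2 / s * (1 + \<eta> / \<rho>b)"
  proof (rule rate)
    define a where "a = s * c1t * \<alpha>l0"
    have "c1t \<le> c\<tau>\<eta>" "0 < c1t"
      using assms(24) c0 \<rho>bp rp \<eta>0 by (auto simp: pos_divide_le_eq algebra_simps)
    then have a0: "0 < a" and "a \<le> s * c\<tau>\<eta> * \<alpha>l0"
      using s \<alpha>l0 by (auto simp: a_def intro!: mult_right_mono mult_left_mono)
    moreover have "s * (c\<tau>\<eta> * \<alpha>l0) < 2 * (c\<tau>\<eta> * \<alpha>l0)"
      using s c0 \<alpha>l0 by (intro mult_strict_right_mono) auto
    ultimately have a1: "a < 2 * c\<tau>\<eta> * \<alpha>l0" by (simp add: mult.assoc)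
    have "a = s * (c\<tau>\<eta> * \<alpha>l0) * (\<rho>b / (\<rho>b + \<eta>))" by (simp add: a_def assms(24))
    also have "\<dots> < s * (2 / s * (1 + \<eta> / \<rho>b)) * (\<rho>b / (\<rho>b + \<eta>))"
      using h s \<rho>bp rp by (intro mult_strict_right_mono mult_strict_left_mono) auto
    also have "\<dots> = 2 * ((\<rho>b + \<eta>) / \<rho>b * (\<rho>b / (\<rho>b + \<eta>)))" unfolding ratio_eq using s by simp
    also have "(\<rho>b + \<eta>) / \<rho>b * (\<rho>b / (\<rho>b + \<eta>)) = 1" using \<rho>bp rp by simp
    finally have a2: "a < 2" by simp
    have p: "2 * s * c1t * \<alpha>l0 / (2 + s * c1t * \<alpha>l0) = 2 * a / (2 + a)" by (simp add: a_def)
    show "0 \<le> 2 * s * c1t * \<alpha>l0 / (2 + s * c1t * \<alpha>l0)" unfolding p using a0 by simp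
    show "2 * s * c1t * \<alpha>l0 / (2 + s * c1t * \<alpha>l0) \<le> \<beta>"
      unfolding p \<beta>1 using a0 a2 by (simp add: pos_divide_le_eq)
    have "2 * a / (2 + a) \<le> a" using a0 by (simp add: pos_divide_le_eq algebra_simps)
    with a1 show "\<beta> < 1 \<or> 2 * s * c1t * \<alpha>l0 / (2 + s * c1t * \<alpha>l0) < 2 * c\<tau>\<eta> * \<alpha>l0"
      unfolding p by linarith
  qed (use c0 in auto)
qed

end
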